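(* Let $p$ be an odd prime, $\mathfrak{g}$ a finite nilpotent Lie ring of $p$-power order and nilpotence class less than $p$, $G=\mathrm{Exp}(\mathfrak{g})$, and $f\in\mathfrak{g}^*$. Then for all polarizations $\mathfrak{p}_1,\mathfrak{p}_2,\mathfrak{p}_3$ of $f$, $$\alpha(\mathfrak{p}_1,\mathfrak{p}_2,\mathfrak{p}_3)=\alpha(\mathfrak{p}_1^f,\mathfrak{p}_2^f,\mathfrak{p}_3^f),$$ where the right-hand side is computed for the Lie ring $\mathfrak{g}^f$, the functional $\bar f$, and the group $\mathrm{Exp}(\mathfrak{g}^f)$.
   Context: A Lie ring is an abelian group with a biadditive bracket satisfying Jacobi and $[x,x]=0$. $G=\mathrm{Exp}(\mathfrak{g})$ has the same underlying set as $\mathfrak{g}$ with product $x*y=\sum_{i<p}\mathrm{CH}_i(x,y)$ (truncated Campbell–Hausdorff series $x+y+\frac12[x,y]+\cdots$); $\exp,\log$ denote the identity maps. $\mathfrak{g}^*=\mathrm{Hom}(\mathfrak{g},\mathbb{C}^\times)$. A polarization of $f$ is a Lie subring $\mathfrak{p}$ with $f([\mathfrak{p},\mathfrak{p}])=\{1\}$, maximal among additive subgroups with this property. For a polarization $\mathfrak{p}$, $P=\exp(\mathfrak{p})$, $\chi_f(x)=f(\log x)$ is a character of $P$, and $V_{f,\mathfrak{p}}=\{\phi:G\to\mathbb{C}:\phi(xg)=\chi_f(x)\phi(g)\ \forall x\in P\}$ with $G$ acting by right translation; this is irreducible. Define $\Phi_{\mathfrak{p}_1,\mathfrak{p}_2}:V_{f,\mathfrak{p}_2}\to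 V_{f,\mathfrak{p}_1}$ by $(\Phi_{\mathfrak{p}_1,\mathfrak{p}_2}\phi)(g)=\frac{1}{\sqrt{|\mathfrak{p}_1||\mathfrak{p}_1\cap\mathfrak{p}_2|}}\sum_{x\in P_1}\chi_f^{-1}(x)\phi(xg)$; $\alpha(\mathfrak{p}_1,\mathfrak{p}_2,\mathfrak{p}_3)$ is the scalar with $\Phi_{\mathfrak{p}_1,\mathfrak{p}_2}\circ\Phi_{\mathfrak{p}_2,\mathfrak{p}_3}\circ\Phi_{\mathfrak{p}_3,\mathfrak{p}_1}=\alpha(\mathfrak{p}_1,\mathfrak{p}_2,\mathfrak{p}_3)\mathrm{Id}$. Reduction: let $B_f(x,y)=f([x,y])$ and $\mathfrak{z}\subset\mathbb{C}^\times$ the image of $B_f$ (a finite cyclic group, written multiplicatively). $\mathfrak{g}^f$ is the abelian group $\mathfrak{g}\oplus\mathfrak{z}$ with $\mathfrak{z}$ central and $[x,y]=B_f(x,y)\in\mathfrak{z}$ for $x,y\in\mathfrak{g}$ (Heisenberg bracket); $\bar f:\mathfrak{g}^f\to\mathbb{C}^\times$ is the projection to $\mathfrak{z}$ followed by inclusion; for a polarization $\mathfrak{p}$ of $f$, $\mathfrak{p}^f:=\mathfrak{p}\oplus\mathfrak{z}$, which is a polarization of $\bar f$. *)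

theory Defs
  imports Complex_Main "HOL-Computational_Algebra.Primes"
begin

record 'a lie_ring =
  lcarrier :: "'a set"
  ladd :: "'a \<Rightarrow> 'a \<Rightarrow> 'a"
  lzero :: 'a
  lneg :: "'a \<Rightarrow> 'a"
  lbr :: "'a \<Rightarrow> 'a \<Rightarrow> 'a"

definition lie_ring :: "'a lie_ring \<Rightarrow> bool" where
  "lie_ring L \<longleftrightarrow>
     lzero L \<in> lcarrier L \<and>
     (\<forall>x\<in>lcarrier L. \<forall>y\<in>lcarrier L. ladd L x y \<in> lcarrier L) \<and>
     (\<forall>x\<in>lcarrier L. lneg L x \<in> lcarrier L) \<and>
     (\<forall>x\<in>lcarrier L. \<forall>y\<in>lcarrier L. lbr L x y \<in> lcarrier L) \<and>
     (\<forall>x\<in>lcarrier L. \<forall>y\<in>lcarrier L. \<forall>z\<in>lcarrier L.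
         ladd L (ladd L x y) z = ladd L x (ladd L y z)) \<and>
     (\<forall>x\<in>lcarrier L. \<forall>y\<in>lcarrier L. ladd L x y = ladd L y x) \<and>
     (\<forall>x\<in>lcarrier L. ladd L (lzero L) x = x) \<and>
     (\<forall>x\<in>lcarrier L. ladd L (lneg L x) x = lzero L) \<and>
     (\<forall>x\<in>lcarrier L. \<forall>y\<in>lcarrier L. \<forall>z\<in>lcarrier L.
         lbr L (ladd L x y) z = ladd L (lbr L x z) (lbr L y z) \<and>
         lbr L x (ladd L y z) = ladd L (lbr L x y) (lbr L x z)) \<and>
     (\<forall>x\<in>lcarrier L. lbr L x x = lzero L) \<and>
     (\<forall>x\<in>lcarrier L. \<forall>y\<in>lcarrier L. \<forall>z\<in>lcarrier L.
         ladd L (ladd L (lbr L x (lbr L y z)) (lbr L y (lbr L z x))) (lbr L z (lbr L x y))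
           = lzero L)"

inductive_set lspan :: "'a lie_ring \<Rightarrow> 'a set \<Rightarrow> 'a set" for L S where
  zero: "lzero L \<in> lspan L S"
| gen: "x \<in> S \<Longrightarrow> x \<in> lspan L S"
| add: "a \<in> lspan L S \<Longrightarrow> b \<in> lspan L S \<Longrightarrow> ladd L a b \<in> lspan L S"
| neg: "a \<in> lspan L S \<Longrightarrow> lneg L a \<in> lspan L S"

text \<open>Lower central series: lcs L k is gamma_(k+1).\<close>
fun lcs :: "'a lie_ring \<Rightarrow> nat \<Rightarrow> 'a set" where
  "lcs L 0 = lcarrier L"
| "lcs L (Suc k) = lspan L {lbr L x y | x y. x \<in> lcarrier L \<and> y \<in> lcs L k}"

definition nilpotent_class_less :: "'a lie_ring \<Rightarrow> nat \<Rightarrow> bool" where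
  "nilpotent_class_less L p \<longleftrightarrow> lcs L (p - 1) = {lzero L}"

definition add_subgroup :: "'a lie_ring \<Rightarrow> 'a set \<Rightarrow> bool" where
  "add_subgroup L S \<longleftrightarrow> S \<subseteq> lcarrier L \<and> lzero L \<in> S \<and>
     (\<forall>x\<in>S. \<forall>y\<in>S. ladd L x y \<in> S) \<and> (\<forall>x\<in>S. lneg L x \<in> S)"

definition lie_subring :: "'a lie_ring \<Rightarrow> 'a set \<Rightarrow> bool" where
  "lie_subring L S \<longleftrightarrow> add_subgroup L S \<and> (\<forall>x\<in>S. \<forall>y\<in>S. lbr L x y \<in> S)"

definition is_char :: "'a lie_ring \<Rightarrow> ('a \<Rightarrow> complex) \<Rightarrow> bool" where
  "is_char L f \<longleftrightarrow> (\<forall>x\<in>lcarrier L. f x \<noteq> 0) \<and>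
     (\<forall>x\<in>lcarrier L. \<forall>y\<in>lcarrier L. f (ladd L x y) = f x * f y)"

definition polarization :: "'a lie_ring \<Rightarrow> ('a \<Rightarrow> complex) \<Rightarrow> 'a set \<Rightarrow> bool" where
  "polarization L f P \<longleftrightarrow> lie_subring L P \<and>
     (\<forall>x\<in>P. \<forall>y\<in>P. f (lbr L x y) = 1) \<and>
     (\<forall>Q. add_subgroup L Q \<and> P \<subseteq> Q \<and> (\<forall>x\<in>Q. \<forall>y\<in>Q. f (lbr L x y) = 1) \<longrightarrow> Q = P)"

section \<open>Truncated Campbell--Hausdorff product (Dynkin's form)\<close>

definition lsum :: "'a lie_ring \<Rightarrow> 'a list \<Rightarrow> 'a" where
  "lsum L xs = foldr (ladd L) xs (lzero L)"

definition nsmul :: "'a lie_ring \<Rightarrow> nat \<Rightarrow> 'a \<Rightarrow> 'a" where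
  "nsmul L n x = (ladd L x ^^ n) (lzero L)"

text \<open>Action of a rational a/b (b prime to the group order N) : multiplication by a * b^{-1} mod N.\<close>
definition rat_smul :: "'a lie_ring \<Rightarrow> rat \<Rightarrow> 'a \<Rightarrow> 'a" where
  "rat_smul L q x =
     (let (a, b) = quotient_of q; N = int (card (lcarrier L));
          c = (SOME c. (b * c) mod N = 1 mod N)
      in nsmul L (nat ((a * c) mod N)) x)"

fun nest :: "'a lie_ring \<Rightarrow> 'a list \<Rightarrow> 'a" where
  "nest L [] = lzero L"
| "nest L [a] = a"
| "nest L (a # w) = lbr L a (nest L w)"

definition dyn_word :: "'a \<Rightarrow> 'a \<Rightarrow> (nat \<times> nat) list \<Rightarrow> 'a list" where
  "dyn_word x y rs = concat (map (\<lambda>(r, s). replicate r x @ replicate s y) rs)"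

definition dyn_index :: "nat \<Rightarrow> (nat \<times> nat) list list" where
  "dyn_index m = concat (map (\<lambda>n. filter
      (\<lambda>rs. (\<forall>(r, s)\<in>set rs. 1 \<le> r + s) \<and> sum_list (map (\<lambda>(r, s). r + s) rs) = m)
      (List.n_lists n (List.product [0..<m+1] [0..<m+1]))) [1..<m+1])"

definition dyn_coeff :: "nat \<Rightarrow> (nat \<times> nat) list \<Rightarrow> rat" where
  "dyn_coeff m rs = (-1) ^ (length rs - 1) /
     (of_nat (length rs) * of_nat m * prod_list (map (\<lambda>(r, s). of_nat (fact r * fact s)) rs))"

definition CH :: "'a lie_ring \<Rightarrow> nat \<Rightarrow> 'a \<Rightarrow> 'a \<Rightarrow> 'a" where
  "CH L m x y = lsum L (map (\<lambda>rs. rat_smul L (dyn_coeff m rs) (nest L (dyn_word x y rs)))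
                          (dyn_index m))"

definition exp_mul :: "'a lie_ring \<Rightarrow> nat \<Rightarrow> 'a \<Rightarrow> 'a \<Rightarrow> 'a" where
  "exp_mul L p x y = lsum L (map (\<lambda>m. CH L m x y) [1..<p])"

definition Vspace :: "'a lie_ring \<Rightarrow> nat \<Rightarrow> ('a \<Rightarrow> complex) \<Rightarrow> 'a set \<Rightarrow> ('a \<Rightarrow> complex) set" where
  "Vspace L p f P = {\<phi>. \<forall>x\<in>P. \<forall>g\<in>lcarrier L. \<phi> (exp_mul L p x g) = f x * \<phi> g}"

definition Phi :: "'a lie_ring \<Rightarrow> nat \<Rightarrow> ('a \<Rightarrow> complex) \<Rightarrow> 'a set \<Rightarrow> 'a set
                   \<Rightarrow> ('a \<Rightarrow> complex) \<Rightarrow> ('a \<Rightarrow> complex)" where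
  "Phi L p f P1 P2 \<phi> = (\<lambda>g. complex_of_real (1 / sqrt (real (card P1 * card (P1 \<inter> P2)))) *
       (\<Sum>x\<in>P1. inverse (f x) * \<phi> (exp_mul L p x g)))"

definition alpha :: "'a lie_ring \<Rightarrow> nat \<Rightarrow> ('a \<Rightarrow> complex) \<Rightarrow> 'a set \<Rightarrow> 'a set \<Rightarrow> 'a set \<Rightarrow> complex" where
  "alpha L p f P1 P2 P3 = (THE c. \<forall>\<phi>\<in>Vspace L p f P1. \<forall>g\<in>lcarrier L.
      Phi L p f P1 P2 (Phi L p f P2 P3 (Phi L p f P3 P1 \<phi>)) g = c * \<phi> g)"

definition zset :: "'a lie_ring \<Rightarrow> ('a \<Rightarrow> complex) \<Rightarrow> complex set" where
  "zset L f = {f (lbr L x y) | x y. x \<in> lcarrier L \<and> y \<in> lcarrier L}"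

definition reduce :: "'a lie_ring \<Rightarrow> ('a \<Rightarrow> complex) \<Rightarrow> ('a \<times> complex) lie_ring" where
  "reduce L f = \<lparr> lcarrier = lcarrier L \<times> zset L f,
      ladd = (\<lambda>(x, a) (y, b). (ladd L x y, a * b)),
      lzero = (lzero L, 1),
      lneg = (\<lambda>(x, a). (lneg L x, inverse a)),
      lbr = (\<lambda>(x, a) (y, b). (lzero L, f (lbr L x y))) \<rparr>"

definition reduce_char :: "'a \<times> complex \<Rightarrow> complex" where
  "reduce_char = snd"

definition reduce_pol :: "'a lie_ring \<Rightarrow> ('a \<Rightarrow> complex) \<Rightarrow> 'a set \<Rightarrow> ('a \<times> complex) set" where
  "reduce_pol L f P = P \<times> zset L f"

end

theory Submission
  imports Defs "HOL-Computational_Algebra.Computational_Algebra" "HOL-Number_Theory.Cong"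
    "HOL-Algebra.FiniteProduct"
begin

text \<open>Both sides are \<open>T \<circ> T \<circ> T\<close> for averaging operators \<open>T\<close>, hence scalars by Schur's lemma; evaluating
  at the function supported on the first polarization gives the sum of
  \<open>f (z \<star> y) / (f y * f z)\<close> over \<open>y \<in> P2\<close>, \<open>z \<in> P3\<close> with \<open>z \<star> y \<in> P1\<close>, respectively the sum of
  \<open>f (\<lbrakk>z, y\<rbrakk> / 2)\<close> over those with \<open>z + y \<in> P1\<close>. Both scalars satisfy the same 2-cocycle identity.

  If \<open>f\<close> is nontrivial on commutators, choose \<open>u\<close> such that \<open>\<lbrakk>x, \<lbrakk>y, u\<rbrakk>\<rbrakk>\<close> always lies in an ideal inside
  the kernel of \<open>f\<close> and \<open>x \<mapsto> f \<lbrakk>x, u\<rbrakk>\<close> is a nontrivial character of order \<open>p\<close>, with kernel \<open>h\<close>. For a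
  polarization \<open>P\<close>, the polarization \<open>P' = (P \<inter> h) + \<langle>u\<rangle>\<close> lies in \<open>h\<close>, and for triples \<open>(P, P', R)\<close>
  the two sums agree term by term. The cocycle identity then replaces each \<open>P\<close> by \<open>P'\<close>, and induction
  applies to the smaller ring \<open>h\<close>. Irreducibility of the induced representations is proved along the
  same induction.

  Associativity of the product is reduced to free noncommutative series: Dynkin's formula follows from
  the differential equation of \<open>log (exp (s u) * exp (s v))\<close> in \<open>s\<close>, and an identity between Lie
  polynomials of degree less than \<open>p\<close> transfers from the free algebra to any Lie ring of \<open>p\<close>-power
  order by the Dynkin operator, without the Poincare-Birkhoff-Witt theorem.\<close>

section \<open>Noncommutative power series\<close>

text \<open>The textbook argument would pass to subrings and to quotients by ideals in the kernel of
  \<open>f\<close>. Rational scalars are defined through the order of the ring, so each such passage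
  would call for a comparison of the products. Here \<open>L\<close> stays fixed: the induction runs
  over subrings \<open>S\<close> of \<open>L\<close>, polarizations are taken relative to
  \<open>S\<close>, and a quotient is replaced by statements modulo an additive subgroup
  \<open>n\<close>. For the same reason the averaging operators carry no normalization; the square
  roots return only when \<open>alpha\<close> is evaluated.

  The element \<open>u\<close> is chosen so that the product of anything with a multiple of
  \<open>u\<close> stops at the half bracket, up to an error that \<open>f\<close> does not see.
  This is why a triple containing \<open>P\<close> and \<open>P'\<close> is accessible, whereas an
  arbitrary triple involves all terms of degree below \<open>p\<close>.

  The reduced ring is again a Lie ring of \<open>p\<close>-power order, of class at most two, and
  two is less than \<open>p\<close> because \<open>p\<close> is odd. All results on averaging
  operators therefore apply to it as a second instance, and neither the cocycle identity nor
  irreducibility has to be proved again. Oddness also supplies the scalar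
  \<open>1 / 2\<close>.\<close>

text \<open>The coefficients are polynomials in a central parameter, with respect to which exponentials will
  be differentiated.\<close>

typedef 'l ncs = "UNIV :: ('l list \<Rightarrow> rat poly) set"
  morphisms cf Abs_ncs by simp

lemma cf_Abs [simp]: "cf (Abs_ncs u) = u"
  by (simp add: Abs_ncs_inverse)

lemma ncs_eqI: "(\<And>w. cf u w = cf v w) \<Longrightarrow> u = v"
  by (metis cf_inverse ext)

text \<open>The Cauchy product over all ways to cut a word into a prefix and a suffix. The recursion
  separates the nonempty prefixes, which begin with the letter \<open>a\<close>, from the empty
  one.\<close>

primrec conv :: "'l list \<Rightarrow> ('l list \<Rightarrow> rat poly) \<Rightarrow> ('l list \<Rightarrow> rat poly) \<Rightarrow> rat poly" where
  "conv [] u v = u [] * v []"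
| "conv (a # w) u v = conv w (\<lambda>x. u (a # x)) v + u [] * v (a # w)"

lemma conv_add_left: "conv w (\<lambda>x. u x + u' x) v = conv w u v + conv w u' v"
  by (induction w arbitrary: u u') (simp_all add: algebra_simps)

lemma conv_add_right: "conv w u (\<lambda>x. v x + v' x) = conv w u v + conv w u v'"
  by (induction w arbitrary: u) (simp_all add: algebra_simps)

lemma conv_scale_left: "conv w (\<lambda>x. c * u x) v = c * conv w u v"
  by (induction w arbitrary: u) (simp_all add: algebra_simps)

lemma conv_scale_right: "conv w u (\<lambda>x. c * v x) = c * conv w u v"
  by (induction w arbitrary: u) (simp_all add: algebra_simps)

lemma conv_zero_left: "conv w (\<lambda>x. 0) v = 0"
  by (induction w) simp_all

lemma conv_assoc: "conv w (\<lambda>x. conv x t u) v = conv w t (\<lambda>x. conv x u v)"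
  by (induction w arbitrary: t u)
    (simp_all add: conv_add_left conv_scale_left algebra_simps)

lemma conv_one_left: "conv w (\<lambda>x. if x = [] then 1 else 0) v = v w"
  by (cases w) (simp_all add: conv_zero_left)

lemma conv_one_right: "conv w u (\<lambda>x. if x = [] then 1 else 0) = u w"
  by (induction w arbitrary: u) simp_all

instantiation ncs :: (type) ring_1
begin

definition "0 = Abs_ncs (\<lambda>w. 0)"
definition "1 = Abs_ncs (\<lambda>w. if w = [] then 1 else 0)"
definition "u + v = Abs_ncs (\<lambda>w. cf u w + cf v w)"
definition "u - v = Abs_ncs (\<lambda>w. cf u w - cf v w)"
definition "- u = Abs_ncs (\<lambda>w. - cf u w)"
definition "u * v = Abs_ncs (\<lambda>w. conv w (cf u) (cf v))"

lemma cf_zero [simp]: "cf 0 w = 0"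
  and cf_one: "cf 1 w = (if w = [] then 1 else 0)"
  and cf_add [simp]: "cf (u + v) w = cf u w + cf v w"
  and cf_diff [simp]: "cf (u - v) w = cf u w - cf v w"
  and cf_minus [simp]: "cf (- u) w = - cf u w"
  and cf_times: "cf (u * v) w = conv w (cf u) (cf v)"
  by (simp_all add: zero_ncs_def one_ncs_def plus_ncs_def minus_ncs_def uminus_ncs_def times_ncs_def)

instance
proof
  fix u v w :: "'a ncs"
  show "u * v * w = u * (v * w)"
    by (rule ncs_eqI) (simp add: times_ncs_def conv_assoc)
  show "1 * u = u"
    by (rule ncs_eqI) (simp add: times_ncs_def one_ncs_def conv_one_left)
  show "u * 1 = u"
    by (rule ncs_eqI) (simp add: times_ncs_def one_ncs_def conv_one_right)
  show "(u + v) * w = u * w + v * w"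
    by (rule ncs_eqI) (simp add: times_ncs_def plus_ncs_def conv_add_left)
  show "u * (v + w) = u * v + u * w"
    by (rule ncs_eqI) (simp add: times_ncs_def plus_ncs_def conv_add_right)
  show "(0::'a ncs) \<noteq> 1"
    by (metis cf_one cf_zero zero_neq_one)
qed (auto intro: ncs_eqI)

end

lemma cf_sum [simp]: "cf (sum F A) w = (\<Sum>i\<in>A. cf (F i) w)"
  by (induction A rule: infinite_finite_induct) simp_all

definition sc :: "rat poly \<Rightarrow> 'l ncs \<Rightarrow> 'l ncs" where
  "sc c u = Abs_ncs (\<lambda>w. c * cf u w)"

lemma cf_sc [simp]: "cf (sc c u) w = c * cf u w"
  by (simp add: sc_def)

lemma sc_add_right: "sc c (u + v) = sc c u + sc c v"
  and sc_diff_right: "sc c (u - v) = sc c u - sc c v"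
  and sc_add_left: "sc (c + d) u = sc c u + sc d u"
  and sc_sc [simp]: "sc c (sc d u) = sc (c * d) u"
  and sc_one [simp]: "sc 1 u = u"
  and sc_zero_left [simp]: "sc 0 u = 0"
  and sc_zero_right [simp]: "sc c 0 = 0"
  by (auto intro!: ncs_eqI simp: algebra_simps)

lemma sc_mult_left [simp]: "sc c u * v = sc c (u * v)"
  by (rule ncs_eqI) (simp add: cf_times conv_scale_left sc_def)

lemma sc_mult_right [simp]: "u * sc c v = sc c (u * v)"
  by (rule ncs_eqI) (simp add: cf_times conv_scale_right sc_def)

lemma sc_sum: "sc c (sum F A) = (\<Sum>i\<in>A. sc c (F i))"
  by (rule ncs_eqI) (simp add: sum_distrib_left)

lemma sc_sum_left: "sc (sum F A) u = (\<Sum>i\<in>A. sc (F i) u)"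
  by (rule ncs_eqI) (simp add: sum_distrib_right)

lemma sum_const_poly: "(\<Sum>i\<in>A. [:F i:]) = [:\<Sum>i\<in>A. F i:]"
  by (induction A rule: infinite_finite_induct) simp_all

lemma sc_pCons_add: "sc [:a:] u + sc [:b:] u = sc [:a + b:] u"
  by (simp flip: sc_add_left)

subsection \<open>The degree filtration\<close>

definition filt :: "nat \<Rightarrow> 'l ncs \<Rightarrow> bool" where
  "filt k u \<longleftrightarrow> (\<forall>w. length w < k \<longrightarrow> cf u w = 0)"

lemma filt_0 [simp]: "filt 0 u"
  and filt_zero [simp]: "filt k 0"
  and filt_add: "filt k u \<Longrightarrow> filt k v \<Longrightarrow> filt k (u + v)"
  and filt_diff: "filt k u \<Longrightarrow> filt k v \<Longrightarrow> filt k (u - v)"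
  and filt_minus: "filt k u \<Longrightarrow> filt k (- u)"
  and filt_sc: "filt k u \<Longrightarrow> filt k (sc c u)"
  and filt_mono: "filt k u \<Longrightarrow> l \<le> k \<Longrightarrow> filt l u"
  by (auto simp: filt_def)

lemma filt_sum: "(\<And>i. i \<in> A \<Longrightarrow> filt k (F i)) \<Longrightarrow> filt k (sum F A)"
  by (simp add: filt_def)

lemma conv_filt:
  assumes "\<And>x. length x < i \<Longrightarrow> u x = 0" "\<And>x. length x < j \<Longrightarrow> v x = 0" "length w < i + j"
  shows "conv w u v = 0"
  using assms
proof (induction w arbitrary: u i)
  case Nil
  then show ?case by (cases "i = 0") auto
next
  case (Cons a w)
  show ?case
  proof (cases i)
    case 0
    have "conv w (\<lambda>x. u (a # x)) v = 0"
      by (rule Cons.IH[of 0]) (use Cons.prems 0 in auto)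
    then show ?thesis using Cons.prems 0 by simp
  next
    case (Suc i')
    have "conv w (\<lambda>x. u (a # x)) v = 0"
      by (rule Cons.IH[of i']) (use Cons.prems Suc in auto)
    then show ?thesis using Cons.prems Suc by simp
  qed
qed

lemma filt_mult: "filt i u \<Longrightarrow> filt j v \<Longrightarrow> filt (i + j) (u * v)"
  by (auto simp: filt_def cf_times intro: conv_filt)

lemma filt_power: "filt 1 u \<Longrightarrow> filt n (u ^ n)"
proof (induction n)
  case (Suc n)
  then show ?case using filt_mult[of 1 u n "u ^ n"] by simp
qed simp

section \<open>Commutators and operators that raise the degree\<close>

definition comm :: "'l ncs \<Rightarrow> 'l ncs \<Rightarrow> 'l ncs" where
  "comm u v = u * v - v * u"

lemma filt_comm: "filt i u \<Longrightarrow> filt j v \<Longrightarrow> filt (i + j) (comm u v)"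
  unfolding comm_def by (metis add.commute filt_diff filt_mult)

text \<open>Left multiplication by a series without constant term and the commutator with it are
  both of this kind. One calculus of power series in an operator thus serves exponentials of
  elements and exponentials of their adjoint action.\<close>

definition raising :: "('l ncs \<Rightarrow> 'l ncs) \<Rightarrow> bool" where
  "raising T \<longleftrightarrow> (\<forall>x y. T (x + y) = T x + T y) \<and> (\<forall>c x. T (sc c x) = sc c (T x)) \<and>
     (\<forall>k x. filt k x \<longrightarrow> filt (Suc k) (T x))"

lemma raising_add: "raising T \<Longrightarrow> T (x + y) = T x + T y"
  and raising_sc: "raising T \<Longrightarrow> T (sc c x) = sc c (T x)"
  and raising_filt: "raising T \<Longrightarrow> filt k x \<Longrightarrow> filt (Suc k) (T x)"
  by (auto simp: raising_def)

lemma raising_zero: "raising T \<Longrightarrow> T 0 = 0"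
  using raising_sc[of T 0 0] by simp

lemma raising_diff: "raising T \<Longrightarrow> T (x - y) = T x - T y"
  using raising_add[of T "x - y" y] by (simp add: algebra_simps)

lemma raising_sum: "raising T \<Longrightarrow> T (sum F A) = (\<Sum>i\<in>A. T (F i))"
  by (induction A rule: infinite_finite_induct) (simp_all add: raising_zero raising_add)

lemma raising_pow:
  assumes "raising T"
  shows "(T ^^ n) (x + y) = (T ^^ n) x + (T ^^ n) y"
    "(T ^^ n) (x - y) = (T ^^ n) x - (T ^^ n) y"
    "(T ^^ n) (sc c x) = sc c ((T ^^ n) x)"
    "(T ^^ n) (sum F A) = (\<Sum>i\<in>A. (T ^^ n) (F i))"
    "filt k x \<Longrightarrow> filt (n + k) ((T ^^ n) x)"
  by (induction n) (use assms in \<open>simp_all add: raising_add raising_diff raising_sc raising_sum raising_filt\<close>)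

lemma raising_lmult: "filt 1 g \<Longrightarrow> raising ((*) g)"
  using filt_mult[of 1 g] by (simp add: raising_def distrib_left)

lemma raising_comm: "filt 1 g \<Longrightarrow> raising (comm g)"
  using filt_comm[of 1 g] by (simp add: raising_def comm_def algebra_simps sc_diff_right)

lemma lmult_pow: "(((*) g) ^^ n) z = g ^ n * (z :: 'l ncs)"
  by (induction n) (simp_all add: mult.assoc)

section \<open>Power series in degree-raising operators, modulo degree M\<close>

locale truncated =
  fixes M :: nat
  assumes M2: "2 \<le> M"
begin

definition eqv :: "'l ncs \<Rightarrow> 'l ncs \<Rightarrow> bool"  (infix \<open>\<approx>\<close> 50) where
  "u \<approx> v \<longleftrightarrow> filt M (u - v)"

lemma eqv_refl [simp]: "u \<approx> u"
  by (simp add: eqv_def)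

lemma eqv_sym: "u \<approx> v \<Longrightarrow> v \<approx> u"
  unfolding eqv_def by (metis filt_minus minus_diff_eq)

lemma eqv_trans [trans]: "u \<approx> v \<Longrightarrow> v \<approx> w \<Longrightarrow> u \<approx> w"
  unfolding eqv_def using filt_add[of M "u - v" "v - w"] by simp

lemma eqv_add: "u \<approx> v \<Longrightarrow> u' \<approx> v' \<Longrightarrow> u + u' \<approx> v + v'"
  unfolding eqv_def using filt_add[of M "u - v" "u' - v'"] by (simp add: algebra_simps)

lemma eqv_diff: "u \<approx> v \<Longrightarrow> u' \<approx> v' \<Longrightarrow> u - u' \<approx> v - v'"
  unfolding eqv_def using filt_diff[of M "u - v" "u' - v'"] by (simp add: algebra_simps)

lemma eqv_sc: "u \<approx> v \<Longrightarrow> sc c u \<approx> sc c v"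
  unfolding eqv_def using filt_sc[of M "u - v"] by (simp add: sc_diff_right)

lemma eqv_sum: "(\<And>i. i \<in> A \<Longrightarrow> F i \<approx> F' i) \<Longrightarrow> sum F A \<approx> sum F' A"
  by (induction A rule: infinite_finite_induct) (simp_all add: eqv_add)

lemma eqv_mult: assumes "u \<approx> v" "u' \<approx> v'" shows "u * u' \<approx> v * v'"
proof -
  have "filt M ((u - v) * u')" "filt M (v * (u' - v'))"
    using filt_mult[of M "u - v" 0 u'] filt_mult[of 0 v M "u' - v'"] assms by (simp_all add: eqv_def)
  from filt_add[OF this] show ?thesis by (simp add: eqv_def algebra_simps)
qed

lemma eqv_power: "u \<approx> v \<Longrightarrow> u ^ n \<approx> v ^ n"
  by (induction n) (simp_all add: eqv_mult)

lemma eqv_add_filt: "filt M r \<Longrightarrow> u \<approx> u + r"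
  unfolding eqv_def using filt_minus[of M r] by simp

lemma raising_eqv: "raising T \<Longrightarrow> u \<approx> v \<Longrightarrow> T u \<approx> T v"
  unfolding eqv_def using raising_filt[of T M "u - v"] filt_mono[of "Suc M" _ M]
  by (simp add: raising_diff)

lemma raising_pow_eqv: "raising T \<Longrightarrow> u \<approx> v \<Longrightarrow> (T ^^ n) u \<approx> (T ^^ n) v"
  by (induction n) (simp_all add: raising_eqv)

text \<open>The triangle of pairs with \<open>i + j < M\<close> and the full square differ only by
  terms of degree at least \<open>M\<close>.\<close>

lemma eqv_double_sum:
  assumes "\<And>i j. filt (i + j) (a i j)"
  shows "(\<Sum>n<M. \<Sum>i\<le>n. a i (n - i)) \<approx> (\<Sum>i<M. \<Sum>j<M. a i j)"
proof -
  have "(\<Sum>n<M. \<Sum>i\<le>n. a i (n - i)) = (\<Sum>(n, i)\<in>(SIGMA n:{..<M}. {..n}). a i (n - i))"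
    by (simp add: sum.Sigma)
  also have "\<dots> = (\<Sum>(i, j)\<in>{(i, j). i + j < M}. a i j)"
    by (rule sum.reindex_bij_witness[of _ "\<lambda>(i, j). (i + j, i)" "\<lambda>(n, i). (i, n - i)"]) auto
  also have "\<dots> = (\<Sum>(i, j)\<in>({..<M} \<times> {..<M}) \<inter> {(i, j). i + j < M}. a i j)"
    by (rule sum.cong) auto
  also have "\<dots> \<approx> (\<Sum>(i, j)\<in>{..<M} \<times> {..<M}. a i j)"
  proof -
    have "(\<Sum>(i, j)\<in>{..<M} \<times> {..<M}. a i j) =
        (\<Sum>(i, j)\<in>({..<M} \<times> {..<M}) \<inter> {(i, j). i + j < M}. a i j) +
        (\<Sum>(i, j)\<in>({..<M} \<times> {..<M}) - {(i, j). i + j < M}. a i j)"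
      by (rule sum.Int_Diff) simp
    moreover have "filt M (\<Sum>(i, j)\<in>({..<M} \<times> {..<M}) - {(i, j). i + j < M}. a i j)"
      by (intro filt_sum) (auto intro: filt_mono[OF assms])
    ultimately show ?thesis
      by (metis eqv_add_filt)
  qed
  finally show ?thesis by (simp add: sum.cartesian_product)
qed

text \<open>The sum stops at \<open>M\<close>, where powers of a raising operator become negligible,
  so products and compositions of series are respected up to \<open>\<approx>\<close>. The bound
  \<open>2 \<le> M\<close> keeps the coefficients of degree zero and one, which makes evaluation at
  \<open>1\<close> and \<open>fps_X\<close> exact.\<close>

definition ev :: "rat fps \<Rightarrow> ('l ncs \<Rightarrow> 'l ncs) \<Rightarrow> 'l ncs \<Rightarrow> 'l ncs" where
  "ev F T z = (\<Sum>j<M. sc [:F $ j:] ((T ^^ j) z))"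

lemma ev_one [simp]: "ev 1 T z = z"
proof -
  obtain m where m: "M = Suc m" using M2 by (cases M) auto
  show ?thesis
    unfolding ev_def unfolding m by (simp add: sum.lessThan_Suc_shift del: sum.lessThan_Suc flip: one_pCons)
qed

lemma ev_eqv: "raising T \<Longrightarrow> z \<approx> z' \<Longrightarrow> ev F T z \<approx> ev F T z'"
  unfolding ev_def by (intro eqv_sum eqv_sc raising_pow_eqv)

lemma ev_mult:
  assumes T: "raising T"
  shows "ev F T (ev K T z) \<approx> ev (F * K) T z"
proof -
  have "ev F T (ev K T z) = (\<Sum>i<M. \<Sum>j<M. sc [:F $ i * K $ j:] ((T ^^ (i + j)) z))"
    unfolding ev_def
    by (simp add: raising_pow[OF T] sc_sum funpow_add mult.commute)
  also have "\<dots> \<approx> (\<Sum>n<M. \<Sum>i\<le>n. sc [:F $ i * K $ (n - i):] ((T ^^ (i + (n - i))) z))"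
    by (intro eqv_sym[OF eqv_double_sum] filt_sc) (use raising_pow(5)[OF T, of 0 z] in simp)
  also have "(\<Sum>n<M. \<Sum>i\<le>n. sc [:F $ i * K $ (n - i):] ((T ^^ (i + (n - i))) z)) = ev (F * K) T z"
  proof -
    have "(\<Sum>i\<le>n. sc [:F $ i * K $ (n - i):] ((T ^^ (i + (n - i))) z)) = sc [:(F * K) $ n:] ((T ^^ n) z)" for n
    proof -
      have "(\<Sum>i\<le>n. sc [:F $ i * K $ (n - i):] ((T ^^ (i + (n - i))) z))
          = sc (\<Sum>i\<le>n. [:F $ i * K $ (n - i):]) ((T ^^ n) z)"
        by (simp add: sc_sum_left)
      also have "(\<Sum>i\<le>n. [:F $ i * K $ (n - i):]) = [:(F * K) $ n:]"
        by (simp add: fps_mult_nth atLeast0AtMost sum_const_poly)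
      finally show ?thesis .
    qed
    then show ?thesis by (simp add: ev_def)
  qed
  finally show ?thesis .
qed

lemma raising_ev:
  assumes T: "raising T" and K: "K $ 0 = 0"
  shows "raising (ev K T)"
  unfolding raising_def
proof (intro conjI allI impI)
  fix k and x :: "'a ncs" assume x: "filt k x"
  have "filt (Suc k) (sc [:K $ j:] ((T ^^ j) x))" for j
    using raising_pow(5)[OF T x, of j] K by (cases j) (auto intro!: filt_sc intro: filt_mono)
  then show "filt (Suc k) (ev K T x)"
    unfolding ev_def by (intro filt_sum)
qed (simp_all add: ev_def raising_pow[OF T] sc_add_right sum.distrib sc_sum mult.commute)

lemma ev_compose:
  assumes T: "raising T" and K: "K $ 0 = 0"
  shows "ev F (ev K T) z \<approx> ev (F oo K) T z"
proof -
  have pow: "(ev K T ^^ j) z \<approx> ev (K ^ j) T z" for j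
  proof (induction j)
    case 0
    show ?case by (simp add: ev_one)
  next
    case (Suc j)
    have "(ev K T ^^ Suc j) z \<approx> ev K T (ev (K ^ j) T z)"
      using raising_eqv[OF raising_ev[OF T K] Suc] by simp
    also have "\<dots> \<approx> ev (K ^ Suc j) T z"
      using ev_mult[OF T, of K "K ^ j"] by simp
    finally show ?case .
  qed
  have "ev F (ev K T) z \<approx> (\<Sum>j<M. sc [:F $ j:] (ev (K ^ j) T z))"
    unfolding ev_def[of F] by (intro eqv_sum eqv_sc pow)
  also have "\<dots> = (\<Sum>n<M. sc (\<Sum>j<M. [:F $ j * (K ^ j) $ n:]) ((T ^^ n) z))"
    unfolding ev_def sc_sum sc_sum_left by (subst sum.swap) (simp add: mult.commute)
  also have "\<dots> = (\<Sum>n<M. sc [:(F oo K) $ n:] ((T ^^ n) z))"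
  proof (rule sum.cong, rule refl)
    fix n assume "n \<in> {..<M}"
    then have n: "n < M" by simp
    \<comment> \<open>\<open>K ^ j\<close> starts in degree \<open>j\<close>, so the summands with
      \<open>j > n\<close> vanish and the rest is the coefficient of the composed series.\<close>
    have "(\<Sum>j<M. F $ j * (K ^ j) $ n) = (\<Sum>j\<in>{0..n}. F $ j * (K ^ j) $ n)"
      using n K by (intro sum.mono_neutral_right) (auto intro: startsby_zero_power_prefix[rule_format])
    then show "sc (\<Sum>j<M. [:F $ j * (K ^ j) $ n:]) ((T ^^ n) z) = sc [:(F oo K) $ n:] ((T ^^ n) z)"
      by (simp add: sum_const_poly fps_compose_nth)
  qed
  finally show ?thesis unfolding ev_def[of "F oo K"] .
qed

lemma ev_X: "ev fps_X T z = T z"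
proof -
  obtain m where m: "M = Suc (Suc m)" using M2 that[of "M - 2"] by simp
  show ?thesis
    unfolding ev_def unfolding m by (simp add: sum.lessThan_Suc_shift fps_X_def del: sum.lessThan_Suc flip: one_pCons)
qed

lemma ev_add_series: "ev (F + K) T z = ev F T z + ev K T z"
  by (simp add: ev_def sum.distrib flip: sc_pCons_add)

lemma ev_diff_series: "ev (F - K) T z = ev F T z - ev K T z"
  using ev_add_series[of "F - K" K T z] by simp

definition ser :: "rat fps \<Rightarrow> 'l ncs \<Rightarrow> 'l ncs" where
  "ser F g = ev F ((*) g) 1"

lemma ser_eq: "ser F g = (\<Sum>j<M. sc [:F $ j:] (g ^ j))"
  by (simp add: ser_def ev_def lmult_pow)

lemma ser_times: "ser F g * z = ev F ((*) g) z"
  by (simp add: ser_eq ev_def lmult_pow sum_distrib_right)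

lemma ser_cong: "g \<approx> g' \<Longrightarrow> ser F g \<approx> ser F g'"
  unfolding ser_eq by (intro eqv_sum eqv_sc eqv_power)

lemma filt_ser: "filt 1 g \<Longrightarrow> K $ 0 = 0 \<Longrightarrow> filt 1 (ser K g)"
  unfolding ser_def using raising_filt[OF raising_ev[OF raising_lmult], of g K 0 1] by simp

lemma ser_compose: "filt 1 g \<Longrightarrow> K $ 0 = 0 \<Longrightarrow> ser F (ser K g) \<approx> ser (F oo K) g"
proof -
  assume a: "filt 1 g" "K $ 0 = 0"
  have "(*) (ser K g) = ev K ((*) g)"
    by (rule ext) (rule ser_times)
  then show ?thesis
    using ev_compose[OF raising_lmult[OF a(1)] a(2), of F 1] by (simp add: ser_def)
qed

lemma ser_mult: "filt 1 g \<Longrightarrow> ser F g * ser K g \<approx> ser (F * K) g"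
  using ev_mult[OF raising_lmult, of g F K 1] by (simp add: ser_times) (simp add: ser_def)

lemma ser_one [simp]: "ser 1 g = 1"
  and ser_X [simp]: "ser fps_X g = g"
  and ser_add: "ser (F + K) g = ser F g + ser K g"
  and ser_diff: "ser (F - K) g = ser F g - ser K g"
  by (simp_all add: ser_def ev_X ev_add_series ev_diff_series)

section \<open>Exponential and logarithm of series\<close>

abbreviation "xp \<equiv> ser (fps_exp 1)"
abbreviation "xm \<equiv> ser (fps_exp (- 1))"
abbreviation "lg \<equiv> ser (fps_ln 1)"

lemma ln_compose_exp: "fps_ln 1 oo (fps_exp 1 - 1) = (fps_X :: rat fps)"
  and exp_compose_ln: "(fps_exp 1 - 1) oo fps_ln 1 = (fps_X :: rat fps)"
  by (simp_all add: fps_ln_fps_exp_inv fps_inv_fps_exp_compose)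

lemma xp_lg: assumes "filt 1 g" shows "xp (lg g) \<approx> 1 + g"
proof -
  have "xp (lg g) \<approx> ser (fps_exp 1 oo fps_ln 1) g"
    by (rule ser_compose[OF assms]) simp
  also have "fps_exp 1 oo fps_ln 1 = (1 + fps_X :: rat fps)"
    using exp_compose_ln by (simp add: fps_compose_sub_distrib algebra_simps)
  finally show ?thesis by (simp add: ser_add)
qed

lemma lg_xp: assumes "filt 1 a" shows "lg (xp a - 1) \<approx> a"
proof -
  have "lg (ser (fps_exp 1 - 1) a) \<approx> ser (fps_ln 1 oo (fps_exp 1 - 1)) a"
    by (rule ser_compose[OF assms]) simp
  then show ?thesis by (simp add: ln_compose_exp ser_diff)
qed

lemma xp_inj: assumes "filt 1 a" "filt 1 b" "xp a \<approx> xp b" shows "a \<approx> b"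
proof -
  have "lg (xp a - 1) \<approx> lg (xp b - 1)"
    by (intro ser_cong eqv_diff assms) simp
  then show ?thesis
    using lg_xp[OF assms(1)] lg_xp[OF assms(2)] eqv_trans eqv_sym by metis
qed

lemma xp_xm: "filt 1 a \<Longrightarrow> xp a * xm a \<approx> 1"
  using ser_mult[of a "fps_exp 1" "fps_exp (- 1)"] by (simp flip: fps_exp_add_mult)

lemma eqv_cancel_xp:
  assumes "filt 1 a" "x * xp a \<approx> y * xp a" shows "x \<approx> y"
proof -
  have "x * (xp a * xm a) \<approx> y * (xp a * xm a)"
    using eqv_mult[OF assms(2) eqv_refl[of "xm a"]] by (simp add: mult.assoc)
  moreover have "z * (xp a * xm a) \<approx> z" for z
    using eqv_mult[OF eqv_refl xp_xm[OF assms(1)], of z] by simp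
  ultimately show ?thesis by (meson eqv_sym eqv_trans)
qed

end

subsection \<open>Conjugation and differentiation of exponentials\<close>

lemma sum_pascal:
  fixes g :: "nat \<Rightarrow> nat \<Rightarrow> 'l ncs"
  shows "(\<Sum>m\<le>Suc n. of_nat (Suc n choose m) * g m (Suc n - m)) =
    (\<Sum>m\<le>n. of_nat (n choose m) * (g (Suc m) (n - m) + g m (Suc n - m)))"
proof -
  have "(\<Sum>m\<le>Suc n. of_nat (Suc n choose m) * g m (Suc n - m)) =
      g 0 (Suc n) + (\<Sum>m\<le>n. of_nat (Suc n choose Suc m) * g (Suc m) (n - m))"
    unfolding sum.atMost_Suc_shift by simp
  also have "(\<Sum>m\<le>n. of_nat (Suc n choose Suc m) * g (Suc m) (n - m)) =
      (\<Sum>m\<le>n. of_nat (n choose m) * g (Suc m) (n - m)) +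
      (\<Sum>m\<le>n. of_nat (n choose Suc m) * g (Suc m) (n - m))"
    by (simp only: binomial_Suc_Suc of_nat_add distrib_right sum.distrib)
  finally have 1: "(\<Sum>m\<le>Suc n. of_nat (Suc n choose m) * g m (Suc n - m)) =
      g 0 (Suc n) + ((\<Sum>m\<le>n. of_nat (n choose m) * g (Suc m) (n - m)) +
      (\<Sum>m\<le>n. of_nat (n choose Suc m) * g (Suc m) (n - m)))" .
  have "(\<Sum>m\<le>n. of_nat (n choose m) * g m (Suc n - m)) =
      (\<Sum>m\<le>Suc n. of_nat (n choose m) * g m (Suc n - m))"
    by (simp add: binomial_eq_0)
  also have "\<dots> = g 0 (Suc n) + (\<Sum>m\<le>n. of_nat (n choose Suc m) * g (Suc m) (n - m))"
    unfolding sum.atMost_Suc_shift by simp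
  finally have 2: "(\<Sum>m\<le>n. of_nat (n choose m) * g m (Suc n - m)) = \<dots>" .
  show ?thesis
    unfolding 1 distrib_left sum.distrib 2 by simp
qed

text \<open>Left multiplication by \<open>H\<close> is the sum of \<open>comm H\<close> and right
  multiplication by \<open>H\<close>, and these two operators commute; this is their binomial
  theorem.\<close>

lemma power_mult_comm_expand:
  "H ^ n * z = (\<Sum>m\<le>n. of_nat (n choose m) * ((comm H ^^ m) z * H ^ (n - m)))"
proof (induction n)
  case (Suc n)
  have "H ^ Suc n * z = (\<Sum>m\<le>n. H * (of_nat (n choose m) * ((comm H ^^ m) z * H ^ (n - m))))"
    by (simp add: Suc mult.assoc sum_distrib_left del: funpow.simps)
  also have "\<dots> = (\<Sum>m\<le>n. of_nat (n choose m) *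
      ((comm H ^^ Suc m) z * H ^ (n - m) + (comm H ^^ m) z * H ^ (Suc n - m)))"
  proof (rule sum.cong[OF refl])
    fix m assume "m \<in> {..n}"
    then have 1: "H ^ (Suc n - m) = H * H ^ (n - m)" by (simp add: Suc_diff_le)
    have "H * (of_nat (n choose m) * ((comm H ^^ m) z * H ^ (n - m))) =
        of_nat (n choose m) * (H * (comm H ^^ m) z * H ^ (n - m))"
      by (metis mult.assoc mult_of_nat_commute)
    also have "H * (comm H ^^ m) z = (comm H ^^ Suc m) z + (comm H ^^ m) z * H"
      by (simp add: comm_def)
    finally show "H * (of_nat (n choose m) * ((comm H ^^ m) z * H ^ (n - m))) =
        of_nat (n choose m) * ((comm H ^^ Suc m) z * H ^ (n - m) + (comm H ^^ m) z * H ^ (Suc n - m))"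
      unfolding 1 by (simp add: distrib_right mult.assoc)
  qed
  also have "\<dots> = (\<Sum>m\<le>Suc n. of_nat (Suc n choose m) * ((comm H ^^ m) z * H ^ (Suc n - m)))"
    by (rule sum_pascal[symmetric])
  finally show ?case .
qed simp

lemma of_nat_sc: "of_nat n * u = sc [:of_nat n:] u"
proof (induction n)
  case (Suc n)
  then show ?case
    by (simp add: algebra_simps) (metis sc_pCons_add sc_one one_pCons)
qed simp

definition dl :: "'l ncs \<Rightarrow> 'l ncs" where
  "dl u = Abs_ncs (\<lambda>w. pderiv (cf u w))"

lemma cf_dl [simp]: "cf (dl u) w = pderiv (cf u w)"
  by (simp add: dl_def)

lemma pderiv_conv:
  "pderiv (conv w u v) = conv w (\<lambda>x. pderiv (u x)) v + conv w u (\<lambda>x. pderiv (v x))"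
  by (induction w arbitrary: u) (simp_all add: pderiv_add pderiv_mult algebra_simps)

lemma dl_add: "dl (u + v) = dl u + dl v"
  and dl_diff: "dl (u - v) = dl u - dl v"
  and dl_zero [simp]: "dl 0 = 0"
  and dl_one [simp]: "dl 1 = 0"
  by (auto intro!: ncs_eqI simp: pderiv_add pderiv_diff cf_one)

lemma dl_sum: "dl (sum F A) = (\<Sum>i\<in>A. dl (F i))"
  by (induction A rule: infinite_finite_induct) (simp_all add: dl_add)

lemma dl_mult: "dl (u * v) = dl u * v + u * dl v"
  by (rule ncs_eqI) (simp add: cf_times pderiv_conv dl_def)

lemma dl_sc: "dl (sc c u) = sc (pderiv c) u + sc c (dl u)"
  by (rule ncs_eqI) (simp add: pderiv_mult)

lemma dl_sc_const [simp]: "dl (sc [:c:] u) = sc [:c:] (dl u)"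
  by (simp add: dl_sc pderiv_pCons)

lemma filt_dl: "filt k u \<Longrightarrow> filt k (dl u)"
  by (auto simp: filt_def)

text \<open>In the Leibniz expansion each \<open>H\<close> to the left of \<open>dl H\<close> is
  moved to the right at the price of commutators. Summing over the position of \<open>dl H\<close>
  adds binomial coefficients along a diagonal of Pascal's triangle, which raises both of their
  arguments by one.\<close>

lemma dl_power_Suc:
  "dl (H ^ Suc n) = (\<Sum>m\<le>n. of_nat (Suc n choose Suc m) * ((comm H ^^ m) (dl H) * H ^ (n - m)))"
proof (induction n)
  case (Suc n)
  let ?g = "\<lambda>m k. (comm H ^^ m) (dl H) * H ^ k"
  have "dl (H ^ Suc (Suc n)) = dl (H ^ Suc n) * H + H ^ Suc n * dl H"
    by (metis dl_mult power_Suc2)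
  also have "dl (H ^ Suc n) * H = (\<Sum>m\<le>n. of_nat (Suc n choose Suc m) * ?g m (Suc n - m))"
    unfolding Suc sum_distrib_right
  proof (rule sum.cong[OF refl])
    fix m assume "m \<in> {..n}"
    then have 1: "H ^ (Suc n - m) = H ^ (n - m) * H" by (simp add: Suc_diff_le power_Suc2 del: power_Suc)
    show "of_nat (Suc n choose Suc m) * ?g m (n - m) * H = of_nat (Suc n choose Suc m) * ?g m (Suc n - m)"
      unfolding 1 by (simp only: mult.assoc)
  qed
  also have "\<dots> = (\<Sum>m\<le>Suc n. of_nat (Suc n choose Suc m) * ?g m (Suc n - m))"
    by (simp add: binomial_eq_0)
  also have "H ^ Suc n * dl H = (\<Sum>m\<le>Suc n. of_nat (Suc n choose m) * ?g m (Suc n - m))"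
    by (rule power_mult_comm_expand)
  also have "(\<Sum>m\<le>Suc n. of_nat (Suc n choose Suc m) * ?g m (Suc n - m)) +
      (\<Sum>m\<le>Suc n. of_nat (Suc n choose m) * ?g m (Suc n - m)) =
      (\<Sum>m\<le>Suc n. of_nat (Suc (Suc n) choose Suc m) * ?g m (Suc n - m))"
    by (subst sum.distrib[symmetric], rule sum.cong[OF refl])
      (simp only: binomial_Suc_Suc[of "Suc n"] of_nat_add distrib_right add.commute)
  finally show ?case .
qed simp

context truncated
begin

lemma eqv_dl: "u \<approx> v \<Longrightarrow> dl u \<approx> dl v"
  unfolding eqv_def using filt_dl by (metis dl_diff)

text \<open>Conjugation by an exponential is the exponential of the adjoint action. Dividing the
  binomial expansion by \<open>fact n\<close> decouples the exponents \<open>m\<close> and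
  \<open>n - m\<close>, and the double sum factors.\<close>

lemma xp_conj:
  assumes H: "filt 1 H"
  shows "xp H * z \<approx> ev (fps_exp 1) (comm H) z * xp H"
proof -
  define a where "a m k = sc [:1 / (fact m * fact k):] ((comm H ^^ m) z * H ^ k)" for m k
  have "xp H * z = (\<Sum>n<M. \<Sum>m\<le>n. a m (n - m))"
    unfolding ser_eq sum_distrib_right
  proof (rule sum.cong[OF refl])
    fix n
    have "sc [:fps_exp 1 $ n:] (H ^ n) * z = (\<Sum>m\<le>n. sc [:1 / fact n * of_nat (n choose m):] ((comm H ^^ m) z * H ^ (n - m)))"
      by (subst sc_mult_left, subst power_mult_comm_expand) (simp add: of_nat_sc sc_sum mult.commute)
    also have "\<dots> = (\<Sum>m\<le>n. a m (n - m))"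
      by (intro sum.cong[OF refl]) (simp add: a_def binomial_fact field_simps)
    finally show "sc [:fps_exp 1 $ n:] (H ^ n) * z = (\<Sum>m\<le>n. a m (n - m))" .
  qed
  also have "\<dots> \<approx> (\<Sum>m<M. \<Sum>k<M. a m k)"
  proof (rule eqv_double_sum)
    fix i j
    have "filt (i + 0) ((comm H ^^ i) z)"
      by (rule raising_pow(5)[OF raising_comm[OF H]]) simp
    then show "filt (i + j) (a i j)"
      unfolding a_def using filt_mult[OF _ filt_power[OF H, of j], of i] by (intro filt_sc) simp
  qed
  also have "\<dots> = ev (fps_exp 1) (comm H) z * xp H"
    unfolding a_def ev_def ser_eq sum_product by (intro sum.cong refl) (simp add: mult.commute)
  finally show ?thesis .
qed

text \<open>The series \<open>(exp X - 1) / X\<close>. At the adjoint action of \<open>H\<close> it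
  turns the derivative of \<open>H\<close> into the logarithmic derivative of
  \<open>exp H\<close>.\<close>

definition dexp :: "rat fps" where
  "dexp = Abs_fps (\<lambda>n. 1 / fact (Suc n))"

lemma X_mult_dexp: "fps_X * dexp = fps_exp 1 - 1"
  by (rule fps_ext) (auto simp: dexp_def fps_X_mult_nth gr0_conv_Suc)

lemma xp_deriv:
  assumes H: "filt 1 H"
  shows "dl (xp H) \<approx> ev dexp (comm H) (dl H) * xp H"
proof -
  define a where "a m k = sc [:1 / (fact (Suc m) * fact k):] ((comm H ^^ m) (dl H) * H ^ k)" for m k
  \<comment> \<open>One degree more than the exponents show, since \<open>dl H\<close> has no
    constant term. This compensates the index shift caused by differentiating, which leaves one row
    of the triangle missing.\<close>
  have fa: "filt (Suc (i + j)) (a i j)" for i j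
  proof -
    have "filt (i + 1) ((comm H ^^ i) (dl H))"
      by (rule raising_pow(5)[OF raising_comm[OF H]]) (rule filt_dl[OF H])
    then show ?thesis
      unfolding a_def using filt_mult[OF _ filt_power[OF H, of j], of "i + 1"] by (intro filt_sc) simp
  qed
  obtain M' where M': "M = Suc M'" using M2 by (cases M) auto
  have "dl (xp H) = (\<Sum>n<M. sc [:1 / fact n:] (dl (H ^ n)))"
    by (simp add: ser_eq dl_sum)
  also have "\<dots> = (\<Sum>n<M'. sc [:1 / fact (Suc n):] (dl (H ^ Suc n)))"
    unfolding M' by (simp add: sum.lessThan_Suc_shift del: sum.lessThan_Suc power_Suc fact_Suc)
  also have "\<dots> = (\<Sum>n<M'. \<Sum>m\<le>n. a m (n - m))"
  proof (rule sum.cong[OF refl])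
    fix n
    have "sc [:1 / fact (Suc n):] (dl (H ^ Suc n)) =
        (\<Sum>m\<le>n. sc [:1 / fact (Suc n) * of_nat (Suc n choose Suc m):] ((comm H ^^ m) (dl H) * H ^ (n - m)))"
      by (subst dl_power_Suc) (simp add: of_nat_sc sc_sum mult.commute del: power_Suc fact_Suc binomial_Suc_Suc)
    also have "\<dots> = (\<Sum>m\<le>n. a m (n - m))"
      by (intro sum.cong[OF refl]) (simp add: a_def binomial_fact field_simps del: fact_Suc binomial_Suc_Suc)
    finally show "sc [:1 / fact (Suc n):] (dl (H ^ Suc n)) = (\<Sum>m\<le>n. a m (n - m))" .
  qed
  also have "\<dots> \<approx> (\<Sum>n<M. \<Sum>m\<le>n. a m (n - m))"
  proof -
    have "filt M (\<Sum>m\<le>M'. a m (M' - m))"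
      by (intro filt_sum) (use fa M' in \<open>metis atMost_iff le_add_diff_inverse\<close>)
    moreover have "(\<Sum>n<M. \<Sum>m\<le>n. a m (n - m)) =
        (\<Sum>n<M'. \<Sum>m\<le>n. a m (n - m)) + (\<Sum>m\<le>M'. a m (M' - m))"
      by (simp add: M')
    ultimately show ?thesis
      by (metis eqv_add_filt)
  qed
  also have "\<dots> \<approx> (\<Sum>m<M. \<Sum>k<M. a m k)"
    by (rule eqv_double_sum) (rule filt_mono[OF fa], simp)
  also have "\<dots> = ev dexp (comm H) (dl H) * xp H"
    unfolding a_def ev_def ser_eq sum_product
    by (intro sum.cong refl) (simp add: dexp_def mult.commute del: fact_Suc)
  finally show ?thesis .
qed

end

subsection \<open>Specialization of the parameter\<close>

text \<open>Setting the central parameter to \<open>t\<close>. The result is again a series over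
  polynomials, with constant ones, so no second type of series is required.\<close>

definition sp :: "rat \<Rightarrow> 'l ncs \<Rightarrow> 'l ncs" where
  "sp t u = Abs_ncs (\<lambda>w. [:poly (cf u w) t:])"

lemma cf_sp [simp]: "cf (sp t u) w = [:poly (cf u w) t:]"
  by (simp add: sp_def)

lemma conv_sp: "conv w (\<lambda>x. [:poly (u x) t:]) (\<lambda>x. [:poly (v x) t:]) = [:poly (conv w u v) t:]"
  by (induction w arbitrary: u) simp_all

lemma sp_add: "sp t (u + v) = sp t u + sp t v"
  and sp_diff: "sp t (u - v) = sp t u - sp t v"
  and sp_zero [simp]: "sp t 0 = 0"
  and sp_one [simp]: "sp t 1 = 1"
  and sp_sc: "sp t (sc c u) = sc [:poly c t:] (sp t u)"
  by (auto intro!: ncs_eqI simp: cf_one one_pCons)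

lemma sp_mult: "sp t (u * v) = sp t u * sp t v"
  by (rule ncs_eqI) (simp add: cf_times sp_def conv_sp)

lemma sp_power: "sp t (u ^ n) = sp t u ^ n"
  by (induction n) (simp_all add: sp_mult)

lemma sp_sum: "sp t (sum F A) = (\<Sum>i\<in>A. sp t (F i))"
  by (induction A rule: infinite_finite_induct) (simp_all add: sp_add)

lemma filt_sp: "filt k u \<Longrightarrow> filt k (sp t u)"
  by (auto simp: filt_def)

definition const :: "'l ncs \<Rightarrow> bool" where
  "const u \<longleftrightarrow> (\<forall>w. \<exists>c. cf u w = [:c:])"

lemma const_sp [simp]: "const (sp t u)"
  by (auto simp: const_def)

lemma sp_const: "const u \<Longrightarrow> sp t u = u"
proof (rule ncs_eqI)
  fix w assume "const u"
  then obtain c where "cf u w = [:c:]" by (auto simp: const_def)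
  then show "cf (sp t u) w = cf u w" by simp
qed

lemma const_iff: "const u \<longleftrightarrow> sp 0 u = u"
  by (metis const_sp sp_const)

lemma const_zero [simp]: "const 0"
  and const_add: "const u \<Longrightarrow> const v \<Longrightarrow> const (u + v)"
  and const_comm: "const u \<Longrightarrow> const v \<Longrightarrow> const (comm u v)"
  and const_sc: "const u \<Longrightarrow> const (sc [:c:] u)"
  by (simp_all add: const_iff comm_def sp_add sp_diff sp_mult sp_sc)

lemma dl_const: assumes "const u" shows "dl u = 0"
proof (rule ncs_eqI)
  fix w
  obtain c where "cf u w = [:c:]" using assms by (auto simp: const_def)
  then show "cf (dl u) w = cf 0 w" by (simp add: pderiv_pCons)
qed

section \<open>Nested brackets and the index set of Dynkin's series\<close>

definition ncs_lie :: "'l ncs lie_ring" where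
  "ncs_lie = \<lparr>lcarrier = UNIV, ladd = (+), lzero = 0, lneg = uminus, lbr = comm\<rparr>"

lemma ncs_lie_simps [simp]: "lbr ncs_lie = comm" "lzero ncs_lie = 0"
  by (simp_all add: ncs_lie_def)

text \<open>Viewing series as a Lie ring record makes \<open>nest\<close> the same function on
  series as on \<open>L\<close>, so nested brackets can be lifted letter by letter.\<close>

abbreviation "nst \<equiv> nest ncs_lie"

lemma nst_Nil [simp]: "nst [] = 0"
  and nst_Cons: "w \<noteq> [] \<Longrightarrow> nst (a # w) = comm a (nst w)"
  by (auto simp: ncs_lie_def neq_Nil_conv)

lemma nst_replicate_append: "w \<noteq> [] \<Longrightarrow> nst (replicate r a @ w) = (comm a ^^ r) (nst w)"
  by (induction r) (simp_all add: nst_Cons)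

lemma comm_self [simp]: "comm a a = 0" "comm a 0 = 0"
  by (simp_all add: comm_def)

lemma nst_replicate: "nst (replicate r a) = (if r = 1 then a else 0)"
proof (induction r rule: less_induct)
  case (less r)
  show ?case
  proof (cases r)
    case (Suc r')
    show ?thesis
    proof (cases r')
      case (Suc r'')
      then have "nst (replicate r a) = comm a (nst (replicate r' a))"
        using \<open>r = Suc r'\<close> by (simp add: nst_Cons)
      then show ?thesis using less[of r'] \<open>r = Suc r'\<close> Suc by simp
    qed (use Suc in simp)
  qed simp
qed

lemma const_nst: "(\<And>a. a \<in> set w \<Longrightarrow> const a) \<Longrightarrow> const (nst w)"
  by (induction w rule: induct_list012) (simp_all add: nst_Cons const_comm)

lemma filt_nst: "(\<And>a. a \<in> set w \<Longrightarrow> filt 1 a) \<Longrightarrow> filt (length w) (nst w)"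
proof (induction w rule: induct_list012)
  case (3 x y zs)
  then have "filt (1 + length (y # zs)) (comm x (nst (y # zs)))"
    by (intro filt_comm) auto
  then show ?case by (simp add: nst_Cons)
qed simp_all

lemma nst_scale: "nst (map (sc c) w) = sc (c ^ length w) (nst w)"
  by (induction w rule: induct_list012)
    (simp_all add: nst_Cons comm_def sc_diff_right algebra_simps)

definition tot :: "(nat \<times> nat) list \<Rightarrow> nat" where
  "tot rs = sum_list (map (\<lambda>(r, s). r + s) rs)"

definition nzp :: "(nat \<times> nat) list \<Rightarrow> bool" where
  "nzp rs \<longleftrightarrow> (\<forall>(r, s)\<in>set rs. 1 \<le> r + s)"

lemma dyn_word_Cons: "dyn_word x y ((r, s) # rs) = replicate r x @ replicate s y @ dyn_word x y rs"
  and dyn_word_Nil [simp]: "dyn_word x y [] = []"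
  by (simp_all add: dyn_word_def)

lemma length_dyn_word: "length (dyn_word x y rs) = tot rs"
  by (induction rs) (auto simp: tot_def dyn_word_Cons)

lemma set_dyn_word: "set (dyn_word x y rs) \<subseteq> {x, y}"
  by (induction rs) (auto simp: dyn_word_Cons)

lemma map_dyn_word: "map f (dyn_word x y rs) = dyn_word (f x) (f y) rs"
  by (induction rs) (auto simp: dyn_word_Cons)

lemma length_le_tot: "nzp rs \<Longrightarrow> length rs \<le> tot rs"
  by (induction rs) (auto simp: nzp_def tot_def)

lemma entries_le_tot: "(r, s) \<in> set rs \<Longrightarrow> r + s \<le> tot rs"
  by (induction rs) (auto simp: tot_def)

lemma finite_nzp_tot: "finite {rs. nzp rs \<and> tot rs < M}"
proof (rule finite_subset)
  show "{rs. nzp rs \<and> tot rs < M} \<subseteq> {rs. set rs \<subseteq> {..M} \<times> {..M} \<and> length rs \<le> M}"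
  proof clarify
    fix rs assume rs: "nzp rs" "tot rs < M"
    then have "x \<in> {..M} \<times> {..M}" if "x \<in> set rs" for x
      using entries_le_tot[of "fst x" "snd x" rs] that by (simp add: mem_Times_iff)
    then show "set rs \<subseteq> {..M} \<times> {..M} \<and> length rs \<le> M"
      using length_le_tot[OF rs(1)] rs(2) by auto
  qed
qed (rule finite_lists_length_le, simp)

text \<open>In a list of nonzero pairs both the entries and the length are at most the total
  \<open>m\<close>; the bounds in \<open>dyn_index\<close> are chosen accordingly, and each such
  list is enumerated exactly once, under its length.\<close>

lemma sum_dyn_index:
  fixes F :: "_ \<Rightarrow> 'b :: comm_monoid_add"
  assumes "1 \<le> m"
  shows "sum_list (map F (dyn_index m)) = (\<Sum>rs\<in>{rs. nzp rs \<and> tot rs = m}. F rs)"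
proof -
  let ?S = "{rs. nzp rs \<and> tot rs = m}"
  have fin: "finite ?S"
    by (rule finite_subset[OF _ finite_nzp_tot[of "Suc m"]]) auto
  have sl: "sum_list (map F (concat xss)) = sum_list (map (\<lambda>xs. sum_list (map F xs)) xss)" for xss
    by (induction xss) simp_all
  let ?l = "\<lambda>n. filter (\<lambda>rs. (\<forall>(r, s)\<in>set rs. 1 \<le> r + s) \<and> sum_list (map (\<lambda>(r, s). r + s) rs) = m)
      (List.n_lists n (List.product [0..<m+1] [0..<m+1]))"
  have l: "sum_list (map F (?l n)) = (\<Sum>rs\<in>{rs\<in>?S. length rs = n}. F rs)" for n
  proof -
    have d: "distinct (?l n)"
      by (intro distinct_filter distinct_n_lists distinct_product) simp_all
    have s: "set (?l n) = {rs\<in>?S. length rs = n}"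
    proof -
      have "set rs \<subseteq> {0..<m+1} \<times> {0..<m+1}" if "tot rs = m" for rs
      proof
        fix x assume "x \<in> set rs"
        then show "x \<in> {0..<m+1} \<times> {0..<m+1}"
          using entries_le_tot[of "fst x" "snd x" rs] that by (simp add: mem_Times_iff)
      qed
      then show ?thesis
        unfolding set_filter set_n_lists nzp_def tot_def[symmetric] set_product set_upt mem_Collect_eq
        by (intro Collect_cong) metis
    qed
    show ?thesis by (simp only: sum_list_distinct_conv_sum_set[OF d] s)
  qed
  have "sum_list (map F (dyn_index m)) = (\<Sum>n\<in>{1..<m+1}. \<Sum>rs\<in>{rs\<in>?S. length rs = n}. F rs)"
    unfolding dyn_index_def sl map_map o_def l by (simp only: interv_sum_list_conv_sum_set_nat set_upt)
  also have "\<dots> = (\<Sum>rs\<in>?S. F rs)"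
  proof (rule sum.group[OF fin])
    show "length ` ?S \<subseteq> {1..<m+1}"
    proof
      fix n assume "n \<in> length ` ?S"
      then obtain rs where rs: "nzp rs" "tot rs = m" "n = length rs" by auto
      moreover have "rs \<noteq> []" using rs assms by (auto simp: tot_def)
      ultimately show "n \<in> {1..<m+1}" using length_le_tot[of rs] by (cases rs) auto
    qed
  qed simp
  finally show ?thesis .
qed

definition wt :: "(nat \<times> nat) list \<Rightarrow> rat" where
  "wt rs = prod_list (map (\<lambda>(r, s). 1 / (fact r * fact s)) rs)"

lemma wt_inverse: "prod_list (map (\<lambda>(r, s). of_nat (fact r * fact s)) rs) = 1 / wt rs"
  by (induction rs) (auto simp: wt_def)

lemma dyn_coeff_wt: "m > 0 \<Longrightarrow> of_nat m * dyn_coeff m rs = (- 1) ^ (length rs - 1) / of_nat (length rs) * wt rs"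
  unfolding dyn_coeff_def wt_inverse by simp

text \<open>Built from the same nested lists as \<open>exp_mul\<close>, so that a lifting of the
  arguments passes through it summand by summand.\<close>

definition bch :: "nat \<Rightarrow> 'l ncs \<Rightarrow> 'l ncs \<Rightarrow> 'l ncs" where
  "bch M u v = sum_list (map (\<lambda>m. sum_list (map (\<lambda>rs. sc [:dyn_coeff m rs:] (nst (dyn_word u v rs)))
     (dyn_index m))) [1..<M])"

lemma bch_sum:
  "bch M u v = (\<Sum>m\<in>{1..<M}. \<Sum>rs\<in>{rs. nzp rs \<and> tot rs = m}. sc [:dyn_coeff m rs:] (nst (dyn_word u v rs)))"
proof -
  have "bch M u v = (\<Sum>m\<in>{1..<M}. sum_list (map (\<lambda>rs. sc [:dyn_coeff m rs:] (nst (dyn_word u v rs))) (dyn_index m)))"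
    unfolding bch_def by (simp add: interv_sum_list_conv_sum_set_nat)
  then show ?thesis by (simp add: sum_dyn_index)
qed

lemma const_sum: "(\<And>i. i \<in> A \<Longrightarrow> const (F i)) \<Longrightarrow> const (sum F A)"
  by (induction A rule: infinite_finite_induct) (auto intro: const_add)

lemma const_dyn: "const u \<Longrightarrow> const v \<Longrightarrow> const (nst (dyn_word u v rs))"
  using set_dyn_word[of u v rs] by (intro const_nst) auto

lemma const_bch: "const u \<Longrightarrow> const v \<Longrightarrow> const (bch M u v)"
  unfolding bch_sum by (intro const_sum const_sc const_dyn)

lemma filt_dyn: "filt 1 u \<Longrightarrow> filt 1 v \<Longrightarrow> filt (tot rs) (nst (dyn_word u v rs))"
  using filt_nst[of "dyn_word u v rs"] set_dyn_word[of u v rs] by (auto simp: length_dyn_word)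

lemma filt_bch: "filt 1 u \<Longrightarrow> filt 1 v \<Longrightarrow> filt 1 (bch M u v)"
  unfolding bch_sum
proof (intro filt_sum filt_sc)
  fix m rs assume *: "filt 1 u" "filt 1 v" and "m \<in> {1..<M}" "rs \<in> {rs. nzp rs \<and> tot rs = m}"
  then show "filt 1 (nst (dyn_word u v rs))"
    using filt_mono[OF filt_dyn[OF *, of rs], of 1] by simp
qed

subsection \<open>Dynkin's form of the Campbell--Hausdorff formula\<close>

context truncated
begin

text \<open>The expansion of \<open>exp (ad U) exp (ad V) - 1\<close>: omitting the pair
  \<open>(0, 0)\<close> removes the identity and makes the operator raise degrees.\<close>

definition dop :: "'l ncs \<Rightarrow> 'l ncs \<Rightarrow> 'l ncs \<Rightarrow> 'l ncs" where
  "dop U V z = (\<Sum>(r, s)\<in>{..<M} \<times> {..<M} - {(0, 0)}.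
     sc [:1 / (fact r * fact s):] ((comm U ^^ r) ((comm V ^^ s) z)))"

lemma ev_exp_comm_comm:
  assumes "filt 1 U"
  shows "ev (fps_exp 1) (comm U) (ev (fps_exp 1) (comm V) z) = z + dop U V z"
proof -
  have "ev (fps_exp 1) (comm U) (ev (fps_exp 1) (comm V) z) =
      (\<Sum>r<M. \<Sum>s<M. sc [:1 / (fact r * fact s):] ((comm U ^^ r) ((comm V ^^ s) z)))"
    unfolding ev_def by (simp add: raising_pow[OF raising_comm[OF assms]] sc_sum mult.commute)
  also have "\<dots> = (\<Sum>(r, s)\<in>{..<M} \<times> {..<M}. sc [:1 / (fact r * fact s):] ((comm U ^^ r) ((comm V ^^ s) z)))"
    by (simp add: sum.cartesian_product)
  also have "\<dots> = z + dop U V z"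
    unfolding dop_def by (subst sum.remove[of _ "(0, 0)"]) (use M2 in \<open>auto simp flip: one_pCons\<close>)
  finally show ?thesis .
qed

lemma raising_dop:
  assumes "filt 1 U" "filt 1 V"
  shows "raising (dop U V)"
  unfolding raising_def
proof (intro conjI allI impI)
  fix k and x :: "'a ncs" assume x: "filt k x"
  show "filt (Suc k) (dop U V x)"
    unfolding dop_def
  proof (rule filt_sum)
    fix y assume "y \<in> {..<M} \<times> {..<M} - {(0::nat, 0::nat)}"
    then obtain r s where y: "y = (r, s)" "\<not> (r = 0 \<and> s = 0)" by (cases y) simp
    have "filt (r + (s + k)) ((comm U ^^ r) ((comm V ^^ s) x))"
      by (intro raising_pow(5) raising_comm assms x)
    then have "filt (Suc k) ((comm U ^^ r) ((comm V ^^ s) x))"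
      using y(2) by (auto elim!: filt_mono)
    then show "filt (Suc k) (case y of (r, s) \<Rightarrow> sc [:1 / (fact r * fact s):] ((comm U ^^ r) ((comm V ^^ s) x)))"
      by (simp add: y filt_sc)
  qed
qed (simp_all add: dop_def raising_pow[OF raising_comm[OF assms(1)]] raising_pow[OF raising_comm[OF assms(2)]] sc_add_right sum.distrib sc_sum
      split_def mult.commute)

text \<open>Applying \<open>dop\<close> prepends one nonzero pair to a word. The powers of
  \<open>dop\<close> on \<open>wsum U V 1\<close> hence run through Dynkin's words, sorted by the
  number of pairs and not yet by degree.\<close>

definition wsum :: "'l ncs \<Rightarrow> 'l ncs \<Rightarrow> nat \<Rightarrow> 'l ncs" where
  "wsum U V n = (\<Sum>rs\<in>{rs. length rs = n \<and> set rs \<subseteq> {..<M} \<times> {..<M} - {(0, 0)}}.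
     sc [:wt rs:] (nst (dyn_word U V rs)))"

lemma wsum_Suc:
  "wsum U V (Suc n) = (\<Sum>(r, s)\<in>{..<M} \<times> {..<M} - {(0, 0)}.
     \<Sum>rs\<in>{rs. length rs = n \<and> set rs \<subseteq> {..<M} \<times> {..<M} - {(0, 0)}}.
       sc [:1 / (fact r * fact s) * wt rs:] (nst (replicate r U @ replicate s V @ dyn_word U V rs)))"
proof -
  let ?B = "{..<M} \<times> {..<M} - {(0::nat, 0::nat)}"
  let ?L = "\<lambda>n. {rs. length rs = n \<and> set rs \<subseteq> ?B}"
  have "wsum U V (Suc n) = (\<Sum>(x, rs)\<in>?B \<times> ?L n. sc [:wt (x # rs):] (nst (dyn_word U V (x # rs))))"
    unfolding wsum_def
    by (rule sum.reindex_bij_witness[of _ "\<lambda>(x, rs). x # rs" "\<lambda>rs. (hd rs, tl rs)"])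
      (auto simp: length_Suc_conv)
  also have "\<dots> = (\<Sum>x\<in>?B. \<Sum>rs\<in>?L n. sc [:wt (x # rs):] (nst (dyn_word U V (x # rs))))"
    by (rule sum.cartesian_product[symmetric])
  also have "\<dots> = (\<Sum>(r, s)\<in>?B. \<Sum>rs\<in>?L n. sc [:1 / (fact r * fact s) * wt rs:]
      (nst (replicate r U @ replicate s V @ dyn_word U V rs)))"
    by (intro sum.cong refl) (auto simp: wt_def dyn_word_Cons split_def)
  finally show ?thesis .
qed

lemma dop_wsum:
  assumes "filt 1 U" "filt 1 V"
  shows "dop U V (wsum U V (Suc n)) = wsum U V (Suc (Suc n))"
proof -
  let ?B = "{..<M} \<times> {..<M} - {(0::nat, 0::nat)}"
  \<comment> \<open>A nested bracket is an iterated commutator only while something remains to its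
    right, hence the empty word must be excluded.\<close>
  have ne: "dyn_word U V rs \<noteq> []" if "length rs = Suc n" "set rs \<subseteq> ?B" for rs
  proof -
    obtain r s rs' where "rs = (r, s) # rs'" using \<open>length rs = Suc n\<close> by (cases rs) auto
    then show ?thesis using that by (auto simp: dyn_word_Cons)
  qed
  show ?thesis
    unfolding wsum_Suc[of U V "Suc n"] unfolding dop_def wsum_def
    by (intro sum.cong refl)
      (auto simp: raising_pow[OF raising_comm[OF assms(1)]] raising_pow[OF raising_comm[OF assms(2)]]
        sc_sum nst_replicate_append ne intro!: sum.cong)
qed

text \<open>A right-nested bracket ending in two equal letters vanishes, so of the words
  \<open>U ... U V ... V\<close> only \<open>U\<close> itself and those with exactly one
  \<open>V\<close> contribute.\<close>

lemma wsum_1: "wsum U V (Suc 0) = U + ev (fps_exp 1) (comm U) V"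
proof -
  let ?F = "\<lambda>r s. sc [:1 / (fact r * fact s):] (nst (replicate r U @ replicate s V))"
  have L0: "{rs. length rs = 0 \<and> set rs \<subseteq> {..<M} \<times> {..<M} - {(0::nat, 0::nat)}} = {[]}" by auto
  have F0: "?F r 0 = (if r = 1 then U else 0)" for r
    by (simp add: nst_replicate flip: one_pCons)
  have F1: "?F r (Suc 0) = sc [:1 / fact r:] ((comm U ^^ r) V)" for r
    by (simp add: nst_replicate_append)
  have cz: "(comm U ^^ r) 0 = 0" for r
    by (induction r) simp_all
  have F2: "?F r (Suc (Suc s)) = 0" for r s
  proof -
    have "nst (replicate r U @ replicate (Suc (Suc s)) V) = (comm U ^^ r) (nst (replicate (Suc (Suc s)) V))"
      by (rule nst_replicate_append) simp
    also have "\<dots> = 0" by (simp only: nst_replicate) (simp add: cz)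
    finally show ?thesis by simp
  qed
  obtain m where m: "M = Suc (Suc m)" using M2 that[of "M - 2"] by simp
  have "wsum U V (Suc 0) = (\<Sum>(r, s)\<in>{..<M} \<times> {..<M} - {(0, 0)}. ?F r s)"
    unfolding wsum_Suc L0 by (simp add: wt_def)
  also have "\<dots> = (\<Sum>(r, s)\<in>{..<M} \<times> {..<M}. ?F r s)"
    by (rule sum.mono_neutral_left) auto
  also have "\<dots> = (\<Sum>r<M. \<Sum>s<M. ?F r s)"
    by (rule sum.cartesian_product[symmetric])
  also have "\<dots> = (\<Sum>r<M. (if r = 1 then U else 0) + sc [:1 / fact r:] ((comm U ^^ r) V))"
  proof (rule sum.cong[OF refl])
    fix r
    have "(\<Sum>s<M. ?F r s) = ?F r 0 + ?F r (Suc 0) + (\<Sum>s<m. ?F r (Suc (Suc s)))"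
      unfolding m sum.lessThan_Suc_shift by (simp add: add.assoc)
    then show "(\<Sum>s<M. ?F r s) = (if r = 1 then U else 0) + sc [:1 / fact r:] ((comm U ^^ r) V)"
      unfolding F0 F1 F2 by simp
  qed
  also have "\<dots> = U + ev (fps_exp 1) (comm U) V"
    using M2 by (simp add: sum.distrib ev_def)
  finally show ?thesis .
qed

text \<open>The series \<open>ln (1 + X) / X\<close>. Substituting \<open>exp X - 1\<close> makes it
  the inverse of \<open>dexp\<close>, which is what solves for the derivative of the
  logarithm.\<close>

definition lnX :: "rat fps" where
  "lnX = Abs_fps (\<lambda>n. (- 1) ^ n / of_nat (Suc n))"

lemma lnX_compose: "(lnX oo (fps_exp 1 - 1)) * dexp = 1"
proof -
  have X: "fps_X * lnX = fps_ln 1"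
    by (rule fps_ext) (auto simp: lnX_def fps_X_mult_nth fps_ln_nth gr0_conv_Suc simp del: of_nat_Suc)
  have "fps_X * 1 = (fps_X * lnX) oo (fps_exp 1 - 1)"
    by (simp add: X ln_compose_exp)
  also have "\<dots> = (fps_exp 1 - 1) * (lnX oo (fps_exp 1 - 1))"
    by (subst fps_compose_mult_distrib) simp_all
  also have "\<dots> = fps_X * ((lnX oo (fps_exp 1 - 1)) * dexp)"
    unfolding X_mult_dexp[symmetric] by (simp only: mult_ac)
  finally have "fps_X * 1 = fps_X * ((lnX oo (fps_exp 1 - 1)) * dexp)" .
  then show ?thesis
    unfolding mult_cancel_left by simp
qed

lemma sp_ser: "sp t (ser F g) = ser F (sp t g)"
  by (simp add: ser_eq sp_sum sp_sc sp_power)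

lemma eqv_sp: "u \<approx> v \<Longrightarrow> sp t u \<approx> sp t v"
  unfolding eqv_def using filt_sp by (metis sp_diff)

lemma ser_zero: "ser F 0 = sc [:F $ 0:] 1"
proof -
  obtain m where m: "M = Suc m" using M2 by (cases M) auto
  show ?thesis
    unfolding ser_eq unfolding m by (simp add: sum.lessThan_Suc_shift del: sum.lessThan_Suc)
qed

lemma filt_xp_diff: "filt 1 g \<Longrightarrow> filt 1 (xp g - 1)"
  using filt_ser[of g "fps_exp 1 - 1"] by (simp add: ser_diff)

text \<open>Over the rationals a polynomial with zero derivative is constant. The extra factor is
  the parameter itself: the differential equation is used after multiplication by it.\<close>

lemma eqv_if_deriv_eqv:
  assumes "sc [:0, 1:] (dl u) \<approx> 0" and "sp 0 u = 0"
  shows "u \<approx> 0"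
  unfolding eqv_def filt_def
proof (intro allI impI)
  fix w :: "'a list" assume w: "length w < M"
  have "[:0, 1:] * pderiv (cf u w) = 0"
    using assms(1) w by (simp add: eqv_def filt_def)
  then have "degree (cf u w) = 0"
    by (simp add: pderiv_eq_0_iff)
  then obtain c where c: "cf u w = [:c:]" by (metis degree_0_id)
  have "cf (sp 0 u) w = 0" using assms(2) by simp
  then show "cf (u - 0) w = 0" using c by simp
qed

text \<open>The same words are regrouped from the number of pairs to the total degree, and those of
  degree at least \<open>M\<close> are dropped. The coefficient of \<open>lnX\<close> is the
  alternating factor of Dynkin's formula; the \<open>1 / m\<close> in \<open>dyn_coeff\<close> is
  still missing and will come from integration.\<close>

lemma sum_wsum:
  assumes "filt 1 U" "filt 1 V"
  shows "(\<Sum>n<M. sc [:lnX $ n:] (wsum U V (Suc n))) \<approx>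
    (\<Sum>m\<in>{1..<M}. \<Sum>rs\<in>{rs. nzp rs \<and> tot rs = m}. sc [:of_nat m * dyn_coeff m rs:] (nst (dyn_word U V rs)))"
proof -
  let ?B = "{..<M} \<times> {..<M} - {(0::nat, 0::nat)}"
  let ?L = "\<lambda>n. {rs. length rs = n \<and> set rs \<subseteq> ?B}"
  define R where "R = {rs. (nzp rs \<and> tot rs < M) \<and> rs \<noteq> []}"
  define t where "t rs = sc [:(- 1) ^ (length rs - 1) / of_nat (length rs) * wt rs:] (nst (dyn_word U V rs))" for rs
  have finR: "finite R"
    unfolding R_def by (rule finite_subset[OF _ finite_nzp_tot[of M]]) auto
  have finL: "finite (?L n)" for n
  proof -
    have "finite {rs. set rs \<subseteq> ?B \<and> length rs = n}" by (rule finite_lists_length_eq) simp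
    then show ?thesis by (rule rev_finite_subset) auto
  qed
  have RL: "{rs\<in>R. length rs - 1 = n} = ?L (Suc n) \<inter> {rs. tot rs < M}" for n
  proof (intro equalityI subsetI)
    fix rs assume "rs \<in> {rs\<in>R. length rs - 1 = n}"
    then have rs: "nzp rs" "tot rs < M" "length rs = Suc n" by (auto simp: R_def neq_Nil_conv)
    have "x \<in> ?B" if x: "x \<in> set rs" for x
    proof -
      have "fst x + snd x < M" using entries_le_tot[of "fst x" "snd x" rs] x rs(2) by simp
      moreover have "fst x + snd x \<noteq> 0" using rs(1) x by (auto simp: nzp_def)
      ultimately show ?thesis by (cases x) auto
    qed
    then show "rs \<in> ?L (Suc n) \<inter> {rs. tot rs < M}" using rs by blast
  next
    fix rs assume rs: "rs \<in> ?L (Suc n) \<inter> {rs. tot rs < M}"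
    then have "nzp rs" by (fastforce simp: nzp_def)
    then show "rs \<in> {rs\<in>R. length rs - 1 = n}" using rs by (auto simp: R_def)
  qed
  have "(\<Sum>n<M. sc [:lnX $ n:] (wsum U V (Suc n))) = (\<Sum>n<M. \<Sum>rs\<in>?L (Suc n). t rs)"
    unfolding wsum_def sc_sum by (intro sum.cong refl) (simp add: t_def lnX_def mult.commute del: of_nat_Suc)
  also have "\<dots> \<approx> (\<Sum>n<M. \<Sum>rs\<in>?L (Suc n) \<inter> {rs. tot rs < M}. t rs)"
  proof (rule eqv_sum)
    fix n
    have e: "(\<Sum>rs\<in>?L (Suc n). t rs) = (\<Sum>rs\<in>?L (Suc n) \<inter> {rs. tot rs < M}. t rs) +
        (\<Sum>rs\<in>?L (Suc n) - {rs. tot rs < M}. t rs)"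
      by (rule sum.Int_Diff[OF finL])
    have fl: "filt M (\<Sum>rs\<in>?L (Suc n) - {rs. tot rs < M}. t rs)"
    proof (rule filt_sum)
      fix rs assume "rs \<in> ?L (Suc n) - {rs. tot rs < M}"
      then have "M \<le> tot rs" by auto
      then show "filt M (t rs)" unfolding t_def by (intro filt_sc filt_mono[OF filt_dyn[OF assms]])
    qed
    show "(\<Sum>rs\<in>?L (Suc n). t rs) \<approx> (\<Sum>rs\<in>?L (Suc n) \<inter> {rs. tot rs < M}. t rs)"
      unfolding e by (rule eqv_sym[OF eqv_add_filt[OF fl]])
  qed
  also have "\<dots> = (\<Sum>rs\<in>R. t rs)"
    unfolding RL[symmetric]
  proof (rule sum.group[OF finR])
    show "(\<lambda>rs. length rs - 1) ` R \<subseteq> {..<M}"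
    proof
      fix n assume "n \<in> (\<lambda>rs. length rs - 1) ` R"
      then obtain rs where "nzp rs" "tot rs < M" "n = length rs - 1" by (auto simp: R_def)
      then show "n \<in> {..<M}" using length_le_tot[of rs] by simp
    qed
  qed simp
  also have "\<dots> = (\<Sum>m\<in>{1..<M}. \<Sum>rs\<in>{rs\<in>R. tot rs = m}. t rs)"
  proof (rule sum.group[OF finR, symmetric])
    show "tot ` R \<subseteq> {1..<M}"
    proof
      fix n assume "n \<in> tot ` R"
      then obtain rs where "nzp rs" "tot rs < M" "n = tot rs" "rs \<noteq> []" by (auto simp: R_def)
      then show "n \<in> {1..<M}" using length_le_tot[of rs] by (cases rs) auto
    qed
  qed simp
  also have "\<dots> = (\<Sum>m\<in>{1..<M}. \<Sum>rs\<in>{rs. nzp rs \<and> tot rs = m}. sc [:of_nat m * dyn_coeff m rs:] (nst (dyn_word U V rs)))"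
  proof (intro sum.cong refl)
    fix m assume m: "m \<in> {1..<M}"
    then show "{rs\<in>R. tot rs = m} = {rs. nzp rs \<and> tot rs = m}"
      by (auto simp: R_def tot_def)
    fix rs assume "rs \<in> {rs. nzp rs \<and> tot rs = m}"
    show "t rs = sc [:of_nat m * dyn_coeff m rs:] (nst (dyn_word U V rs))"
      using m by (simp add: t_def dyn_coeff_wt)
  qed
  finally show ?thesis .
qed

text \<open>For \<open>exp H = exp (s u) exp (s v)\<close> the logarithmic derivative in
  \<open>s\<close> is \<open>W = u + exp (ad (s u)) v\<close>, hence \<open>dexp (ad H)\<close> maps
  the derivative of \<open>H\<close> to \<open>W\<close>. Inverting \<open>dexp\<close> needs only
  \<open>exp (ad H)\<close>, which equals \<open>exp (ad (s u)) exp (ad (s v))\<close>; in this way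
  \<open>H\<close> disappears from the right-hand side.\<close>

theorem xp_bch:
  assumes u: "filt 1 u" "const u" and v: "filt 1 v" "const v"
  shows "xp (bch M u v) \<approx> xp u * xp v"
proof -
  define s where "s = [:0, 1::rat:]"
  define U V where "U = sc s u" and "V = sc s v"
  define G where "G = xp U * xp V"
  define H where "H = lg (G - 1)"
  define W where "W = u + ev (fps_exp 1) (comm U) v"
  have U: "filt 1 U" and V: "filt 1 V"
    using u v by (simp_all add: U_def V_def filt_sc)
  have "filt (1 + 0) ((xp U - 1) * xp V)"
    by (rule filt_mult[OF filt_xp_diff[OF U]]) simp
  from filt_add[OF this[simplified] filt_xp_diff[OF V, simplified]] have G1: "filt 1 (G - 1)"
    by (simp add: G_def algebra_simps)
  have H: "filt 1 H"
    unfolding H_def by (rule filt_ser[OF G1]) simp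
  have HG: "xp H \<approx> G"
    using xp_lg[OF G1] by (simp add: H_def)
  \<comment> \<open>On a line through the origin the commutator of \<open>s x\<close> with its
    derivative \<open>x\<close> is zero, so only the leading term of \<open>dexp\<close>
    remains.\<close>
  have exp_line: "dl (xp (sc s x)) \<approx> x * xp (sc s x)" if "filt 1 x" "const x" for x
  proof -
    obtain m where m: "M = Suc m" using M2 by (cases M) auto
    have "comm (sc s x) x = 0" by (simp add: comm_def)
    then have "(comm (sc s x) ^^ Suc j) x = 0" for j
      by (induction j) simp_all
    then have "ev dexp (comm (sc s x)) x = x"
      unfolding ev_def unfolding m
      by (simp add: sum.lessThan_Suc_shift dexp_def del: sum.lessThan_Suc funpow.simps(2) flip: one_pCons)
    moreover have "dl (sc s x) = x"
      by (simp add: dl_sc s_def dl_const that pderiv_pCons flip: one_pCons)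
    ultimately show ?thesis
      using xp_deriv[of "sc s x"] that by (simp add: filt_sc)
  qed
  have "dl G \<approx> u * xp U * xp V + xp U * (v * xp V)"
    unfolding G_def dl_mult using exp_line[OF u] exp_line[OF v]
    by (intro eqv_add eqv_mult) (simp_all add: U_def V_def)
  also have "\<dots> \<approx> u * xp U * xp V + ev (fps_exp 1) (comm U) v * xp U * xp V"
    using eqv_mult[OF xp_conj[OF U, of v] eqv_refl[of "xp V"]]
    by (intro eqv_add) (simp_all add: mult.assoc)
  also have "\<dots> = W * G"
    by (simp add: W_def G_def algebra_simps)
  finally have dG: "dl G \<approx> W * G" .
  have W: "ev dexp (comm H) (dl H) \<approx> W"
  proof (rule eqv_cancel_xp[OF H])
    have "ev dexp (comm H) (dl H) * xp H \<approx> dl (xp H)"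
      by (rule eqv_sym[OF xp_deriv[OF H]])
    also have "\<dots> \<approx> dl G" by (rule eqv_dl[OF HG])
    also note dG
    also have "W * G \<approx> W * xp H" by (intro eqv_mult eqv_refl eqv_sym[OF HG])
    finally show "ev dexp (comm H) (dl H) * xp H \<approx> W * xp H" .
  qed
  \<comment> \<open>Both sides are conjugation of \<open>z\<close> by \<open>G\<close>, once through
    \<open>H\<close> and once through the two factors.\<close>
  have Gam: "ev (fps_exp 1) (comm H) z \<approx> z + dop U V z" for z
  proof (rule eqv_cancel_xp[OF H])
    have "ev (fps_exp 1) (comm H) z * xp H \<approx> xp H * z"
      by (rule eqv_sym[OF xp_conj[OF H]])
    also have "\<dots> \<approx> G * z" by (intro eqv_mult eqv_refl HG)
    also have "G * z = xp U * (xp V * z)" by (simp add: G_def mult.assoc)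
    also have "\<dots> \<approx> xp U * (ev (fps_exp 1) (comm V) z * xp V)"
      by (intro eqv_mult eqv_refl xp_conj V)
    also have "\<dots> = xp U * ev (fps_exp 1) (comm V) z * xp V" by (simp add: mult.assoc)
    also have "\<dots> \<approx> ev (fps_exp 1) (comm U) (ev (fps_exp 1) (comm V) z) * xp U * xp V"
      by (intro eqv_mult eqv_refl xp_conj U)
    also have "\<dots> = (z + dop U V z) * G"
      by (simp add: ev_exp_comm_comm[OF U] G_def mult.assoc)
    also have "\<dots> \<approx> (z + dop U V z) * xp H" by (intro eqv_mult eqv_refl eqv_sym[OF HG])
    finally show "ev (fps_exp 1) (comm H) z * xp H \<approx> (z + dop U V z) * xp H" .
  qed
  define T where "T = ev (fps_exp 1 - 1) (comm H)"
  have T: "raising T"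
    unfolding T_def by (rule raising_ev[OF raising_comm[OF H]]) simp
  have D: "raising (dop U V)" by (rule raising_dop[OF U V])
  have TD: "T z \<approx> dop U V z" for z
    using eqv_diff[OF Gam[of z] eqv_refl[of z]] by (simp add: T_def ev_diff_series)
  have TDn: "(T ^^ n) z \<approx> (dop U V ^^ n) z" for n z
  proof (induction n)
    case (Suc n)
    show ?case using eqv_trans[OF TD[of "(T ^^ n) z"] raising_eqv[OF D Suc]] by simp
  qed simp
  have "dl H = ev ((lnX oo (fps_exp 1 - 1)) * dexp) (comm H) (dl H)"
    by (simp add: lnX_compose)
  also have "\<dots> \<approx> ev (lnX oo (fps_exp 1 - 1)) (comm H) (ev dexp (comm H) (dl H))"
    by (rule eqv_sym[OF ev_mult[OF raising_comm[OF H]]])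
  also have "\<dots> \<approx> ev (lnX oo (fps_exp 1 - 1)) (comm H) W"
    by (rule ev_eqv[OF raising_comm[OF H] W])
  also have "\<dots> \<approx> ev lnX T W"
    unfolding T_def by (rule eqv_sym[OF ev_compose[OF raising_comm[OF H]]]) simp
  also have "\<dots> \<approx> (\<Sum>n<M. sc [:lnX $ n:] ((dop U V ^^ n) W))"
    unfolding ev_def by (intro eqv_sum eqv_sc TDn)
  finally have "sc s (dl H) \<approx> sc s (\<Sum>n<M. sc [:lnX $ n:] ((dop U V ^^ n) W))"
    by (rule eqv_sc)
  also have "\<dots> = (\<Sum>n<M. sc [:lnX $ n:] ((dop U V ^^ n) (sc s W)))"
    by (simp add: sc_sum raising_pow[OF D] mult.commute)
  also have "\<dots> = (\<Sum>n<M. sc [:lnX $ n:] (wsum U V (Suc n)))"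
  proof -
    \<comment> \<open>Multiplication by \<open>s\<close> turns the bare \<open>u\<close> and
      \<open>v\<close> in \<open>W\<close> into \<open>U\<close> and \<open>V\<close>, giving the
      starting value of Dynkin's recursion.\<close>
    have "sc s W = wsum U V (Suc 0)"
      by (simp add: W_def wsum_1 sc_add_right ev_def sc_sum U_def[symmetric] V_def
          raising_pow[OF raising_comm[OF U]] mult.commute)
    moreover have "(dop U V ^^ n) (wsum U V (Suc 0)) = wsum U V (Suc n)" for n
      by (induction n) (simp_all add: dop_wsum[OF U V])
    ultimately show ?thesis by simp
  qed
  also note sum_wsum[OF U V]
  also have "(\<Sum>m\<in>{1..<M}. \<Sum>rs\<in>{rs. nzp rs \<and> tot rs = m}. sc [:of_nat m * dyn_coeff m rs:] (nst (dyn_word U V rs))) =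
      (\<Sum>m\<in>{1..<M}. \<Sum>rs\<in>{rs. nzp rs \<and> tot rs = m}. sc (monom (of_nat m * dyn_coeff m rs) m) (nst (dyn_word u v rs)))"
  proof (intro sum.cong refl)
    fix m rs assume "rs \<in> {rs. nzp rs \<and> tot rs = m}"
    then have "nst (dyn_word U V rs) = sc (s ^ m) (nst (dyn_word u v rs))"
      unfolding U_def V_def map_dyn_word[symmetric] nst_scale by (simp add: length_dyn_word)
    then show "sc [:of_nat m * dyn_coeff m rs:] (nst (dyn_word U V rs)) =
        sc (monom (of_nat m * dyn_coeff m rs) m) (nst (dyn_word u v rs))"
      by (simp add: s_def monom_altdef)
  qed
  finally have dH: "sc s (dl H) \<approx> \<dots>" .
  \<comment> \<open>The antiderivative vanishing at \<open>s = 0\<close>: a word of degree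
    \<open>m\<close> carries \<open>s ^ m\<close>, so integrating \<open>m\<close> times its
    coefficient against \<open>1 / s\<close> cancels the \<open>m\<close>. Its value at
    \<open>s = 1\<close> is \<open>bch M u v\<close>.\<close>
  define K where "K = (\<Sum>m\<in>{1..<M}. \<Sum>rs\<in>{rs. nzp rs \<and> tot rs = m}.
    sc (monom (dyn_coeff m rs) m) (nst (dyn_word u v rs)))"
  have "sc s (dl K) = (\<Sum>m\<in>{1..<M}. \<Sum>rs\<in>{rs. nzp rs \<and> tot rs = m}.
      sc (monom (of_nat m * dyn_coeff m rs) m) (nst (dyn_word u v rs)))"
    unfolding K_def dl_sum sc_sum
  proof (intro sum.cong refl)
    fix m rs assume m: "m \<in> {1..<M}"
    then obtain m' where m': "m = Suc m'" by (cases m) auto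
    have "s * monom c m' = monom c m" for c
      by (simp add: s_def m' monom_Suc)
    then show "sc s (dl (sc (monom (dyn_coeff m rs) m) (nst (dyn_word u v rs)))) =
        sc (monom (of_nat m * dyn_coeff m rs) m) (nst (dyn_word u v rs))"
      by (simp add: dl_sc pderiv_monom dl_const[OF const_dyn[OF u(2) v(2)]] m' del: of_nat_Suc)
  qed
  with dH have "sc [:0, 1:] (dl (H - K)) \<approx> 0"
    by (simp add: dl_diff sc_diff_right eqv_def s_def)
  moreover have "sp 0 (H - K) = 0"
  proof -
    have "sp 0 U = 0" "sp 0 V = 0" by (simp_all add: U_def V_def sp_sc s_def)
    then have "sp 0 G = 1"
      by (simp add: G_def sp_mult sp_ser ser_zero flip: one_pCons)
    then have "sp 0 H = 0" by (simp add: H_def sp_ser sp_diff ser_zero)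
    moreover have "sp 0 K = 0"
      unfolding K_def sp_sum by (intro sum.neutral ballI) (auto simp: sp_sc poly_monom power_0_left)
    ultimately show ?thesis by (simp add: sp_diff)
  qed
  ultimately have "H - K \<approx> 0" by (rule eqv_if_deriv_eqv)
  then have HK: "sp 1 H \<approx> sp 1 K"
    by (intro eqv_sp) (simp add: eqv_def)
  have K1: "sp 1 K = bch M u v"
    unfolding K_def bch_sum sp_sum
    by (intro sum.cong refl) (simp add: sp_sc poly_monom sp_const[OF const_dyn[OF u(2) v(2)]])
  have "xp (bch M u v) \<approx> xp (sp 1 H)"
    unfolding K1[symmetric] by (rule ser_cong[OF eqv_sym[OF HK]])
  also have "\<dots> \<approx> sp 1 G"
    using eqv_sp[OF HG, of 1] by (simp add: sp_ser)
  also have "sp 1 G = xp u * xp v"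
    by (simp add: G_def sp_mult sp_ser U_def V_def sp_sc s_def sp_const u v flip: one_pCons)
  finally show ?thesis .
qed

theorem bch_assoc:
  assumes "filt 1 u" "const u" "filt 1 v" "const v" "filt 1 w" "const w"
  shows "bch M (bch M u v) w \<approx> bch M u (bch M v w)"
proof (rule xp_inj)
  have "xp (bch M (bch M u v) w) \<approx> xp (bch M u v) * xp w"
    by (intro xp_bch filt_bch const_bch assms)
  also have "\<dots> \<approx> xp u * xp v * xp w"
    by (intro eqv_mult eqv_refl xp_bch assms)
  also have "\<dots> = xp u * (xp v * xp w)" by (rule mult.assoc)
  also have "\<dots> \<approx> xp u * xp (bch M v w)"
    by (intro eqv_mult eqv_refl eqv_sym[OF xp_bch] assms)
  also have "\<dots> \<approx> xp (bch M u (bch M v w))"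
    by (intro eqv_sym[OF xp_bch] filt_bch const_bch assms)
  finally show "xp (bch M (bch M u v) w) \<approx> xp (bch M u (bch M v w))" .
qed (intro filt_bch assms)+

end

section \<open>Lie rings\<close>

locale lie =
  fixes L :: "'a lie_ring"
  assumes lie: "lie_ring L"
begin

abbreviation carr where "carr \<equiv> lcarrier L"
abbreviation add (infixl \<open>\<oplus>\<close> 65) where "x \<oplus> y \<equiv> ladd L x y"
abbreviation neg (\<open>\<ominus> _\<close> [81] 80) where "\<ominus> x \<equiv> lneg L x"
abbreviation zero (\<open>\<zero>\<close>) where "\<zero> \<equiv> lzero L"
abbreviation br (\<open>\<lbrakk>_,/ _\<rbrakk>\<close>) where "\<lbrakk>x, y\<rbrakk> \<equiv> lbr L x y"

lemma closed [simp]: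
  "\<zero> \<in> carr"
  "x \<in> carr \<Longrightarrow> y \<in> carr \<Longrightarrow> x \<oplus> y \<in> carr"
  "x \<in> carr \<Longrightarrow> \<ominus> x \<in> carr"
  "x \<in> carr \<Longrightarrow> y \<in> carr \<Longrightarrow> \<lbrakk>x, y\<rbrakk> \<in> carr"
  using lie by (simp_all add: lie_ring_def)

lemma add_assoc: "x \<in> carr \<Longrightarrow> y \<in> carr \<Longrightarrow> z \<in> carr \<Longrightarrow> x \<oplus> y \<oplus> z = x \<oplus> (y \<oplus> z)"
  and add_comm: "x \<in> carr \<Longrightarrow> y \<in> carr \<Longrightarrow> x \<oplus> y = y \<oplus> x"
  and add_zero_left [simp]: "x \<in> carr \<Longrightarrow> \<zero> \<oplus> x = x"
  and add_neg_left [simp]: "x \<in> carr \<Longrightarrow> \<ominus> x \<oplus> x = \<zero>"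
  and br_add_left: "x \<in> carr \<Longrightarrow> y \<in> carr \<Longrightarrow> z \<in> carr \<Longrightarrow> \<lbrakk>x \<oplus> y, z\<rbrakk> = \<lbrakk>x, z\<rbrakk> \<oplus> \<lbrakk>y, z\<rbrakk>"
  and br_add_right: "x \<in> carr \<Longrightarrow> y \<in> carr \<Longrightarrow> z \<in> carr \<Longrightarrow> \<lbrakk>x, y \<oplus> z\<rbrakk> = \<lbrakk>x, y\<rbrakk> \<oplus> \<lbrakk>x, z\<rbrakk>"
  and br_self [simp]: "x \<in> carr \<Longrightarrow> \<lbrakk>x, x\<rbrakk> = \<zero>"
  and jacobi: "x \<in> carr \<Longrightarrow> y \<in> carr \<Longrightarrow> z \<in> carr \<Longrightarrow>
    \<lbrakk>x, \<lbrakk>y, z\<rbrakk>\<rbrakk> \<oplus> \<lbrakk>y, \<lbrakk>z, x\<rbrakk>\<rbrakk> \<oplus> \<lbrakk>z, \<lbrakk>x, y\<rbrakk>\<rbrakk> = \<zero>"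
  using lie unfolding lie_ring_def by blast+

lemma add_zero_right [simp]: "x \<in> carr \<Longrightarrow> x \<oplus> \<zero> = x"
  and add_neg_right [simp]: "x \<in> carr \<Longrightarrow> x \<oplus> \<ominus> x = \<zero>"
  using add_comm[of x \<zero>] add_comm[of x "\<ominus> x"] by simp_all

lemma add_left_comm: "x \<in> carr \<Longrightarrow> y \<in> carr \<Longrightarrow> z \<in> carr \<Longrightarrow> x \<oplus> (y \<oplus> z) = y \<oplus> (x \<oplus> z)"
  by (metis add_assoc add_comm)

lemmas add_ac = add_assoc add_comm add_left_comm

lemma add_neg_cancel [simp]:
  "x \<in> carr \<Longrightarrow> y \<in> carr \<Longrightarrow> x \<oplus> (\<ominus> x \<oplus> y) = y"
  "x \<in> carr \<Longrightarrow> y \<in> carr \<Longrightarrow> \<ominus> x \<oplus> (x \<oplus> y) = y"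
  by (simp_all flip: add_assoc)

lemma add_cancel_left: "x \<in> carr \<Longrightarrow> y \<in> carr \<Longrightarrow> z \<in> carr \<Longrightarrow> x \<oplus> y = x \<oplus> z \<longleftrightarrow> y = z"
  by (metis add_neg_cancel(2))

lemma neg_unique: "x \<in> carr \<Longrightarrow> y \<in> carr \<Longrightarrow> x \<oplus> y = \<zero> \<Longrightarrow> y = \<ominus> x"
  by (metis add_cancel_left add_neg_right closed(3))

lemma neg_zero [simp]: "\<ominus> \<zero> = \<zero>"
  by (metis add_zero_left closed(1) neg_unique)

lemma neg_neg [simp]: "x \<in> carr \<Longrightarrow> \<ominus> (\<ominus> x) = x"
  by (metis add_neg_left closed(3) neg_unique)

lemma neg_add: "x \<in> carr \<Longrightarrow> y \<in> carr \<Longrightarrow> \<ominus> (x \<oplus> y) = \<ominus> x \<oplus> \<ominus> y"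
  by (rule neg_unique[symmetric]) (simp_all add: add_ac)

lemma br_zero [simp]: "x \<in> carr \<Longrightarrow> \<lbrakk>x, \<zero>\<rbrakk> = \<zero>" "x \<in> carr \<Longrightarrow> \<lbrakk>\<zero>, x\<rbrakk> = \<zero>"
  using br_add_right[of x \<zero> \<zero>] br_add_left[of \<zero> \<zero> x]
  by (metis add_cancel_left add_zero_right closed(1,4))+

lemma br_neg: "x \<in> carr \<Longrightarrow> y \<in> carr \<Longrightarrow> \<lbrakk>x, \<ominus> y\<rbrakk> = \<ominus> \<lbrakk>x, y\<rbrakk>"
  "x \<in> carr \<Longrightarrow> y \<in> carr \<Longrightarrow> \<lbrakk>\<ominus> x, y\<rbrakk> = \<ominus> \<lbrakk>x, y\<rbrakk>"
  by (rule neg_unique; simp flip: br_add_right br_add_left)+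

lemma br_anti: assumes "x \<in> carr" "y \<in> carr" shows "\<lbrakk>x, y\<rbrakk> = \<ominus> \<lbrakk>y, x\<rbrakk>"
proof (rule neg_unique)
  have "\<lbrakk>x \<oplus> y, x \<oplus> y\<rbrakk> = \<lbrakk>x, x \<oplus> y\<rbrakk> \<oplus> \<lbrakk>y, x \<oplus> y\<rbrakk>"
    using assms by (intro br_add_left) auto
  then have "\<lbrakk>x, y\<rbrakk> \<oplus> \<lbrakk>y, x\<rbrakk> = \<zero>"
    using assms by (simp add: br_add_right)
  then show "\<lbrakk>y, x\<rbrakk> \<oplus> \<lbrakk>x, y\<rbrakk> = \<zero>"
    using assms by (simp add: add_comm[of "\<lbrakk>y, x\<rbrakk>"])
qed (use assms in auto)

lemma br_br_left:
  assumes "x \<in> carr" "y \<in> carr" "z \<in> carr"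
  shows "\<lbrakk>\<lbrakk>x, y\<rbrakk>, z\<rbrakk> = \<lbrakk>x, \<lbrakk>y, z\<rbrakk>\<rbrakk> \<oplus> \<ominus> \<lbrakk>y, \<lbrakk>x, z\<rbrakk>\<rbrakk>"
proof -
  have "\<lbrakk>\<lbrakk>x, y\<rbrakk>, z\<rbrakk> = \<ominus> \<lbrakk>z, \<lbrakk>x, y\<rbrakk>\<rbrakk>" using assms by (intro br_anti) auto
  also have "\<dots> = \<lbrakk>x, \<lbrakk>y, z\<rbrakk>\<rbrakk> \<oplus> \<lbrakk>y, \<lbrakk>z, x\<rbrakk>\<rbrakk>"
    using assms jacobi[of x y z]
    by (intro neg_unique[symmetric]) (simp_all add: add_ac)
  also have "\<lbrakk>y, \<lbrakk>z, x\<rbrakk>\<rbrakk> = \<ominus> \<lbrakk>y, \<lbrakk>x, z\<rbrakk>\<rbrakk>"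
    using assms br_anti[of z x] by (simp add: br_neg)
  finally show ?thesis .
qed

lemma nsmul_0 [simp]: "nsmul L 0 x = \<zero>"
  and nsmul_Suc: "nsmul L (Suc n) x = x \<oplus> nsmul L n x"
  by (simp_all add: nsmul_def)

lemma nsmul_closed [simp]: "x \<in> carr \<Longrightarrow> nsmul L n x \<in> carr"
  by (induction n) (simp_all add: nsmul_Suc)

lemma nsmul_1 [simp]: "x \<in> carr \<Longrightarrow> nsmul L (Suc 0) x = x"
  by (simp add: nsmul_Suc)

lemma nsmul_add: "x \<in> carr \<Longrightarrow> nsmul L (m + n) x = nsmul L m x \<oplus> nsmul L n x"
  by (induction m) (simp_all add: nsmul_Suc add_assoc)

lemma nsmul_mult: "x \<in> carr \<Longrightarrow> nsmul L (m * n) x = nsmul L m (nsmul L n x)"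
  by (induction m) (simp_all add: nsmul_Suc nsmul_add)

lemma nsmul_zero [simp]: "nsmul L n \<zero> = \<zero>"
  by (induction n) (simp_all add: nsmul_Suc)

lemma nsmul_add_right:
  "x \<in> carr \<Longrightarrow> y \<in> carr \<Longrightarrow> nsmul L n (x \<oplus> y) = nsmul L n x \<oplus> nsmul L n y"
  by (induction n) (simp_all add: nsmul_Suc add_ac)

lemma nsmul_br:
  "x \<in> carr \<Longrightarrow> y \<in> carr \<Longrightarrow> \<lbrakk>x, nsmul L n y\<rbrakk> = nsmul L n \<lbrakk>x, y\<rbrakk>"
  "x \<in> carr \<Longrightarrow> y \<in> carr \<Longrightarrow> \<lbrakk>nsmul L n x, y\<rbrakk> = nsmul L n \<lbrakk>x, y\<rbrakk>"
  by (induction n) (simp_all add: nsmul_Suc br_add_left br_add_right)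

lemma subgroup_nsmul: "add_subgroup L S \<Longrightarrow> x \<in> S \<Longrightarrow> nsmul L n x \<in> S"
  by (induction n) (auto simp: nsmul_Suc add_subgroup_def)

lemma nsmul_card: assumes fin: "finite carr" and x: "x \<in> carr" shows "nsmul L (card carr) x = \<zero>"
proof -
  let ?G = "\<lparr>carrier = carr, monoid.mult = ladd L, one = \<zero>\<rparr>"
  have "comm_group ?G"
  proof (rule comm_groupI)
    fix x assume "x \<in> carrier ?G"
    then show "\<exists>y\<in>carrier ?G. y \<otimes>\<^bsub>?G\<^esub> x = \<one>\<^bsub>?G\<^esub>"
      by (intro bexI[of _ "\<ominus> x"]) auto
  qed (simp_all add: add_assoc, simp add: add_comm)
  then interpret G: comm_group ?G .
  have "x [^]\<^bsub>?G\<^esub> (n::nat) = nsmul L n x" for n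
    using x by (induction n) (simp_all add: nsmul_Suc add_comm)
  moreover have "x [^]\<^bsub>?G\<^esub> card (carrier ?G) = \<one>\<^bsub>?G\<^esub>"
    using G.power_order_eq_one[of x] fin x by simp
  ultimately show ?thesis by simp
qed

lemma nsmul_mod:
  assumes "finite carr" "x \<in> carr"
  shows "nsmul L (n mod card carr) x = nsmul L n x"
proof -
  have "nsmul L n x = nsmul L (n div card carr * card carr + n mod card carr) x"
    by simp
  also have "\<dots> = nsmul L (n mod card carr) x"
    by (simp only: nsmul_add[OF assms(2)] nsmul_mult[OF assms(2)] nsmul_card[OF assms])
      (simp add: assms)
  finally show ?thesis by simp
qed

lemma nsmul_cong: "finite carr \<Longrightarrow> x \<in> carr \<Longrightarrow> [m = n] (mod card carr) \<Longrightarrow> nsmul L m x = nsmul L n x"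
  by (metis cong_def nsmul_mod)

subsection \<open>The lower central series\<close>

lemma add_subgroup_lspan:
  assumes "S \<subseteq> carr" shows "add_subgroup L (lspan L S)"
proof -
  have "x \<in> carr" if "x \<in> lspan L S" for x
    using that by induction (use assms in auto)
  then show ?thesis by (auto simp: add_subgroup_def intro: lspan.intros)
qed

lemma add_subgroup_lcs: "add_subgroup L (lcs L k)"
proof (induction k)
  case 0
  show ?case by (simp add: add_subgroup_def)
next
  case (Suc k)
  then show ?case
    by (auto simp: add_subgroup_def intro!: add_subgroup_lspan[unfolded add_subgroup_def])
qed

lemma lcs_closed: "x \<in> lcs L k \<Longrightarrow> x \<in> carr"
  using add_subgroup_lcs[of k] by (auto simp: add_subgroup_def)

lemma lcs_Suc_subset: "lcs L (Suc k) \<subseteq> lcs L k"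
proof (induction k)
  case 0
  show ?case using lcs_closed[of _ "Suc 0"] unfolding lcs.simps(1) by blast
next
  case (Suc k)
  show ?case
  proof
    fix x assume "x \<in> lcs L (Suc (Suc k))"
    then have "x \<in> lspan L {\<lbrakk>a, b\<rbrakk> |a b. a \<in> carr \<and> b \<in> lcs L (Suc k)}" by simp
    then show "x \<in> lcs L (Suc k)"
      by induction (use Suc in \<open>auto intro: lspan.intros simp del: lcs.simps(2) simp: lcs.simps(2)[of L k]\<close>)
  qed
qed

lemma lcs_antimono: "i \<le> j \<Longrightarrow> lcs L j \<subseteq> lcs L i"
  by (rule lift_Suc_antimono_le[of "lcs L", OF lcs_Suc_subset])

text \<open>By Jacobi a bracket on the left unfolds into brackets with the factors, and induction on
  \<open>i\<close> applies. The extra \<open>Suc\<close> reflects that \<open>lcs L k\<close> is the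
  term number \<open>k + 1\<close> of the series.\<close>

lemma br_lcs: "x \<in> lcs L i \<Longrightarrow> y \<in> lcs L j \<Longrightarrow> \<lbrakk>x, y\<rbrakk> \<in> lcs L (Suc (i + j))"
proof (induction i arbitrary: x y j)
  case 0
  then show ?case by (auto intro: lspan.gen)
next
  case (Suc i)
  have sg: "add_subgroup L (lcs L (Suc (Suc i + j)))" by (rule add_subgroup_lcs)
  have y: "y \<in> carr" using Suc.prems lcs_closed by blast
  from Suc.prems(1) have "x \<in> lspan L {\<lbrakk>a, b\<rbrakk> |a b. a \<in> carr \<and> b \<in> lcs L i}" by simp
  then have "x \<in> carr \<and> \<lbrakk>x, y\<rbrakk> \<in> lcs L (Suc (Suc i + j))"
  proof induction
    case zero
    then show ?case using sg y by (simp add: add_subgroup_def del: lcs.simps)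
  next
    case (gen x)
    then obtain a b where ab: "x = \<lbrakk>a, b\<rbrakk>" "a \<in> carr" "b \<in> lcs L i" by auto
    have b: "b \<in> carr" using ab lcs_closed by blast
    have "\<lbrakk>a, \<lbrakk>b, y\<rbrakk>\<rbrakk> \<in> lcs L (Suc (Suc i + j))"
      using Suc.IH[OF ab(3) Suc.prems(2)] ab(2) by (auto intro: lspan.gen)
    moreover have "\<lbrakk>a, y\<rbrakk> \<in> lcs L (Suc j)"
      using ab(2) Suc.prems(2) by (auto intro: lspan.gen)
    then have "\<lbrakk>b, \<lbrakk>a, y\<rbrakk>\<rbrakk> \<in> lcs L (Suc (Suc i + j))"
      using Suc.IH[OF ab(3)] by fastforce
    ultimately show ?case
      using sg ab b y by (simp add: br_br_left add_subgroup_def del: lcs.simps)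
  next
    case (add a b)
    then show ?case using sg y by (simp add: br_add_left add_subgroup_def del: lcs.simps)
  next
    case (neg a)
    then show ?case using sg y by (simp add: br_neg add_subgroup_def del: lcs.simps)
  qed
  then show ?case by simp
qed

end

section \<open>Rational scalars prime to the order\<close>

text \<open>The localization of the integers at \<open>p\<close>. Any fraction with denominator
  prime to \<open>p\<close> may serve as witness, so sums and products need no reduction to lowest
  terms.\<close>

definition pint :: "nat \<Rightarrow> rat \<Rightarrow> bool" where
  "pint p q \<longleftrightarrow> (\<exists>a b. \<not> int p dvd b \<and> q * of_int b = of_int a)"

context
  fixes p :: nat
  assumes p: "prime p"
begin

lemma not_dvd_mult: "\<not> int p dvd a \<Longrightarrow> \<not> int p dvd b \<Longrightarrow> \<not> int p dvd a * b"
  using p by (simp add: prime_dvd_mult_iff)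

lemma pint_of_int [simp]: "pint p (of_int a)"
  unfolding pint_def using p
  by (intro exI[of _ a] exI[of _ 1]) (auto simp: prime_nat_iff)

lemma pint_of_nat [simp]: "pint p (of_nat a)" "pint p 0" "pint p 1"
  using pint_of_int[of "int a"] pint_of_int[of 0] pint_of_int[of 1] by simp_all

lemma pint_add: assumes "pint p q" "pint p r" shows "pint p (q + r)"
proof -
  obtain a b a' b' where *: "\<not> int p dvd b" "q * of_int b = of_int a" "\<not> int p dvd b'" "r * of_int b' = of_int a'"
    using assms by (auto simp: pint_def)
  have "(q + r) * of_int (b * b') = (q * of_int b) * of_int b' + (r * of_int b') * of_int b"
    by (simp add: algebra_simps)
  also have "\<dots> = of_int (a * b' + a' * b)" unfolding * by simp
  finally show ?thesis using not_dvd_mult[OF *(1,3)] unfolding pint_def by blast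
qed

lemma pint_mult: assumes "pint p q" "pint p r" shows "pint p (q * r)"
proof -
  obtain a b a' b' where *: "\<not> int p dvd b" "q * of_int b = of_int a" "\<not> int p dvd b'" "r * of_int b' = of_int a'"
    using assms by (auto simp: pint_def)
  have "(q * r) * of_int (b * b') = (q * of_int b) * (r * of_int b')"
    by (simp add: algebra_simps)
  also have "\<dots> = of_int (a * a')" unfolding * by simp
  finally show ?thesis using not_dvd_mult[OF *(1,3)] unfolding pint_def by blast
qed

lemma pint_minus: "pint p q \<Longrightarrow> pint p (- q)"
  using pint_mult[OF pint_of_int[of "-1"]] by simp

lemma pint_inverse_nat: "\<not> p dvd n \<Longrightarrow> pint p (1 / of_nat n)"
  unfolding pint_def
  by (intro exI[of _ 1] exI[of _ "int n"]) (cases "n = 0", auto)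

lemma pint_inverse_fact: "n < p \<Longrightarrow> pint p (1 / fact n)"
  using pint_inverse_nat[of "fact n"] prime_dvd_fact_iff[of p n] p by simp

lemma pint_power: "pint p q \<Longrightarrow> pint p (q ^ n)"
  by (induction n) (simp_all add: pint_mult)

text \<open>All denominators are products of numbers and factorials of numbers at most
  \<open>m\<close>, and \<open>m < p\<close>.\<close>

lemma pint_dyn_coeff:
  assumes "rs \<in> set (dyn_index m)" "1 \<le> m" "m < p"
  shows "pint p (dyn_coeff m rs)"
proof -
  have rs: "set rs \<subseteq> {0..<m+1} \<times> {0..<m+1}" "1 \<le> length rs" "length rs \<le> m"
    using assms(1) by (auto simp: dyn_index_def set_n_lists)
  have "pint p (wt rs)"
    using rs(1)
  proof (induction rs)
    case (Cons x rs)
    obtain r s where x: "x = (r, s)" by (cases x)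
    have "r < p" "s < p" using Cons.prems assms x by auto
    then have "pint p (1 / fact r * (1 / fact s) * wt rs)"
      using Cons by (intro pint_mult pint_inverse_fact) auto
    then show ?case by (simp add: x wt_def)
  qed (simp add: wt_def)
  moreover have "\<not> p dvd length rs" "\<not> p dvd m"
    using rs assms by (auto dest!: dvd_imp_le)
  ultimately have "pint p ((- 1) ^ (length rs - 1) * (1 / of_nat (length rs)) * (1 / of_nat m) * wt rs)"
    by (intro pint_mult pint_power pint_inverse_nat pint_minus pint_of_nat)
  then show ?thesis
    unfolding dyn_coeff_def wt_inverse by (simp add: algebra_simps)
qed

end

locale p_lie = lie +
  fixes p :: nat
  assumes prime_p: "prime p" and fin: "finite carr" and card_carr: "\<exists>k. card carr = p ^ k"
begin

definition res :: "rat \<Rightarrow> nat" where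
  "res q = (let (a, b) = quotient_of q; N = int (card carr); c = (SOME c. (b * c) mod N = 1 mod N)
     in nat ((a * c) mod N))"

lemma rat_smul_res: "rat_smul L q x = nsmul L (res q) x"
  by (simp add: rat_smul_def res_def Let_def split: prod.split)

lemma coprime_card: "\<not> int p dvd b \<Longrightarrow> coprime b (int (card carr))"
  using card_carr prime_p
  by (metis coprime_commute coprime_power_left_iff of_nat_power prime_imp_coprime prime_nat_int_transfer)

lemma card_pos: "0 < card carr"
  using fin closed(1) card_gt_0_iff by blast

text \<open>Pins down \<open>res q\<close> modulo the group order by any admissible fraction for
  \<open>q\<close>; the choice operator and the reduced fraction in the definition of the scalar
  action are not looked at again.\<close>

lemma cong_res:
  assumes "q * of_int b = of_int a" "\<not> int p dvd b"
  shows "[b * int (res q) = a] (mod int (card carr))"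
proof -
  let ?N = "int (card carr)"
  obtain a0 b0 where ab0: "quotient_of q = (a0, b0)" by (cases "quotient_of q")
  have b0: "b0 > 0" "coprime a0 b0" "q = of_int a0 / of_int b0"
    using quotient_of_denom_pos[OF ab0] quotient_of_coprime[OF ab0] quotient_of_div[OF ab0] by auto
  have "of_int (a0 * b) = (of_int (a * b0) :: rat)"
    using assms(1) b0 by (simp add: field_simps)
  then have e: "a0 * b = a * b0" by (simp only: of_int_eq_iff)
  have nd: "\<not> int p dvd b0"
  proof
    assume d: "int p dvd b0"
    then have "int p dvd a0 * b" unfolding e by simp
    then have "int p dvd a0" using assms(2) prime_p by (simp add: prime_dvd_mult_iff)
    then show False using d b0(2) prime_p by (meson coprime_common_divisor not_prime_unit prime_nat_int_transfer)
  qed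
  have "\<exists>c. (b0 * c) mod ?N = 1 mod ?N"
    using cong_solve_coprime_int[OF coprime_card[OF nd]] by (simp add: cong_def)
  then have c: "[b0 * (SOME c. (b0 * c) mod ?N = 1 mod ?N) = 1] (mod ?N)"
    unfolding cong_def by (rule someI_ex)
  define c where "c = (SOME c. (b0 * c) mod ?N = 1 mod ?N)"
  have "int (res q) = (a0 * c) mod ?N"
    using card_pos by (simp add: res_def ab0 Let_def c_def)
  then have "[int (res q) = a0 * c] (mod ?N)" by (simp add: cong_def)
  then have "[b0 * (b * int (res q)) = b0 * (b * (a0 * c))] (mod ?N)"
    by (intro cong_scalar_left)
  also have "b0 * (b * (a0 * c)) = (a0 * b) * (b0 * c)" by (simp add: algebra_simps)
  also have "[(a0 * b) * (b0 * c) = (a0 * b) * 1] (mod ?N)"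
    using c unfolding c_def by (rule cong_scalar_left)
  also have "a0 * b * 1 = b0 * a" using e by simp
  finally show ?thesis
    using cong_mult_lcancel[OF coprime_card[OF nd]] by blast
qed

lemma cong_res_iff:
  assumes "q * of_int b = of_int a" "\<not> int p dvd b" "[b * n = a] (mod int (card carr))"
  shows "[int (res q) = n] (mod int (card carr))"
  using cong_mult_lcancel[OF coprime_card[OF assms(2)], of "int (res q)" n]
    cong_trans[OF cong_res[OF assms(1,2)] cong_sym[OF assms(3)]] by blast

lemma res_add:
  assumes "pint p q" "pint p r"
  shows "[res (q + r) = res q + res r] (mod card carr)"
proof -
  obtain a b a' b' where *: "\<not> int p dvd b" "q * of_int b = of_int a" "\<not> int p dvd b'" "r * of_int b' = of_int a'"
    using assms by (auto simp: pint_def)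
  have "[int (res (q + r)) = int (res q) + int (res r)] (mod int (card carr))"
  proof (rule cong_res_iff)
    have "(q + r) * of_int (b * b') = (q * of_int b) * of_int b' + (r * of_int b') * of_int b"
      by (simp add: algebra_simps)
    then show "(q + r) * of_int (b * b') = of_int (a * b' + a' * b)" unfolding * by simp
    show "\<not> int p dvd b * b'" by (rule not_dvd_mult[OF prime_p *(1,3)])
    have "[b * int (res q) * b' + b' * int (res r) * b = a * b' + a' * b] (mod int (card carr))"
      by (intro cong_add cong_scalar_right cong_res *)
    then show "[b * b' * (int (res q) + int (res r)) = a * b' + a' * b] (mod int (card carr))"
      by (simp add: algebra_simps)
  qed
  then show ?thesis by (metis cong_int_iff of_nat_add)
qed

lemma res_mult:
  assumes "pint p q" "pint p r"
  shows "[res (q * r) = res q * res r] (mod card carr)"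
proof -
  obtain a b a' b' where *: "\<not> int p dvd b" "q * of_int b = of_int a" "\<not> int p dvd b'" "r * of_int b' = of_int a'"
    using assms by (auto simp: pint_def)
  have "[int (res (q * r)) = int (res q) * int (res r)] (mod int (card carr))"
  proof (rule cong_res_iff)
    have "(q * r) * of_int (b * b') = (q * of_int b) * (r * of_int b')"
      by (simp add: algebra_simps)
    then show "(q * r) * of_int (b * b') = of_int (a * a')" unfolding * by simp
    show "\<not> int p dvd b * b'" by (rule not_dvd_mult[OF prime_p *(1,3)])
    have "[(b * int (res q)) * (b' * int (res r)) = a * a'] (mod int (card carr))"
      by (intro cong_mult cong_res *)
    then show "[b * b' * (int (res q) * int (res r)) = a * a'] (mod int (card carr))"
      by (simp add: algebra_simps)
  qed
  then show ?thesis by (metis cong_int_iff of_nat_mult)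
qed

lemma res_of_nat: "[res (of_nat n) = n] (mod card carr)"
proof -
  have "[int (res (of_nat n)) = int n] (mod int (card carr))"
    by (rule cong_res_iff[of _ 1 "int n"]) (use prime_p in \<open>auto simp: prime_nat_iff\<close>)
  then show ?thesis by (simp add: cong_int_iff)
qed

abbreviation rsm (infixr \<open>\<bullet>\<close> 75) where "q \<bullet> x \<equiv> rat_smul L q x"

lemma rsm_closed [simp]: "x \<in> carr \<Longrightarrow> q \<bullet> x \<in> carr"
  by (simp add: rat_smul_res)

lemma rsm_zero_right [simp]: "q \<bullet> \<zero> = \<zero>"
  by (simp add: rat_smul_res)

lemma rsm_add_right: "x \<in> carr \<Longrightarrow> y \<in> carr \<Longrightarrow> q \<bullet> (x \<oplus> y) = q \<bullet> x \<oplus> q \<bullet> y"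
  by (simp add: rat_smul_res nsmul_add_right)

lemma rsm_add_left: "pint p q \<Longrightarrow> pint p r \<Longrightarrow> x \<in> carr \<Longrightarrow> (q + r) \<bullet> x = q \<bullet> x \<oplus> r \<bullet> x"
  using nsmul_cong[OF fin _ res_add] by (simp add: rat_smul_res nsmul_add)

lemma rsm_mult: "pint p q \<Longrightarrow> pint p r \<Longrightarrow> x \<in> carr \<Longrightarrow> (q * r) \<bullet> x = q \<bullet> r \<bullet> x"
  using nsmul_cong[OF fin _ res_mult] by (simp add: rat_smul_res nsmul_mult)

lemma rsm_of_nat: "x \<in> carr \<Longrightarrow> of_nat n \<bullet> x = nsmul L n x"
  using nsmul_cong[OF fin _ res_of_nat] by (simp add: rat_smul_res)

lemma rsm_one [simp]: "x \<in> carr \<Longrightarrow> 1 \<bullet> x = x"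
  and rsm_zero [simp]: "x \<in> carr \<Longrightarrow> 0 \<bullet> x = \<zero>"
  using rsm_of_nat[of x 1] rsm_of_nat[of x 0] by simp_all

lemma rsm_neg_right: "x \<in> carr \<Longrightarrow> q \<bullet> (\<ominus> x) = \<ominus> (q \<bullet> x)"
  by (rule neg_unique) (simp_all flip: rsm_add_right)

lemma rsm_minus: "pint p q \<Longrightarrow> x \<in> carr \<Longrightarrow> (- q) \<bullet> x = \<ominus> (q \<bullet> x)"
  by (rule neg_unique) (simp_all add: pint_minus[OF prime_p] flip: rsm_add_left)

lemma rsm_br: "x \<in> carr \<Longrightarrow> y \<in> carr \<Longrightarrow> \<lbrakk>x, q \<bullet> y\<rbrakk> = q \<bullet> \<lbrakk>x, y\<rbrakk>"
  "x \<in> carr \<Longrightarrow> y \<in> carr \<Longrightarrow> \<lbrakk>q \<bullet> x, y\<rbrakk> = q \<bullet> \<lbrakk>x, y\<rbrakk>"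
  by (simp_all add: rat_smul_res nsmul_br)

lemma subgroup_rsm: "add_subgroup L S \<Longrightarrow> x \<in> S \<Longrightarrow> q \<bullet> x \<in> S"
  by (simp add: rat_smul_res subgroup_nsmul)

end

section \<open>Associativity of the Campbell--Hausdorff product\<close>

text \<open>Removal of a leading letter. The product rule \<open>lsh_mult\<close> is what lets the
  operators below be defined and multiplied by recursion on the degree.\<close>

definition lsh :: "'l \<Rightarrow> 'l ncs \<Rightarrow> 'l ncs" where
  "lsh a u = Abs_ncs (\<lambda>w. cf u (a # w))"

lemma cf_lsh [simp]: "cf (lsh a u) w = cf u (a # w)"
  by (simp add: lsh_def)

lemma lsh_add: "lsh a (u + v) = lsh a u + lsh a v"
  and lsh_sc: "lsh a (sc c u) = sc c (lsh a u)"
  and lsh_mult: "lsh a (u * v) = lsh a u * v + sc (cf u []) (lsh a v)"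
  by (rule ncs_eqI, simp add: cf_times lsh_def)+

definition homog :: "nat \<Rightarrow> 'l ncs \<Rightarrow> bool" where
  "homog n u \<longleftrightarrow> (\<forall>w. length w \<noteq> n \<longrightarrow> cf u w = 0)"

lemma homog_lsh: "homog (Suc n) u \<Longrightarrow> homog n (lsh a u)"
  by (simp add: homog_def)

lemma homog_sc: "homog n u \<Longrightarrow> homog n (sc c u)"
  and homog_diff: "homog n u \<Longrightarrow> homog n v \<Longrightarrow> homog n (u - v)"
  by (simp_all add: homog_def)

lemma homog_0: "homog 0 u \<Longrightarrow> u = sc (cf u []) 1"
  by (rule ncs_eqI) (auto simp: homog_def cf_one)

lemma homog_mult: "homog i u \<Longrightarrow> homog j v \<Longrightarrow> homog (i + j) (u * v)"
proof (induction i arbitrary: u)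
  case 0
  then have "u * v = sc (cf u []) v" using homog_0[of u] by (metis mult_1 sc_mult_left)
  then show ?case using 0 by (simp add: homog_sc)
next
  case (Suc i)
  have "cf (u * v) w = 0" if "length w \<noteq> Suc i + j" for w
  proof (cases w)
    case Nil
    then show ?thesis using Suc.prems by (simp add: cf_times homog_def)
  next
    case (Cons a w')
    have "cf (lsh a (u * v)) w' = 0"
      using Suc.IH[OF homog_lsh[OF Suc.prems(1)] Suc.prems(2)] that Cons Suc.prems(1)
      by (simp add: lsh_mult homog_def)
    then show ?thesis using Cons by simp
  qed
  then show ?case by (simp add: homog_def)
qed

locale p_lie_nilp = p_lie +
  assumes nilp: "nilpotent_class_less L p"
begin

abbreviation rc :: "'l ncs \<Rightarrow> 'l list \<Rightarrow> rat" where "rc u w \<equiv> coeff (cf u w) 0"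

definition pints :: "'l ncs \<Rightarrow> bool" where
  "pints u \<longleftrightarrow> (\<forall>w. pint p (rc u w))"

lemma pints_add: "pints u \<Longrightarrow> pints v \<Longrightarrow> pints (u + v)"
  and pints_zero [simp]: "pints 0"
  and pints_sc: "pint p (coeff c 0) \<Longrightarrow> pints u \<Longrightarrow> pints (sc c u)"
  and pints_lsh: "pints u \<Longrightarrow> pints (lsh a u)"
  by (simp_all add: pints_def pint_add pint_mult prime_p coeff_mult_0)

lemma pint_conv:
  "(\<And>x. pint p (coeff (u x) 0)) \<Longrightarrow> (\<And>x. pint p (coeff (v x) 0)) \<Longrightarrow> pint p (coeff (conv w u v) 0)"
  by (induction w arbitrary: u) (simp_all add: pint_add pint_mult prime_p coeff_mult_0)

lemma pints_mult: "pints u \<Longrightarrow> pints v \<Longrightarrow> pints (u * v)"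
  unfolding pints_def cf_times by (intro allI pint_conv) simp_all

lemma pints_minus: "pints u \<Longrightarrow> pints (- u)"
  by (simp add: pints_def pint_minus prime_p)

lemma pints_diff: "pints u \<Longrightarrow> pints v \<Longrightarrow> pints (u - v)"
  using pints_add[OF _ pints_minus, of u v] by simp

text \<open>The sum over the alphabet: \<open>bool option\<close> has three elements, one for each
  factor in the associative law.\<close>

definition sum3 :: "(bool option \<Rightarrow> 'a) \<Rightarrow> 'a" where
  "sum3 h = h None \<oplus> (h (Some False) \<oplus> h (Some True))"

lemma sum3_closed [simp]: "(\<And>a. h a \<in> carr) \<Longrightarrow> sum3 h \<in> carr"
  by (simp add: sum3_def)

lemma sum3_add: "(\<And>a. h a \<in> carr) \<Longrightarrow> (\<And>a. k a \<in> carr) \<Longrightarrow> sum3 (\<lambda>a. h a \<oplus> k a) = sum3 h \<oplus> sum3 k"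
  by (simp add: sum3_def add_ac)

lemma sum3_rsm: "(\<And>a. h a \<in> carr) \<Longrightarrow> sum3 (\<lambda>a. q \<bullet> h a) = q \<bullet> sum3 h"
  by (simp add: sum3_def rsm_add_right)

lemma sum3_delta: "x \<in> carr \<Longrightarrow> sum3 (\<lambda>b. if b = a then x else \<zero>) = x"
  by (cases a; cases "the a") (simp_all add: sum3_def)

end

section \<open>Lifting elements of the Lie ring to series in three letters\<close>

locale p_lie_letters = p_lie_nilp +
  fixes x :: "bool option \<Rightarrow> 'a"
  assumes x_carr [simp]: "x a \<in> carr"
begin

text \<open>The Dynkin operator on the part of degree \<open>n\<close>: a word goes to the
  right-nested bracket of the corresponding elements. Its companion \<open>adj\<close> sends a word
  to the composition of their adjoint actions; together they replace a map into an enveloping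
  algebra.\<close>

fun dyn :: "nat \<Rightarrow> bool option ncs \<Rightarrow> 'a" where
  "dyn 0 u = \<zero>"
| "dyn (Suc 0) u = sum3 (\<lambda>a. rc u [a] \<bullet> x a)"
| "dyn (Suc (Suc n)) u = sum3 (\<lambda>a. \<lbrakk>x a, dyn (Suc n) (lsh a u)\<rbrakk>)"

fun adj :: "nat \<Rightarrow> bool option ncs \<Rightarrow> 'a \<Rightarrow> 'a" where
  "adj 0 u z = rc u [] \<bullet> z"
| "adj (Suc n) u z = sum3 (\<lambda>a. \<lbrakk>x a, adj n (lsh a u) z\<rbrakk>)"

lemma dyn_closed [simp]: "dyn n u \<in> carr"
  by (induction n u rule: dyn.induct) simp_all

lemma adj_closed [simp]: "z \<in> carr \<Longrightarrow> adj n u z \<in> carr"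
  by (induction n arbitrary: u) simp_all

lemma dyn_add: "pints u \<Longrightarrow> pints v \<Longrightarrow> dyn n (u + v) = dyn n u \<oplus> dyn n v"
proof (induction n u arbitrary: v rule: dyn.induct)
  case (2 u)
  then show ?case by (simp add: rsm_add_left pints_def flip: sum3_add)
next
  case (3 n u)
  then show ?case by (simp add: lsh_add br_add_right pints_lsh flip: sum3_add)
qed simp

lemma adj_add: "pints u \<Longrightarrow> pints v \<Longrightarrow> z \<in> carr \<Longrightarrow> adj n (u + v) z = adj n u z \<oplus> adj n v z"
proof (induction n arbitrary: u v)
  case 0
  then show ?case by (simp add: rsm_add_left pints_def)
next
  case (Suc n)
  then show ?case by (simp add: lsh_add br_add_right pints_lsh flip: sum3_add)
qed

lemma dyn_sc: "pints u \<Longrightarrow> pint p (coeff c 0) \<Longrightarrow> dyn n (sc c u) = coeff c 0 \<bullet> dyn n u"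
proof (induction n u rule: dyn.induct)
  case (2 u)
  then show ?case by (simp add: rsm_mult pints_def coeff_mult_0 flip: sum3_rsm)
next
  case (3 n u)
  then show ?case by (simp add: lsh_sc rsm_br pints_lsh flip: sum3_rsm)
qed simp

lemma adj_sc: "pints u \<Longrightarrow> pint p (coeff c 0) \<Longrightarrow> z \<in> carr \<Longrightarrow> adj n (sc c u) z = coeff c 0 \<bullet> adj n u z"
proof (induction n arbitrary: u)
  case 0
  then show ?case by (simp add: rsm_mult pints_def coeff_mult_0)
next
  case (Suc n)
  then show ?case by (simp add: lsh_sc rsm_br pints_lsh flip: sum3_rsm)
qed

lemma minus_sc: "- u = sc (- 1) u"
  by (rule ncs_eqI) simp

lemma dyn_diff: "pints u \<Longrightarrow> pints v \<Longrightarrow> dyn n (u - v) = dyn n u \<oplus> \<ominus> dyn n v"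
  using dyn_add[OF _ pints_minus, of u v n] dyn_sc[of v "- 1" n]
  by (simp add: minus_sc[symmetric] pint_minus prime_p rsm_minus)

lemma adj_diff: "pints u \<Longrightarrow> pints v \<Longrightarrow> z \<in> carr \<Longrightarrow> adj n (u - v) z = adj n u z \<oplus> \<ominus> adj n v z"
  using adj_add[OF _ pints_minus, of u v z n] adj_sc[of v "- 1" z n]
  by (simp add: minus_sc[symmetric] pint_minus prime_p rsm_minus)

lemma dyn_cong: "(\<And>w. length w = n \<Longrightarrow> cf u w = cf v w) \<Longrightarrow> dyn n u = dyn n v"
proof (induction n u arbitrary: v rule: dyn.induct)
  case (3 n u)
  have "dyn (Suc n) (lsh a u) = dyn (Suc n) (lsh a v)" for a
    by (rule 3(1)) (simp add: 3)
  then show ?case by simp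
qed simp_all

lemma dyn_zero: "dyn n 0 = \<zero>"
  using dyn_sc[of 0 0 n] by (simp add: prime_p)

text \<open>Brackets are nested to the right, so the letters of \<open>u\<close> act by their
  adjoint maps on what \<open>v\<close> produces. The second degree is a successor because
  \<open>dyn\<close> sends degree zero to \<open>\<zero>\<close>.\<close>

lemma dyn_mult:
  assumes "pints u" "pints v" "homog i u"
  shows "dyn (i + Suc j) (u * v) = adj i u (dyn (Suc j) v)"
  using assms
proof (induction i arbitrary: u)
  case 0
  then have "u * v = sc (cf u []) v" using homog_0[of u] by (metis mult_1 sc_mult_left)
  then show ?case using 0 by (simp add: dyn_sc pints_def)
next
  case (Suc i)
  have "lsh a (u * v) = lsh a u * v" for a
    using Suc.prems by (simp add: lsh_mult homog_def)
  then show ?case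
    using Suc by (simp add: pints_lsh homog_lsh)
qed

lemma adj_mult:
  assumes "pints u" "pints v" "homog i u" "z \<in> carr"
  shows "adj (i + j) (u * v) z = adj i u (adj j v z)"
  using assms
proof (induction i arbitrary: u)
  case 0
  then have "u * v = sc (cf u []) v" using homog_0[of u] by (metis mult_1 sc_mult_left)
  then show ?case using 0 by (simp add: adj_sc pints_def)
next
  case (Suc i)
  have "lsh a (u * v) = lsh a u * v" for a
    using Suc.prems by (simp add: lsh_mult homog_def)
  then show ?case
    using Suc by (simp add: pints_lsh homog_lsh)
qed

text \<open>\<open>hrel n u l\<close> says that the series \<open>u\<close>, homogeneous of degree \<open>n + 1\<close>, lifts \<open>l\<close>. By the argument of
  Dynkin, Specht and Wever, \<open>u\<close> then determines \<open>(n + 1) \<cdot> l\<close>, hence \<open>l\<close> if \<open>n + 1 < p\<close>.\<close>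

definition hrel :: "nat \<Rightarrow> bool option ncs \<Rightarrow> 'a \<Rightarrow> bool" where
  "hrel n u l \<longleftrightarrow> homog (Suc n) u \<and> pints u \<and> l \<in> lcs L n \<and> dyn (Suc n) u = nsmul L (Suc n) l \<and>
     (\<forall>z\<in>carr. adj (Suc n) u z = \<lbrakk>l, z\<rbrakk>)"

lemma hrel_carr: "hrel n u l \<Longrightarrow> l \<in> carr"
  using lcs_closed by (auto simp: hrel_def)

text \<open>The Dynkin operator sends \<open>u * v - v * u\<close> to \<open>j + 1\<close> copies of
  \<open>\<lbrakk>l, m\<rbrakk>\<close> minus \<open>i + 1\<close> copies of
  \<open>\<lbrakk>m, l\<rbrakk>\<close>, and antisymmetry adds these to the total degree. The
  adjoint condition is preserved by Jacobi.\<close>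

lemma hrel_comm:
  assumes u: "hrel i u l" and v: "hrel j v m"
  shows "hrel (Suc (i + j)) (comm u v) \<lbrakk>l, m\<rbrakk>"
  unfolding hrel_def
proof (intro conjI ballI)
  note lm = hrel_carr[OF u] hrel_carr[OF v]
  note U = u[unfolded hrel_def] and V = v[unfolded hrel_def]
  have pi: "pints u" "pints v" using U V by auto
  show "homog (Suc (Suc (i + j))) (comm u v)"
    using homog_mult[of "Suc i" u "Suc j" v] homog_mult[of "Suc j" v "Suc i" u] U V
    unfolding comm_def by (intro homog_diff) (simp_all add: add.commute)
  show "pints (comm u v)"
    using U V by (simp add: comm_def pints_diff pints_mult)
  show "\<lbrakk>l, m\<rbrakk> \<in> lcs L (Suc (i + j))"
    using U V by (intro br_lcs) simp_all
  have 1: "dyn (Suc i + Suc j) (u * v) = \<lbrakk>l, nsmul L (Suc j) m\<rbrakk>"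
    using U V lm by (subst dyn_mult) (simp_all del: adj.simps dyn.simps)
  have 2: "dyn (Suc i + Suc j) (v * u) = \<lbrakk>m, nsmul L (Suc i) l\<rbrakk>"
    using U V lm by (subst add.commute, subst dyn_mult) (simp_all del: adj.simps dyn.simps)
  have "dyn (Suc i + Suc j) (comm u v) = nsmul L (Suc j) \<lbrakk>l, m\<rbrakk> \<oplus> \<ominus> nsmul L (Suc i) \<lbrakk>m, l\<rbrakk>"
    unfolding comm_def by (simp only: dyn_diff pints_mult pi 1 2 nsmul_br lm)
  also have "\<ominus> nsmul L (Suc i) \<lbrakk>m, l\<rbrakk> = nsmul L (Suc i) \<lbrakk>l, m\<rbrakk>"
  proof -
    have "\<ominus> nsmul L (Suc i) \<lbrakk>m, l\<rbrakk> = \<ominus> \<lbrakk>m, nsmul L (Suc i) l\<rbrakk>"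
      by (simp only: nsmul_br lm)
    also have "\<dots> = \<lbrakk>nsmul L (Suc i) l, m\<rbrakk>"
      by (rule br_anti[symmetric]) (simp_all only: nsmul_closed lm)
    finally show ?thesis by (simp only: nsmul_br lm)
  qed
  finally show "dyn (Suc (Suc (i + j))) (comm u v) = nsmul L (Suc (Suc (i + j))) \<lbrakk>l, m\<rbrakk>"
    using lm nsmul_add[of "\<lbrakk>l, m\<rbrakk>" "Suc j" "Suc i"] by (simp add: add.commute del: dyn.simps)
  fix z assume z: "z \<in> carr"
  have 3: "adj (Suc i + Suc j) (u * v) z = \<lbrakk>l, \<lbrakk>m, z\<rbrakk>\<rbrakk>"
    using U V lm z by (subst adj_mult) (simp_all del: adj.simps dyn.simps)
  have 4: "adj (Suc i + Suc j) (v * u) z = \<lbrakk>m, \<lbrakk>l, z\<rbrakk>\<rbrakk>"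
    using U V lm z by (subst add.commute, subst adj_mult) (simp_all del: adj.simps dyn.simps)
  have "adj (Suc i + Suc j) (comm u v) z = \<lbrakk>\<lbrakk>l, m\<rbrakk>, z\<rbrakk>"
    unfolding comm_def by (simp only: adj_diff pints_mult pi z 3 4 br_br_left lm)
  then show "adj (Suc (Suc (i + j))) (comm u v) z = \<lbrakk>\<lbrakk>l, m\<rbrakk>, z\<rbrakk>"
    by (simp del: adj.simps)
qed

lemma hrel_sc:
  assumes u: "hrel n u l" and q: "pint p q"
  shows "hrel n (sc [:q:] u) (q \<bullet> l)"
proof -
  note l = hrel_carr[OF u]
  have "q \<bullet> nsmul L k l = nsmul L k (q \<bullet> l)" for k
    using l by (metis mult.commute nsmul_mult rat_smul_res)
  then show ?thesis
    using u q l unfolding hrel_def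
    by (simp add: homog_sc pints_sc subgroup_rsm[OF add_subgroup_lcs] dyn_sc adj_sc rsm_br
        del: dyn.simps adj.simps lcs.simps)
qed

text \<open>Finite sums of homogeneous liftings. It is only a relation: that a series lifts at most
  one element is the point still to be proved.\<close>

inductive rel :: "bool option ncs \<Rightarrow> 'a \<Rightarrow> bool" where
  rel_zero: "rel 0 \<zero>"
| rel_step: "hrel n u l \<Longrightarrow> rel v m \<Longrightarrow> rel (u + v) (l \<oplus> m)"

lemma rel_carr: "rel u l \<Longrightarrow> l \<in> carr"
  by (induction rule: rel.induct) (simp_all add: hrel_carr)

lemma rel_hrel: "hrel n u l \<Longrightarrow> rel u l"
  using rel_step[OF _ rel_zero, of n u l] hrel_carr by simp

lemma rel_add: "rel u l \<Longrightarrow> rel v m \<Longrightarrow> rel (u + v) (l \<oplus> m)"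
proof (induction rule: rel.induct)
  case rel_zero
  then show ?case using rel_carr by simp
next
  case (rel_step n u l u' l')
  have "rel (u + (u' + v)) (l \<oplus> (l' \<oplus> m))"
    by (rule rel.rel_step[OF rel_step.hyps(1) rel_step.IH[OF rel_step.prems]])
  then show ?case using rel_step by (simp add: add.assoc add_assoc hrel_carr rel_carr)
qed

lemma rel_sc: "rel u l \<Longrightarrow> pint p q \<Longrightarrow> rel (sc [:q:] u) (q \<bullet> l)"
proof (induction rule: rel.induct)
  case rel_zero
  then show ?case using rel.rel_zero by simp
next
  case (rel_step n u l v m)
  then show ?case
    by (simp add: sc_add_right rsm_add_right hrel_carr rel_carr rel.rel_step[OF hrel_sc])
qed

lemma rel_comm:
  assumes "rel u l" "rel v m" shows "rel (comm u v) \<lbrakk>l, m\<rbrakk>"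
proof -
  have 1: "rel (comm u v) \<lbrakk>l, m\<rbrakk>" if "hrel n u l" "rel v m" for n u l v m
    using that(2,1)
  proof (induction rule: rel.induct)
    case rel_zero
    then show ?case using rel.rel_zero by (simp add: hrel_carr)
  next
    case (rel_step k u' l' v' m')
    have "comm u (u' + v') = comm u u' + comm u v'" by (simp add: comm_def algebra_simps)
    then show ?case
      using rel_step by (simp add: br_add_right hrel_carr rel_carr rel.rel_step[OF hrel_comm])
  qed
  show ?thesis
    using assms
  proof (induction rule: rel.induct)
    case rel_zero
    then show ?case using rel.rel_zero by (simp add: rel_carr comm_def)
  next
    case (rel_step n u' l' v' m')
    have "comm (u' + v') v = comm u' v + comm v' v" by (simp add: comm_def algebra_simps)
    then show ?case
      using rel_step by (simp add: br_add_left hrel_carr rel_carr rel_add[OF 1])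
  qed
qed

lemma rel_pints: "rel u l \<Longrightarrow> pints u"
  by (induction rule: rel.induct) (simp_all add: pints_add hrel_def)

primrec dynp :: "nat \<Rightarrow> bool option ncs \<Rightarrow> 'a" where
  "dynp 0 u = \<zero>"
| "dynp (Suc n) u = dynp n u \<oplus> (1 / of_nat (Suc n)) \<bullet> dyn (Suc n) u"

lemma dynp_closed [simp]: "dynp n u \<in> carr"
  by (induction n) simp_all

lemma dynp_add: "pints u \<Longrightarrow> pints v \<Longrightarrow> dynp n (u + v) = dynp n u \<oplus> dynp n v"
  by (induction n) (simp_all add: dyn_add rsm_add_right add_ac del: dyn.simps)

lemma dynp_zero: "dynp n 0 = \<zero>"
  by (induction n) (simp_all add: dyn_zero del: dyn.simps)

lemma dynp_cong: "(\<And>w. length w \<le> n \<Longrightarrow> cf u w = cf v w) \<Longrightarrow> dynp n u = dynp n v"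
proof (induction n)
  case (Suc n)
  have "dynp n u = dynp n v" "dyn (Suc n) u = dyn (Suc n) v"
    by (intro Suc.IH dyn_cong Suc.prems; simp)+
  then show ?case by simp
qed simp

text \<open>In degree \<open>n + 1 < p\<close> the factor \<open>n + 1\<close> is prime to the group
  order and can be divided out. In higher degree \<open>l\<close> lies in
  \<open>lcs L (p - 1)\<close> and is zero. Here the bound on the nilpotence class enters.\<close>

lemma dynp_hrel: assumes u: "hrel n u l" shows "dynp (p - 1) u = l"
proof -
  note l = hrel_carr[OF u]
  have other: "dyn k u = \<zero>" if "k \<noteq> Suc n" for k
    using dyn_cong[of k u 0] u that by (simp add: hrel_def homog_def dyn_zero)
  have low: "dynp k u = \<zero>" if "k \<le> n" for k
    using that by (induction k) (simp_all add: other del: dyn.simps)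
  show ?thesis
  proof (cases "Suc n < p")
    case True
    have nd: "\<not> p dvd Suc n" using True by (auto dest!: dvd_imp_le)
    have "(1 / of_nat (Suc n)) \<bullet> nsmul L (Suc n) l = (1 / of_nat (Suc n) * of_nat (Suc n)) \<bullet> l"
      using l pint_inverse_nat[OF prime_p nd] by (simp only: rsm_mult pint_of_nat prime_p rsm_of_nat)
    then have "(1 / of_nat (Suc n)) \<bullet> dyn (Suc n) u = l"
      using u l by (simp add: hrel_def del: of_nat_Suc dyn.simps)
    then have base: "dynp (Suc n) u = l" using low[of n] l by simp
    have later: "dynp (Suc n + k) u = l" for k
      using l by (induction k) (simp_all add: base other del: dyn.simps dynp.simps, simp add: other del: dyn.simps)
    have "p - 1 = Suc n + (p - 1 - Suc n)" using True by simp
    then show ?thesis using later[of "p - 1 - Suc n"] by (simp only:)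
  next
    case False
    then have "p - 1 \<le> n" by simp
    then have "l \<in> lcs L (p - 1)"
      using u lcs_antimono unfolding hrel_def by blast
    then have "l = \<zero>" using nilp by (simp add: nilpotent_class_less_def)
    then show ?thesis using low[of "p - 1"] False by simp
  qed
qed

lemma dynp_rel: "rel u l \<Longrightarrow> dynp (p - 1) u = l"
proof (induction rule: rel.induct)
  case (rel_step n u l v m)
  then show ?case using dynp_hrel[of n u l] rel_pints[of v m]
    by (simp add: dynp_add hrel_def del: dyn.simps adj.simps lcs.simps)
qed (simp add: dynp_zero)

text \<open>Each lifted element is recovered by \<open>dynp (p - 1)\<close>, which reads only
  coefficients of words shorter than \<open>p\<close>.\<close>

lemma rel_unique:
  assumes "rel u l" "rel v m" "filt p (u - v)"
  shows "l = m"
proof -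
  have "dynp (p - 1) u = dynp (p - 1) v"
    using assms(3) prime_gt_0_nat[OF prime_p]
    by (intro dynp_cong) (auto simp: filt_def)
  then show ?thesis using assms dynp_rel by metis
qed

definition letter :: "bool option \<Rightarrow> bool option ncs" where
  "letter a = Abs_ncs (\<lambda>w. if w = [a] then 1 else 0)"

lemma cf_letter: "cf (letter a) w = (if w = [a] then 1 else 0)"
  by (simp add: letter_def)

lemma rel_letter: "rel (letter a) (x a)"
proof (rule rel_hrel[of 0])
  have "(\<lambda>b. (if b = a then 1 else 0) \<bullet> x b) = (\<lambda>b. if b = a then x a else \<zero>)"
    by auto
  then have 1: "sum3 (\<lambda>b. (if b = a then 1 else 0) \<bullet> x b) = x a"
    by (simp only: sum3_delta x_carr)
  have 2: "sum3 (\<lambda>b. \<lbrakk>x b, (if b = a then 1 else 0) \<bullet> z\<rbrakk>) = \<lbrakk>x a, z\<rbrakk>" if "z \<in> carr" for z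
  proof -
    have "(\<lambda>b. \<lbrakk>x b, (if b = a then 1 else 0) \<bullet> z\<rbrakk>) = (\<lambda>b. if b = a then \<lbrakk>x a, z\<rbrakk> else \<zero>)"
      using that by auto
    then show ?thesis using that by (simp only: sum3_delta x_carr closed)
  qed
  have c: "coeff (if P then 1 else 0 :: rat poly) 0 = (if P then 1 else 0)" for P by simp
  show "hrel 0 (letter a) (x a)"
    unfolding hrel_def using 1 2
    by (auto simp: homog_def pints_def cf_letter c prime_p)
qed

lemma filt_letter: "filt 1 (letter a)"
  and const_letter: "const (letter a)"
  by (auto simp: filt_def const_def cf_letter intro: exI[of _ 1] exI[of _ 0] simp flip: one_pCons)

lemma rel_nest: "list_all2 rel us ls \<Longrightarrow> rel (nst us) (nest L ls)"
proof (induction us arbitrary: ls)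
  case (Cons u us)
  then obtain l ls' where ls: "ls = l # ls'" "rel u l" "list_all2 rel us ls'"
    by (auto simp: list_all2_Cons1)
  show ?case
  proof (cases us)
    case Nil
    then show ?thesis using ls by simp
  next
    case (Cons v vs)
    then obtain m ms where "ls' = m # ms" using ls by (auto simp: list_all2_Cons1)
    then show ?thesis using Cons.IH[OF ls(3)] ls Cons rel_comm[of u l "nst us"] by simp
  qed
qed (simp add: rel_zero)

lemma rel_dyn_word: "rel u l \<Longrightarrow> rel v m \<Longrightarrow> list_all2 rel (dyn_word u v rs) (dyn_word l m rs)"
proof (induction rs)
  case (Cons rs1 rs)
  have rep: "list_all2 rel (replicate n a) (replicate n b)" if "rel a b" for a b n
    using that by (simp add: list_all2_conv_all_nth)
  obtain r s where "rs1 = (r, s)" by (cases rs1)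
  then show ?case using Cons by (simp add: dyn_word_Cons list_all2_appendI rep)
qed simp

lemma rel_sum_list:
  "(\<And>i. i \<in> set is \<Longrightarrow> rel (F i) (K i)) \<Longrightarrow> rel (sum_list (map F is)) (lsum L (map K is))"
  by (induction "is") (simp_all add: lsum_def rel_zero rel_add)

lemma rel_bch:
  assumes "rel u l" "rel v m"
  shows "rel (bch p u v) (exp_mul L p l m)"
  unfolding bch_def exp_mul_def CH_def
proof (intro rel_sum_list rel_sc rel_nest rel_dyn_word assms)
  fix k rs assume "k \<in> set [1..<p]" "rs \<in> set (dyn_index k)"
  then show "pint p (dyn_coeff k rs)" by (intro pint_dyn_coeff prime_p) auto
qed

end

context p_lie_nilp
begin

theorem exp_mul_assoc:
  assumes "a \<in> carr" "b \<in> carr" "c \<in> carr"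
  shows "exp_mul L p (exp_mul L p a b) c = exp_mul L p a (exp_mul L p b c)"
proof -
  interpret p_lie_letters L p "\<lambda>t. case t of None \<Rightarrow> a | Some False \<Rightarrow> b | Some True \<Rightarrow> c"
    by standard (use assms in \<open>auto split: option.split bool.split\<close>)
  interpret truncated p
    by standard (rule prime_ge_2_nat[OF prime_p])
  have r: "rel (letter None) a" "rel (letter (Some False)) b" "rel (letter (Some True)) c"
    using rel_letter[of None] rel_letter[of "Some False"] rel_letter[of "Some True"] by simp_all
  show ?thesis
  proof (rule rel_unique)
    show "rel (bch p (bch p (letter None) (letter (Some False))) (letter (Some True)))
        (exp_mul L p (exp_mul L p a b) c)"
      by (intro rel_bch r)
    show "rel (bch p (letter None) (bch p (letter (Some False)) (letter (Some True))))
        (exp_mul L p a (exp_mul L p b c))"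
      by (intro rel_bch r)
    show "filt p (bch p (bch p (letter None) (letter (Some False))) (letter (Some True)) -
        bch p (letter None) (bch p (letter (Some False)) (letter (Some True))))"
      using bch_assoc[OF filt_letter const_letter filt_letter const_letter filt_letter const_letter]
      by (simp add: eqv_def)
  qed
qed

lemma lsum_Cons: "lsum L (y # ys) = y \<oplus> lsum L ys"
  and lsum_Nil [simp]: "lsum L [] = \<zero>"
  by (simp_all add: lsum_def)

lemma subgroup_lsum: "add_subgroup L S \<Longrightarrow> set ys \<subseteq> S \<Longrightarrow> lsum L ys \<in> S"
  by (induction ys) (auto simp: lsum_Cons add_subgroup_def)

end

section \<open>The product up to brackets of length three\<close>

lemma dyn_index_1: "dyn_index 1 = [[(0, 1)], [(1, 0)]]"
  by code_simp

lemma dyn_index_2: "dyn_index 2 = [[(0, 2)], [(1, 1)], [(2, 0)],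
    [(0, 1), (0, 1)], [(1, 0), (0, 1)], [(0, 1), (1, 0)], [(1, 0), (1, 0)]]"
  by code_simp

locale p_lie_odd = p_lie_nilp +
  assumes odd_p: "odd p"
begin

abbreviation mul (infixl \<open>\<star>\<close> 70) where "a \<star> b \<equiv> exp_mul L p a b"

lemma p_ge_3: "3 \<le> p"
  using prime_ge_2_nat[OF prime_p] odd_p by (cases "p = 2") auto

lemma pint_half: "pint p (1 / 2)" "pint p (1 / 4)"
proof -
  have "\<not> p dvd 2" using p_ge_3 by (auto dest!: dvd_imp_le)
  then have "\<not> p dvd 2 ^ 2" using prime_p prime_dvd_power by blast
  with \<open>\<not> p dvd 2\<close> show "pint p (1 / 2)" "pint p (1 / 4)"
    using pint_inverse_nat[OF prime_p, of 2] pint_inverse_nat[OF prime_p, of "2 ^ 2"] by simp_all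
qed

text \<open>Later arguments about the product use no terms beyond degree two. \<open>S\<close>
  collects the longer brackets, and choosing it as the zero group, a kernel or an ideal makes them
  harmless.\<close>

lemma mul_expand:
  assumes ab: "a \<in> carr" "b \<in> carr" and S: "add_subgroup L S"
    and nest: "\<And>w. set w \<subseteq> {a, b} \<Longrightarrow> 3 \<le> length w \<Longrightarrow> nest L w \<in> S"
  shows "\<exists>r\<in>S. a \<star> b = a \<oplus> b \<oplus> (1 / 2) \<bullet> \<lbrakk>a, b\<rbrakk> \<oplus> r"
proof -
  let ?r = "lsum L (map (\<lambda>m. CH L m a b) [3..<p])"
  have "CH L m a b \<in> S" if "3 \<le> m" for m
    unfolding CH_def
  proof (rule subgroup_lsum[OF S], clarsimp)
    fix rs assume "rs \<in> set (dyn_index m)"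
    then have "tot rs = m" by (auto simp: dyn_index_def tot_def)
    then have "nest L (dyn_word a b rs) \<in> S"
      using that set_dyn_word[of a b rs] by (intro nest) (auto simp: length_dyn_word)
    then show "dyn_coeff m rs \<bullet> nest L (dyn_word a b rs) \<in> S" by (rule subgroup_rsm[OF S])
  qed
  then have r: "?r \<in> S" by (intro subgroup_lsum[OF S]) auto
  then have rc: "?r \<in> carr" using S by (auto simp: add_subgroup_def)
  have "[1..<p] = 1 # 2 # [3..<p]"
    using p_ge_3 by (simp add: upt_conv_Cons numeral_2_eq_2 numeral_3_eq_3)
  then have "a \<star> b = CH L 1 a b \<oplus> (CH L 2 a b \<oplus> ?r)"
    by (simp add: exp_mul_def lsum_Cons)
  moreover have "CH L 1 a b = a \<oplus> b"
    unfolding CH_def dyn_index_1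
    using ab by (simp add: lsum_Cons dyn_coeff_def dyn_word_def add_comm)
  moreover have "CH L 2 a b = (1 / 2) \<bullet> \<lbrakk>a, b\<rbrakk>"
  proof -
    \<comment> \<open>The single pair \<open>(1, 1)\<close> gives \<open>1 / 2\<close>; the words
      made of two pairs give \<open>- 1 / 4\<close> for both orders of the letters, which cancel.
      Words in one letter vanish.\<close>
    have "CH L 2 a b = (1 / 2) \<bullet> \<lbrakk>a, b\<rbrakk> \<oplus> ((- (1 / 4)) \<bullet> \<lbrakk>a, b\<rbrakk> \<oplus> (- (1 / 4)) \<bullet> \<lbrakk>b, a\<rbrakk>)"
      unfolding CH_def dyn_index_2
      using ab by (simp add: lsum_Cons dyn_coeff_def dyn_word_def numeral_2_eq_2)
    also have "(- (1 / 4)) \<bullet> \<lbrakk>b, a\<rbrakk> = \<ominus> ((- (1 / 4)) \<bullet> \<lbrakk>a, b\<rbrakk>)"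
      using ab br_anti[of b a] by (simp add: rsm_neg_right)
    finally show ?thesis using ab by simp
  qed
  ultimately have "a \<star> b = a \<oplus> b \<oplus> (1 / 2) \<bullet> \<lbrakk>a, b\<rbrakk> \<oplus> ?r"
    using ab rc by (simp add: add_assoc)
  with r show ?thesis by blast
qed

lemma nest_Cons: "w \<noteq> [] \<Longrightarrow> nest L (a # w) = \<lbrakk>a, nest L w\<rbrakk>"
  by (cases w) auto

lemma nest_subset:
  assumes ab: "set w \<subseteq> {a, b}" "2 \<le> length w" and "a \<in> carr" "b \<in> carr"
    and S: "add_subgroup L S" "\<lbrakk>a, b\<rbrakk> \<in> S" "\<And>s. s \<in> S \<Longrightarrow> \<lbrakk>a, s\<rbrakk> \<in> S" "\<And>s. s \<in> S \<Longrightarrow> \<lbrakk>b, s\<rbrakk> \<in> S"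
  shows "nest L w \<in> S"
  using ab
proof (induction w rule: induct_list012)
  case (3 c d w)
  show ?case
  proof (cases w)
    case Nil
    have "\<lbrakk>b, a\<rbrakk> \<in> S" "\<zero> \<in> S"
      using S br_anti[of b a] assms by (auto simp: add_subgroup_def)
    then show ?thesis using 3 Nil S assms by auto
  next
    case (Cons e w')
    then have "nest L (d # w) \<in> S" using 3 by simp
    then show ?thesis using 3 S by auto
  qed
qed simp_all

lemma mul_expand2:
  assumes ab: "a \<in> carr" "b \<in> carr"
    and S: "add_subgroup L S" "\<lbrakk>a, b\<rbrakk> \<in> S" "\<And>s. s \<in> S \<Longrightarrow> \<lbrakk>a, s\<rbrakk> \<in> S" "\<And>s. s \<in> S \<Longrightarrow> \<lbrakk>b, s\<rbrakk> \<in> S"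
  shows "\<exists>r\<in>S. a \<star> b = a \<oplus> b \<oplus> r"
proof -
  have "\<exists>r\<in>S. a \<star> b = a \<oplus> b \<oplus> (1 / 2) \<bullet> \<lbrakk>a, b\<rbrakk> \<oplus> r"
    by (rule mul_expand[OF ab S(1)], rule nest_subset[of _ a b]) (use assms in auto)
  then obtain r where r: "r \<in> S" "a \<star> b = a \<oplus> b \<oplus> (1 / 2) \<bullet> \<lbrakk>a, b\<rbrakk> \<oplus> r" by blast
  have "(1 / 2) \<bullet> \<lbrakk>a, b\<rbrakk> \<oplus> r \<in> S" "r \<in> carr"
    using r S subgroup_rsm[OF S(1,2)] by (auto simp: add_subgroup_def)
  moreover have "a \<star> b = a \<oplus> b \<oplus> ((1 / 2) \<bullet> \<lbrakk>a, b\<rbrakk> \<oplus> r)"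
    using r ab \<open>r \<in> carr\<close> by (simp add: add_assoc)
  ultimately show ?thesis by blast
qed

lemma mul_commuting: "a \<in> carr \<Longrightarrow> b \<in> carr \<Longrightarrow> \<lbrakk>a, b\<rbrakk> = \<zero> \<Longrightarrow> a \<star> b = a \<oplus> b"
  using mul_expand2[of a b "{\<zero>}"] by (auto simp: add_subgroup_def)

lemma mul_closed [simp]: "a \<in> carr \<Longrightarrow> b \<in> carr \<Longrightarrow> a \<star> b \<in> carr"
  using mul_expand2[of a b carr] by (auto simp: add_subgroup_def)

lemma mul_zero [simp]: "a \<in> carr \<Longrightarrow> a \<star> \<zero> = a" "a \<in> carr \<Longrightarrow> \<zero> \<star> a = a"
  by (simp_all add: mul_commuting)

lemma mul_neg [simp]: "a \<in> carr \<Longrightarrow> a \<star> \<ominus> a = \<zero>" "a \<in> carr \<Longrightarrow> \<ominus> a \<star> a = \<zero>"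
  by (simp_all add: mul_commuting br_neg)

lemma mul_assoc: "a \<in> carr \<Longrightarrow> b \<in> carr \<Longrightarrow> c \<in> carr \<Longrightarrow> a \<star> b \<star> c = a \<star> (b \<star> c)"
  by (rule exp_mul_assoc)

lemma mul_cancel [simp]:
  "a \<in> carr \<Longrightarrow> b \<in> carr \<Longrightarrow> \<ominus> a \<star> (a \<star> b) = b"
  "a \<in> carr \<Longrightarrow> b \<in> carr \<Longrightarrow> a \<star> (\<ominus> a \<star> b) = b"
  by (simp_all flip: mul_assoc)

lemma mul_cancel_right [simp]:
  "a \<in> carr \<Longrightarrow> b \<in> carr \<Longrightarrow> a \<star> b \<star> \<ominus> b = a"
  "a \<in> carr \<Longrightarrow> b \<in> carr \<Longrightarrow> a \<star> \<ominus> b \<star> b = a"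
  by (simp_all add: mul_assoc)

lemma neg_mul: assumes "a \<in> carr" "b \<in> carr" shows "\<ominus> (a \<star> b) = \<ominus> b \<star> \<ominus> a"
proof -
  have "a \<star> b \<star> (\<ominus> b \<star> \<ominus> a) = \<zero>" using assms by (simp add: mul_assoc)
  then have "\<ominus> (a \<star> b) \<star> (a \<star> b \<star> (\<ominus> b \<star> \<ominus> a)) = \<ominus> (a \<star> b)" using assms by simp
  then show ?thesis using assms by simp
qed

end

section \<open>Polarizations\<close>

lemma power_gcd_eq_1:
  fixes z :: complex
  assumes "z ^ a = 1" "z ^ b = 1" shows "z ^ gcd a b = 1"
proof (cases "a = 0")
  case False
  then obtain x y where "a * x = b * y + gcd a b" using bezout_nat by blast
  then have "z ^ (a * x) = z ^ (b * y) * z ^ gcd a b" by (simp add: power_add)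
  then show ?thesis using assms by (simp add: power_mult)
qed (use assms in simp)

lemma root_of_unity_power:
  fixes z y :: complex
  assumes "prime p" "z ^ p ^ Suc j = 1" "z ^ p ^ j \<noteq> 1" "y ^ p ^ Suc j = 1"
  shows "\<exists>k. y = z ^ k"
proof -
  let ?n = "p ^ Suc j"
  have n: "?n > 0" using prime_gt_0_nat[OF assms(1)] by simp
  have nz: "z \<noteq> 0" using assms(2) n by (metis power_0_left zero_neq_one less_numeral_extra(3))
  have ord: "z ^ m \<noteq> 1" if "0 < m" "m < ?n" for m
  proof
    assume "z ^ m = 1"
    then have 1: "z ^ gcd m ?n = 1" using power_gcd_eq_1 assms(2) by blast
    obtain i where i: "i \<le> Suc j" "gcd m ?n = p ^ i"
      using divides_primepow_nat[OF assms(1), of "gcd m ?n" "Suc j"] by auto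
    have "gcd m ?n \<le> m" using that by (intro gcd_le1_nat) simp
    then have "i \<noteq> Suc j" using i(2) that(2) by (metis leD)
    then have "i \<le> j" using i by simp
    then have "z ^ p ^ j = (z ^ p ^ i) ^ p ^ (j - i)"
      by (simp add: power_mult[symmetric] power_add[symmetric])
    then show False using 1 i assms(3) by simp
  qed
  have inj: "inj_on (\<lambda>k. z ^ k) {..<?n}"
  proof (rule inj_onI)
    fix a b assume ab: "a \<in> {..<?n}" "b \<in> {..<?n}" "z ^ a = z ^ b"
    have le: "a = b" if "a \<le> b" "b < ?n" "z ^ a = z ^ b" for a b
    proof -
      have "z ^ b = z ^ a * z ^ (b - a)" by (metis le_add_diff_inverse power_add that(1))
      then have "z ^ (b - a) = 1" using that nz by simp
      then show ?thesis using ord[of "b - a"] that less_imp_diff_less[of b ?n a] by (cases "a = b") auto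
    qed
    show "a = b"
      using le[OF _ _ ab(3)] le[OF _ _ ab(3)[symmetric]] ab(1,2) nat_le_linear[of a b]
      unfolding lessThan_iff by blast
  qed
  have "(\<lambda>k. z ^ k) ` {..<?n} = {w. w ^ ?n = 1}"
  proof (rule card_subset_eq)
    show "finite {w::complex. w ^ ?n = 1}" by (rule finite_nth_roots[OF n])
    show "(\<lambda>k. z ^ k) ` {..<?n} \<subseteq> {w. w ^ ?n = 1}"
    proof clarify
      fix k
      have "(z ^ k) ^ ?n = (z ^ ?n) ^ k" by (metis mult.commute power_mult)
      then show "(z ^ k) ^ ?n = 1" using assms(2) by simp
    qed
    show "card ((\<lambda>k. z ^ k) ` {..<?n}) = card {w::complex. w ^ ?n = 1}"
      unfolding card_image[OF inj] using card_roots_unity_eq[OF n] by simp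
  qed
  then show ?thesis using assms(4) by blast
qed

locale char_lie = p_lie_odd +
  fixes f :: "'a \<Rightarrow> complex"
  assumes chr: "is_char L f"
begin

lemma f_nz [simp]: "x \<in> carr \<Longrightarrow> f x \<noteq> 0"
  and f_add: "x \<in> carr \<Longrightarrow> y \<in> carr \<Longrightarrow> f (x \<oplus> y) = f x * f y"
  using chr by (auto simp: is_char_def)

lemma f_zero [simp]: "f \<zero> = 1"
  using f_add[of \<zero> \<zero>] f_nz[of \<zero>] by simp

lemma f_neg: "x \<in> carr \<Longrightarrow> f (\<ominus> x) = inverse (f x)"
  using f_add[of x "\<ominus> x"] inverse_unique[of "f x" "f (\<ominus> x)"] by simp

lemma f_nsmul: "x \<in> carr \<Longrightarrow> f (nsmul L k x) = f x ^ k"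
  by (induction k) (simp_all add: nsmul_Suc f_add)

lemma f_half: "x \<in> carr \<Longrightarrow> f ((1 / 2) \<bullet> x) * f ((1 / 2) \<bullet> x) = f x"
  using rsm_add_left[OF pint_half(1) pint_half(1), of x] by (simp flip: f_add)

lemma half_double: "x \<in> carr \<Longrightarrow> (1 / 2) \<bullet> x \<oplus> (1 / 2) \<bullet> x = x"
  using rsm_add_left[OF pint_half(1) pint_half(1), of x] by simp

lemma f_br_swap: "x \<in> carr \<Longrightarrow> y \<in> carr \<Longrightarrow> f \<lbrakk>x, y\<rbrakk> = inverse (f \<lbrakk>y, x\<rbrakk>)"
  using br_anti[of x y] by (simp add: f_neg)

text \<open>Lets normal forms such as \<open>y0 \<oplus> nsmul L k u\<close> be closed under
  negation with natural \<open>k\<close> only.\<close>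

lemma neg_nsmul: "x \<in> carr \<Longrightarrow> \<ominus> nsmul L k x = nsmul L (k * (card carr - 1)) x"
proof (rule neg_unique[symmetric])
  assume x: "x \<in> carr"
  have "k + k * (card carr - 1) = k * card carr"
    using card_pos by (metis Suc_diff_1 mult_Suc_right)
  then show "nsmul L k x \<oplus> nsmul L (k * (card carr - 1)) x = \<zero>"
    using nsmul_add[OF x, of k "k * (card carr - 1)"] nsmul_mult[OF x, of k "card carr"] nsmul_card[OF fin x]
    by (simp only: nsmul_zero)
qed simp_all

definition isotropic :: "'a set \<Rightarrow> bool" where
  "isotropic Q \<longleftrightarrow> (\<forall>x\<in>Q. \<forall>y\<in>Q. f \<lbrakk>x, y\<rbrakk> = 1)"

text \<open>A polarization of the restriction of \<open>f\<close> to \<open>S\<close>; brackets,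
  product and scalars remain those of \<open>L\<close>.\<close>

definition pol :: "'a set \<Rightarrow> 'a set \<Rightarrow> bool" where
  "pol S P \<longleftrightarrow> lie_subring L P \<and> P \<subseteq> S \<and> isotropic P \<and>
     (\<forall>Q. add_subgroup L Q \<and> Q \<subseteq> S \<and> P \<subseteq> Q \<and> isotropic Q \<longrightarrow> Q = P)"

lemma polarization_pol: "polarization L f P \<longleftrightarrow> pol carr P"
proof -
  have "lie_subring L P \<Longrightarrow> P \<subseteq> carr" "\<And>Q. add_subgroup L Q \<Longrightarrow> Q \<subseteq> carr"
    by (simp_all add: lie_subring_def add_subgroup_def)
  then show ?thesis
    unfolding polarization_def pol_def isotropic_def[symmetric] by metis
qed

lemma subringD:
  assumes "lie_subring L S"
  shows "add_subgroup L S" "S \<subseteq> carr" "\<zero> \<in> S" "x \<in> S \<Longrightarrow> x \<in> carr"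
    "x \<in> S \<Longrightarrow> y \<in> S \<Longrightarrow> x \<oplus> y \<in> S" "x \<in> S \<Longrightarrow> \<ominus> x \<in> S" "x \<in> S \<Longrightarrow> y \<in> S \<Longrightarrow> \<lbrakk>x, y\<rbrakk> \<in> S"
  using assms by (auto simp: lie_subring_def add_subgroup_def)

lemma subgroupD:
  assumes "add_subgroup L S"
  shows "S \<subseteq> carr" "\<zero> \<in> S" "x \<in> S \<Longrightarrow> x \<in> carr"
    "x \<in> S \<Longrightarrow> y \<in> S \<Longrightarrow> x \<oplus> y \<in> S" "x \<in> S \<Longrightarrow> \<ominus> x \<in> S"
  using assms by (auto simp: add_subgroup_def)

lemma subring_mul: "lie_subring L S \<Longrightarrow> a \<in> S \<Longrightarrow> b \<in> S \<Longrightarrow> a \<star> b \<in> S"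
proof -
  assume S: "lie_subring L S" and ab: "a \<in> S" "b \<in> S"
  note S' = subringD[OF S]
  have "\<exists>r\<in>S. a \<star> b = a \<oplus> b \<oplus> r"
    by (rule mul_expand2) (simp_all add: S' ab)
  then show "a \<star> b \<in> S" using S'(5) ab by metis
qed

lemma polD:
  assumes "pol S P"
  shows "lie_subring L P" "P \<subseteq> S" "x \<in> P \<Longrightarrow> y \<in> P \<Longrightarrow> f \<lbrakk>x, y\<rbrakk> = 1"
    "add_subgroup L P" "P \<subseteq> carr"
proof -
  show 1: "lie_subring L P" and "P \<subseteq> S" and "x \<in> P \<Longrightarrow> y \<in> P \<Longrightarrow> f \<lbrakk>x, y\<rbrakk> = 1"
    using assms unfolding pol_def isotropic_def by blast+
  show "add_subgroup L P" "P \<subseteq> carr" using subringD[OF 1] by blast+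
qed

lemma pol_mul: "pol S P \<Longrightarrow> a \<in> P \<Longrightarrow> b \<in> P \<Longrightarrow> a \<star> b \<in> P"
  using subring_mul polD by blast

text \<open>The kernel of \<open>f\<close> on \<open>P\<close> contains all brackets of
  \<open>P\<close>, so modulo this kernel the product of \<open>P\<close> is addition.\<close>

lemma f_mul:
  assumes P: "pol S P" and ab: "a \<in> P" "b \<in> P"
  shows "f (a \<star> b) = f a * f b"
proof -
  let ?K = "{x\<in>P. f x = 1}"
  note P' = subringD[OF polD(1)[OF P]]
  have "\<exists>r\<in>?K. a \<star> b = a \<oplus> b \<oplus> r"
  proof (rule mul_expand2)
    show "add_subgroup L ?K"
      unfolding add_subgroup_def using P'(2) by (auto simp: P' f_add f_neg)
  qed (simp_all add: P' ab polD(3)[OF P])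
  then show ?thesis using ab by (auto simp: f_add P')
qed

lemma lspan_mono: "X \<subseteq> S \<Longrightarrow> add_subgroup L S \<Longrightarrow> lspan L X \<subseteq> S"
proof
  fix x assume *: "X \<subseteq> S" "add_subgroup L S" and "x \<in> lspan L X"
  from this(3) show "x \<in> S" by induction (use * in \<open>auto simp: add_subgroup_def\<close>)
qed

lemma isotropic_lspan:
  assumes X: "X \<subseteq> carr" and iso: "isotropic X"
  shows "isotropic (lspan L X)"
proof -
  have c: "x \<in> carr" if "x \<in> lspan L X" for x
    using that add_subgroup_lspan[OF X] by (auto simp: add_subgroup_def)
  have 1: "f \<lbrakk>x, y\<rbrakk> = 1" if "x \<in> X" "y \<in> lspan L X" for x y
    using that(2)
  proof induction
    case (gen y)
    then show ?case using iso that by (auto simp: isotropic_def)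
  qed (use that X c in \<open>auto simp: br_add_right br_neg f_add f_neg subset_iff\<close>)
  have "f \<lbrakk>x, y\<rbrakk> = 1" if "x \<in> lspan L X" "y \<in> lspan L X" for x y
    using that(1)
  proof induction
    case (gen x)
    then show ?case using 1 that by auto
  qed (use that X c in \<open>auto simp: br_add_left br_neg f_add f_neg\<close>)
  then show ?thesis by (simp add: isotropic_def)
qed

text \<open>Adjoining \<open>a\<close> to \<open>P\<close> generates an isotropic group, so
  maximality applies: \<open>P\<close> is its own orthogonal complement in \<open>S\<close>.\<close>

lemma pol_perp:
  assumes S: "add_subgroup L S" and P: "pol S P" and a: "a \<in> S" "\<And>x. x \<in> P \<Longrightarrow> f \<lbrakk>x, a\<rbrakk> = 1"
  shows "a \<in> P"
proof -
  note P' = polD[OF P] and S' = subgroupD[OF S]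
  have X: "insert a P \<subseteq> S" using a P' by auto
  then have Xc: "insert a P \<subseteq> carr" using S' by auto
  have "isotropic (insert a P)"
    unfolding isotropic_def using a P' Xc f_br_swap[of a] by auto
  then have "lspan L (insert a P) = P"
    using P add_subgroup_lspan[OF Xc] isotropic_lspan[OF Xc] lspan_mono[OF X S]
    unfolding pol_def by (auto intro!: lspan.gen)
  then show ?thesis by (metis insertI1 lspan.gen)
qed

lemma sum_char_zero:
  assumes P: "add_subgroup L P" and c: "\<And>x y. x \<in> P \<Longrightarrow> y \<in> P \<Longrightarrow> c (x \<oplus> y) = c x * (c y :: complex)"
    and x0: "x0 \<in> P" "c x0 \<noteq> 1"
  shows "(\<Sum>x\<in>P. c x) = 0"
proof -
  note P' = subgroupD[OF P]
  have "(\<Sum>x\<in>P. c x) = (\<Sum>x\<in>P. c (x0 \<oplus> x))"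
    by (rule sum.reindex_bij_witness[of _ "\<lambda>x. x0 \<oplus> x" "\<lambda>x. \<ominus> x0 \<oplus> x"])
      (use P' x0 in \<open>auto\<close>)
  also have "\<dots> = c x0 * (\<Sum>x\<in>P. c x)"
    using c x0 by (simp add: sum_distrib_left)
  finally show ?thesis using x0 by simp
qed

lemma finite_sub: "P \<subseteq> carr \<Longrightarrow> finite P"
  using fin by (rule rev_finite_subset)

lemma sum_mul_left:
  assumes "pol S P" "y \<in> P" shows "(\<Sum>x\<in>P. F (y \<star> x)) = (\<Sum>x\<in>P. F x)"
  by (rule sum.reindex_bij_witness[of _ "\<lambda>x. \<ominus> y \<star> x" "\<lambda>x. y \<star> x"])
    (use pol_mul[OF assms(1)] assms subringD[OF polD(1)[OF assms(1)]] in auto)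

lemma sum_mul_right:
  assumes "pol S P" "y \<in> P" shows "(\<Sum>x\<in>P. F (x \<star> y)) = (\<Sum>x\<in>P. F x)"
  by (rule sum.reindex_bij_witness[of _ "\<lambda>x. x \<star> \<ominus> y" "\<lambda>x. x \<star> y"])
    (use pol_mul[OF assms(1)] assms subringD[OF polD(1)[OF assms(1)]] in auto)

subsection \<open>A central-by-central direction\<close>

text \<open>The largest ideal of \<open>S\<close> on which \<open>f\<close> is trivial, described
  elementwise through iterated brackets; the empty list of brackets gives
  \<open>f a = 1\<close>.\<close>

definition ideal_in_ker :: "'a set \<Rightarrow> 'a set" where
  "ideal_in_ker S = {a\<in>S. \<forall>ws. set ws \<subseteq> S \<longrightarrow> f (foldr (lbr L) ws a) = 1}"

lemma foldr_br_closed: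
  "lie_subring L S \<Longrightarrow> set ws \<subseteq> S \<Longrightarrow> a \<in> S \<Longrightarrow> foldr (lbr L) ws a \<in> S"
  by (induction ws) (auto dest: subringD)

lemma foldr_br_carr: "set ws \<subseteq> carr \<Longrightarrow> a \<in> carr \<Longrightarrow> foldr (lbr L) ws a \<in> carr"
  by (induction ws) auto

lemma foldr_br_add: "set ws \<subseteq> carr \<Longrightarrow> a \<in> carr \<Longrightarrow> b \<in> carr \<Longrightarrow>
    foldr (lbr L) ws (a \<oplus> b) = foldr (lbr L) ws a \<oplus> foldr (lbr L) ws b"
  by (induction ws) (auto simp: br_add_right foldr_br_carr)

lemma foldr_br_zero: "set ws \<subseteq> carr \<Longrightarrow> foldr (lbr L) ws \<zero> = \<zero>"
  by (induction ws) auto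

lemma foldr_br_neg: "set ws \<subseteq> carr \<Longrightarrow> a \<in> carr \<Longrightarrow>
    foldr (lbr L) ws (\<ominus> a) = \<ominus> foldr (lbr L) ws a"
  by (induction ws) (auto simp: br_neg foldr_br_carr)

lemma foldr_br_lcs: "set ws \<subseteq> carr \<Longrightarrow> a \<in> carr \<Longrightarrow> foldr (lbr L) ws a \<in> lcs L (length ws)"
proof (induction ws)
  case (Cons w ws)
  then show ?case using br_lcs[of w 0 "foldr (lbr L) ws a" "length ws"] by simp
qed simp

text \<open>Modulo the ideal \<open>n\<close> the element \<open>u\<close> belongs to the second
  center but not to the center.\<close>

definition good :: "'a set \<Rightarrow> 'a set \<Rightarrow> 'a \<Rightarrow> bool" where
  "good S n u \<longleftrightarrow> add_subgroup L n \<and> n \<subseteq> S \<and> (\<forall>a\<in>n. f a = 1) \<and> (\<forall>s\<in>S. \<forall>a\<in>n. \<lbrakk>s, a\<rbrakk> \<in> n) \<and> u \<in> S \<and>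
     (\<forall>x\<in>S. \<forall>y\<in>S. \<lbrakk>x, \<lbrakk>y, u\<rbrakk>\<rbrakk> \<in> n) \<and> (\<forall>x\<in>S. f \<lbrakk>x, u\<rbrakk> ^ p = 1) \<and> (\<exists>x\<in>S. f \<lbrakk>x, u\<rbrakk> \<noteq> 1)"

text \<open>With \<open>n\<close> the largest ideal in the kernel and \<open>Z\<close> the center
  modulo \<open>n\<close>, nilpotence supplies an element of the second center outside
  \<open>Z\<close>, and a suitable \<open>p\<close>-power multiple of it is the last one outside
  \<open>Z\<close>. If \<open>f \<lbrakk>x, u\<rbrakk>\<close> were always \<open>1\<close>, all
  \<open>\<lbrakk>s, u\<rbrakk>\<close> would lie in \<open>n\<close>, since their further brackets
  do so anyway.\<close>

lemma exists_good:
  assumes S: "lie_subring L S" and ne: "\<not> isotropic S"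
  shows "\<exists>n u. good S n u"
proof -
  note S' = subringD[OF S]
  define n where "n = ideal_in_ker S"
  have nS: "n \<subseteq> S" by (auto simp: n_def ideal_in_ker_def)
  have n_all: "f (foldr (lbr L) ws a) = 1" if "a \<in> n" "set ws \<subseteq> S" for a ws
    using that unfolding n_def ideal_in_ker_def by blast
  have n_I: "a \<in> n" if "a \<in> S" "\<And>ws. set ws \<subseteq> S \<Longrightarrow> f (foldr (lbr L) ws a) = 1" for a
    using that unfolding n_def ideal_in_ker_def by blast
  have n_sub: "add_subgroup L n"
  proof -
    have ws: "set ws \<subseteq> carr" if "set ws \<subseteq> S" for ws using that S'(2) by blast
    have c: "a \<in> carr" "a \<in> S" if "a \<in> n" for a using that nS S'(2) by auto
    show ?thesis
      unfolding add_subgroup_def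
    proof (intro conjI ballI)
      show "n \<subseteq> carr" using c by blast
      show "\<zero> \<in> n" by (rule n_I) (simp_all add: S'(3) foldr_br_zero ws)
      fix a assume a: "a \<in> n"
      show "\<ominus> a \<in> n"
        by (rule n_I) (simp_all add: S'(6) c[OF a] foldr_br_neg foldr_br_carr ws f_neg n_all[OF a])
      fix b assume b: "b \<in> n"
      show "a \<oplus> b \<in> n"
        by (rule n_I) (simp_all add: S'(5) c[OF a] c[OF b] foldr_br_add foldr_br_carr ws f_add n_all[OF a] n_all[OF b])
    qed
  qed
  have n_f: "f a = 1" if "a \<in> n" for a
    using n_all[OF that, of "[]"] by simp
  have n_br: "\<lbrakk>s, a\<rbrakk> \<in> n" if "s \<in> S" "a \<in> n" for s a
  proof (rule n_I)
    show "\<lbrakk>s, a\<rbrakk> \<in> S" using that nS S'(7) by (simp add: subset_iff)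
    fix ws assume "set ws \<subseteq> S"
    then show "f (foldr (lbr L) ws \<lbrakk>s, a\<rbrakk>) = 1"
      using n_all[OF that(2), of "ws @ [s]"] that(1) by simp
  qed
  note n' = subgroupD[OF n_sub]
  define Z where "Z = {a\<in>S. \<forall>s\<in>S. \<lbrakk>s, a\<rbrakk> \<in> n}"
  have Z_sub: "add_subgroup L Z"
    unfolding add_subgroup_def Z_def using S'(2) by (auto simp: br_add_right br_neg S' n')
  note Z' = subgroupD[OF Z_sub]
  obtain a where a: "a \<in> S" "a \<notin> Z"
  proof -
    obtain x y where xy: "x \<in> S" "y \<in> S" "f \<lbrakk>x, y\<rbrakk> \<noteq> 1" using ne by (auto simp: isotropic_def)
    then have "y \<notin> Z" using n_f by (auto simp: Z_def)
    with xy that show thesis by blast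
  qed
  have "\<exists>b\<in>S. b \<notin> Z \<and> (\<forall>s\<in>S. \<lbrakk>s, b\<rbrakk> \<in> Z)"
  proof (rule ccontr)
    assume "\<not> ?thesis"
    \<comment> \<open>Otherwise one could keep bracketing \<open>a\<close> without entering
      \<open>Z\<close>; after \<open>p - 1\<close> brackets the result is zero, which lies in
      \<open>Z\<close>.\<close>
    then have ex: "\<forall>b\<in>S - Z. \<exists>s\<in>S. \<lbrakk>s, b\<rbrakk> \<notin> Z" by blast
    have "\<exists>ws. length ws = k \<and> set ws \<subseteq> S \<and> foldr (lbr L) ws a \<notin> Z" for k
    proof (induction k)
      case 0
      then show ?case using a by auto
    next
      case (Suc k)
      then obtain ws where ws: "length ws = k" "set ws \<subseteq> S" "foldr (lbr L) ws a \<notin> Z" by blast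
      then obtain s where "s \<in> S" "\<lbrakk>s, foldr (lbr L) ws a\<rbrakk> \<notin> Z"
        using ex foldr_br_closed[OF S ws(2) a(1)] by blast
      then show ?case using ws by (intro exI[of _ "s # ws"]) auto
    qed
    then obtain ws where ws: "length ws = p - 1" "set ws \<subseteq> S" "foldr (lbr L) ws a \<notin> Z" by blast
    then have "foldr (lbr L) ws a \<in> lcs L (p - 1)"
      using foldr_br_lcs[of ws a] S' a by auto
    then show False using nilp ws Z' by (simp add: nilpotent_class_less_def)
  qed
  then obtain b where b: "b \<in> S" "b \<notin> Z" "\<And>s. s \<in> S \<Longrightarrow> \<lbrakk>s, b\<rbrakk> \<in> Z" by blast
  have bc: "b \<in> carr" using b S' by blast
  \<comment> \<open>With \<open>j\<close> least, \<open>u\<close> is \<open>p ^ (j - 1)\<close>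
    times \<open>b\<close>: it is still outside \<open>Z\<close> while \<open>p\<close> times
    \<open>u\<close> is inside, which forces the values \<open>f \<lbrakk>x, u\<rbrakk>\<close> to
    be \<open>p\<close>-th roots of unity.\<close>
  define j where "j = (LEAST i. nsmul L (p ^ i) b \<in> Z)"
  obtain k where k: "card carr = p ^ k" using card_carr by blast
  have "nsmul L (p ^ k) b \<in> Z" using nsmul_card[OF fin bc] Z' by (simp add: k)
  then have j: "nsmul L (p ^ j) b \<in> Z" unfolding j_def by (rule LeastI)
  have "j \<noteq> 0" using j b bc by (cases j) auto
  then obtain i where i: "j = Suc i" by (cases j) auto
  define u where "u = nsmul L (p ^ i) b"
  have uZ: "u \<notin> Z" using not_less_Least[of i "\<lambda>i. nsmul L (p ^ i) b \<in> Z"] i by (auto simp: u_def j_def)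
  have pu: "nsmul L p u \<in> Z" using j bc by (simp add: u_def i flip: nsmul_mult)
  have u: "u \<in> S" using b subgroup_nsmul[OF S'(1)] by (simp add: u_def)
  have uc: "u \<in> carr" using u S' by blast
  have bu: "\<lbrakk>s, u\<rbrakk> \<in> Z" if "s \<in> S" for s
    using b(3)[OF that] that S' bc subgroup_nsmul[OF Z_sub] by (auto simp: u_def nsmul_br)
  have "f \<lbrakk>x, u\<rbrakk> ^ p = 1" if "x \<in> S" for x
  proof -
    have "\<lbrakk>x, nsmul L p u\<rbrakk> \<in> n" using pu that by (auto simp: Z_def)
    from n_f[OF this] show ?thesis
      using S'(4)[OF that] uc by (simp add: nsmul_br f_nsmul)
  qed
  moreover have "\<exists>x\<in>S. f \<lbrakk>x, u\<rbrakk> \<noteq> 1"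
  proof (rule ccontr)
    assume "\<not> ?thesis"
    then have 1: "f \<lbrakk>x, u\<rbrakk> = 1" if "x \<in> S" for x using that by blast
    have "\<lbrakk>s, u\<rbrakk> \<in> n" if s: "s \<in> S" for s
    proof -
      have "f (foldr (lbr L) ws \<lbrakk>s, u\<rbrakk>) = 1" if "set ws \<subseteq> S" for ws
      proof (cases ws rule: rev_cases)
        case Nil
        then show ?thesis using 1 s by simp
      next
        case (snoc ws' w)
        then have "\<lbrakk>w, \<lbrakk>s, u\<rbrakk>\<rbrakk> \<in> n" using bu[OF s] that by (auto simp: Z_def)
        then have "f (foldr (lbr L) ws' \<lbrakk>w, \<lbrakk>s, u\<rbrakk>\<rbrakk>) = 1"
          using that snoc by (intro n_all) auto
        then show ?thesis using snoc by simp
      qed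
      then show ?thesis using s u S'(7) by (intro n_I) auto
    qed
    then show False using uZ u by (auto simp: Z_def)
  qed
  ultimately have "good S n u"
    using n_sub nS n_f n_br u bu by (auto simp: good_def Z_def)
  then show ?thesis by blast
qed

end

section \<open>Bi-equivariant functions and irreducibility\<close>

context char_lie
begin

text \<open>Such functions are the convolution kernels of endomorphisms of the representation of
  \<open>S\<close> induced from the character of \<open>P\<close>.\<close>

definition bieq :: "'a set \<Rightarrow> 'a set \<Rightarrow> ('a \<Rightarrow> complex) \<Rightarrow> bool" where
  "bieq S P K \<longleftrightarrow> (\<forall>x\<in>P. \<forall>y\<in>P. \<forall>g\<in>S. K (x \<star> g \<star> y) = f x * K g * f y)"

text \<open>By Mackey's criterion, \<open>clean S P\<close> means that inducing the character of \<open>P\<close> to \<open>S\<close> gives an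
  irreducible representation.\<close>

definition clean :: "'a set \<Rightarrow> 'a set \<Rightarrow> bool" where
  "clean S P \<longleftrightarrow> (\<forall>K. bieq S P K \<longrightarrow> (\<forall>g\<in>S - P. K g = 0))"

lemma add_conj: "w \<in> carr \<Longrightarrow> c \<in> carr \<Longrightarrow> w \<oplus> c \<oplus> \<ominus> w = c"
  by (simp add: add_comm[of w c] add_assoc)

end

section \<open>Center and second center modulo n, and the subring h\<close>

locale step = char_lie +
  fixes S n u
  assumes S: "lie_subring L S" and gd: "good S n u"
begin

lemmas S' = subringD[OF S]

lemma n_sub: "add_subgroup L n" and nS: "n \<subseteq> S" and n_f: "a \<in> n \<Longrightarrow> f a = 1"
  and n_br: "s \<in> S \<Longrightarrow> a \<in> n \<Longrightarrow> \<lbrakk>s, a\<rbrakk> \<in> n" and u_S: "u \<in> S"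
  and br_u: "x \<in> S \<Longrightarrow> y \<in> S \<Longrightarrow> \<lbrakk>x, \<lbrakk>y, u\<rbrakk>\<rbrakk> \<in> n"
  and f_u_pow: "x \<in> S \<Longrightarrow> f \<lbrakk>x, u\<rbrakk> ^ p = 1" and f_u_ne: "\<exists>x\<in>S. f \<lbrakk>x, u\<rbrakk> \<noteq> 1"
  using gd unfolding good_def by blast+

lemmas n' = subgroupD[OF n_sub]

lemma u_c [simp]: "u \<in> carr"
  using u_S S'(4) by simp

lemma n_S: "a \<in> n \<Longrightarrow> a \<in> S"
  using nS by blast

text \<open>The center of \<open>S\<close> modulo \<open>n\<close>. It pairs trivially with
  \<open>S\<close> under \<open>f\<close>, hence lies in every polarization.\<close>

definition Z where "Z = {t\<in>S. \<forall>s\<in>S. \<lbrakk>s, t\<rbrakk> \<in> n}"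

lemma Z_S: "t \<in> Z \<Longrightarrow> t \<in> S" and Z_br: "s \<in> S \<Longrightarrow> t \<in> Z \<Longrightarrow> \<lbrakk>s, t\<rbrakk> \<in> n"
  by (simp_all add: Z_def)

lemma Z_sub: "add_subgroup L Z"
  unfolding add_subgroup_def Z_def using S'(2) by (auto simp: br_add_right br_neg S' n')

lemmas Z' = subgroupD[OF Z_sub]

lemma n_Z: "a \<in> n \<Longrightarrow> a \<in> Z"
  by (simp add: Z_def n_S n_br)

lemma Z_br': "s \<in> S \<Longrightarrow> t \<in> Z \<Longrightarrow> \<lbrakk>t, s\<rbrakk> \<in> n"
  using br_anti[of t s] Z_br[of s t] by (simp add: S' Z_S n')

text \<open>The second center modulo \<open>n\<close>, containing all multiples of \<open>u\<close>.
  Membership of brackets in \<open>Z\<close> is what makes the product computable.\<close>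

definition W where "W = {w\<in>S. \<forall>s\<in>S. \<lbrakk>s, w\<rbrakk> \<in> Z}"

lemma W_S: "w \<in> W \<Longrightarrow> w \<in> S" and W_br: "s \<in> S \<Longrightarrow> w \<in> W \<Longrightarrow> \<lbrakk>s, w\<rbrakk> \<in> Z"
  by (simp_all add: W_def)

lemma W_sub: "add_subgroup L W"
  unfolding add_subgroup_def W_def using S'(2) by (auto simp: br_add_right br_neg S' Z')

lemmas W' = subgroupD[OF W_sub]

lemma W_br': "s \<in> S \<Longrightarrow> w \<in> W \<Longrightarrow> \<lbrakk>w, s\<rbrakk> \<in> Z"
  using br_anti[of w s] W_br[of s w] by (simp add: S' W_S Z')

lemma u_W: "u \<in> W"
  by (simp add: W_def Z_def u_S S' br_u)

lemma nsmul_u_W: "nsmul L k u \<in> W"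
  by (rule subgroup_nsmul[OF W_sub u_W])

text \<open>Nested words of length two or more lie in \<open>Z\<close>, so one more bracket puts
  them into \<open>n\<close>.\<close>

lemma mul_W:
  assumes ab: "a \<in> S" "b \<in> S" "\<lbrakk>a, b\<rbrakk> \<in> Z"
  shows "\<exists>r\<in>n. a \<star> b = a \<oplus> b \<oplus> (1 / 2) \<bullet> \<lbrakk>a, b\<rbrakk> \<oplus> r"
proof (rule mul_expand)
  fix w assume w: "set w \<subseteq> {a, b}" "3 \<le> length w"
  then obtain c w' where w': "w = c # w'" by (cases w) auto
  have 1: "nest L w' \<in> Z"
    by (rule nest_subset[of _ a b]) (use w w' in \<open>simp_all add: ab S' Z_sub n_Z Z_br\<close>)
  have 2: "c \<in> S" using w w' ab by auto
  have "w' \<noteq> []" using w w' by auto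
  then show "nest L w \<in> n" unfolding w' by (subst nest_Cons) (auto intro: Z_br[OF 2 1])
qed (rule S'(4)[OF ab(1)] S'(4)[OF ab(2)] n_sub)+

text \<open>Each of the two multiplications contributes half of
  \<open>\<lbrakk>w, x\<rbrakk>\<close>; every other correction is a bracket with an element of
  \<open>Z\<close> and falls into \<open>n\<close>.\<close>

lemma conj_W:
  assumes w: "w \<in> W" and x: "x \<in> S"
  shows "\<exists>r\<in>n. w \<star> x \<star> \<ominus> w = x \<oplus> \<lbrakk>w, x\<rbrakk> \<oplus> r"
proof -
  note wS = W_S[OF w]
  have mw: "\<ominus> w \<in> W" "\<ominus> w \<in> S" by (rule W'(5)[OF w], rule W_S[OF W'(5)[OF w]])
  have wx: "\<lbrakk>w, x\<rbrakk> \<in> Z" by (rule W_br'[OF x w])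
  define t where "t = (1 / 2) \<bullet> \<lbrakk>w, x\<rbrakk>"
  have t: "t \<in> Z" unfolding t_def by (rule subgroup_rsm[OF Z_sub wx])
  obtain r1 where r1: "r1 \<in> n" "w \<star> x = w \<oplus> x \<oplus> t \<oplus> r1"
    using mul_W[OF wS x wx] t_def by blast
  note c = S'(4)[OF wS] S'(4)[OF x] Z'(3)[OF t] n'(3)[OF r1(1)]
  define g where "g = w \<oplus> x \<oplus> t \<oplus> r1"
  have gS: "g \<in> S" unfolding g_def by (intro S' wS x Z_S[OF t] n_S[OF r1(1)])
  define m where "m = \<lbrakk>t, w\<rbrakk> \<oplus> \<lbrakk>r1, w\<rbrakk>"
  have m: "m \<in> n" unfolding m_def by (intro n' Z_br' wS t n_Z[OF r1(1)])
  note mc = n'(3)[OF m]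
  have "\<lbrakk>g, w\<rbrakk> = \<ominus> \<lbrakk>w, x\<rbrakk> \<oplus> m"
    using c br_anti[of x w] by (simp add: g_def m_def br_add_left add_assoc)
  then have "\<lbrakk>g, \<ominus> w\<rbrakk> = \<lbrakk>w, x\<rbrakk> \<oplus> \<ominus> m"
    using c S'(4)[OF gS] mc by (simp add: br_neg neg_add)
  then have half: "(1 / 2) \<bullet> \<lbrakk>g, \<ominus> w\<rbrakk> = t \<oplus> (1 / 2) \<bullet> (\<ominus> m)"
    using c mc by (simp add: rsm_add_right t_def)
  define m' where "m' = (1 / 2) \<bullet> (\<ominus> m)"
  have m': "m' \<in> n" unfolding m'_def by (intro subgroup_rsm n_sub n' m)
  note mc' = n'(3)[OF m']
  obtain r2 where r2: "r2 \<in> n" "g \<star> \<ominus> w = g \<oplus> \<ominus> w \<oplus> (t \<oplus> m') \<oplus> r2"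
    using mul_W[OF gS mw(2) W_br[OF gS mw(1)]] half m'_def by auto
  note rc2 = n'(3)[OF r2(1)]
  have "g = w \<oplus> (x \<oplus> t \<oplus> r1)" using c by (simp add: g_def add_assoc)
  then have "g \<oplus> \<ominus> w = x \<oplus> t \<oplus> r1" using c by (simp add: add_conj)
  then have "g \<star> \<ominus> w = x \<oplus> (t \<oplus> t) \<oplus> (r1 \<oplus> m' \<oplus> r2)"
    using c mc' rc2 r2(2) by (simp add: add_ac)
  also have "t \<oplus> t = \<lbrakk>w, x\<rbrakk>" using c by (simp add: t_def half_double)
  finally have "w \<star> x \<star> \<ominus> w = x \<oplus> \<lbrakk>w, x\<rbrakk> \<oplus> (r1 \<oplus> m' \<oplus> r2)"
    using r1(2) g_def by simp
  moreover have "r1 \<oplus> m' \<oplus> r2 \<in> n" by (intro n' r1 m' r2)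
  ultimately show ?thesis by blast
qed

lemma Z_P: "pol S P \<Longrightarrow> t \<in> Z \<Longrightarrow> t \<in> P"
proof (rule pol_perp[OF S'(1)])
  fix x assume "pol S P" "t \<in> Z" "x \<in> P"
  then show "f \<lbrakk>x, t\<rbrakk> = 1" using n_f[OF Z_br] polD(2) by blast
qed (simp_all add: Z_S)

text \<open>Conjugation by the second center preserves every polarization, because
  \<open>\<lbrakk>w, x\<rbrakk>\<close> lies in \<open>Z\<close>, and twists its character by
  \<open>f \<lbrakk>w, x\<rbrakk>\<close>.\<close>

lemma conj_P:
  assumes P: "pol S P" and w: "w \<in> W" and x: "x \<in> P"
  shows "w \<star> x \<star> \<ominus> w \<in> P" "f (w \<star> x \<star> \<ominus> w) = f x * f \<lbrakk>w, x\<rbrakk>"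
proof -
  note P' = subringD[OF polD(1)[OF P]]
  have xS: "x \<in> S" using x polD(2)[OF P] by blast
  obtain r where r: "r \<in> n" "w \<star> x \<star> \<ominus> w = x \<oplus> \<lbrakk>w, x\<rbrakk> \<oplus> r" using conj_W[OF w xS] by blast
  have wx: "\<lbrakk>w, x\<rbrakk> \<in> P" by (rule Z_P[OF P W_br'[OF xS w]])
  show "w \<star> x \<star> \<ominus> w \<in> P"
    unfolding r(2) by (intro P' x wx Z_P[OF P] n_Z r)
  show "f (w \<star> x \<star> \<ominus> w) = f x * f \<lbrakk>w, x\<rbrakk>"
    unfolding r(2) using P'(4)[OF x] P'(4)[OF wx] n'(3)[OF r(1)] n_f[OF r(1)] by (simp add: f_add)
qed

definition h where "h = {x\<in>S. f \<lbrakk>x, u\<rbrakk> = 1}"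

lemma h_S: "x \<in> h \<Longrightarrow> x \<in> S" and h_f: "x \<in> h \<Longrightarrow> f \<lbrakk>x, u\<rbrakk> = 1"
  and hI: "x \<in> S \<Longrightarrow> f \<lbrakk>x, u\<rbrakk> = 1 \<Longrightarrow> x \<in> h"
  by (simp_all add: h_def)

lemma Z_h: "t \<in> Z \<Longrightarrow> t \<in> h"
  by (intro hI Z_S n_f Z_br' u_S)

text \<open>By Jacobi the bracket of \<open>\<lbrakk>x, y\<rbrakk>\<close> with \<open>u\<close> is
  a difference of double brackets ending in \<open>u\<close>, which lie in \<open>n\<close>. Thus
  \<open>h\<close> is even an ideal of \<open>S\<close>.\<close>

lemma br_h: assumes "x \<in> S" "y \<in> S" shows "\<lbrakk>x, y\<rbrakk> \<in> h"
proof (rule hI)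
  have "\<lbrakk>\<lbrakk>x, y\<rbrakk>, u\<rbrakk> = \<lbrakk>x, \<lbrakk>y, u\<rbrakk>\<rbrakk> \<oplus> \<ominus> \<lbrakk>y, \<lbrakk>x, u\<rbrakk>\<rbrakk>"
    using assms by (simp add: br_br_left S')
  also have "\<dots> \<in> n" by (intro n' br_u assms)
  finally show "f \<lbrakk>\<lbrakk>x, y\<rbrakk>, u\<rbrakk> = 1" by (rule n_f)
qed (simp add: S' assms)

lemma h_subring: "lie_subring L h"
  unfolding lie_subring_def add_subgroup_def
proof (intro conjI ballI)
  show "h \<subseteq> carr" using S'(2) h_S by blast
  show "\<zero> \<in> h" by (simp add: h_def S')
  fix x assume x: "x \<in> h"
  show "\<ominus> x \<in> h" using h_S[OF x] h_f[OF x] by (intro hI) (simp_all add: S' br_neg f_neg)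
  fix y assume y: "y \<in> h"
  show "x \<oplus> y \<in> h" using h_S[OF x] h_f[OF x] h_S[OF y] h_f[OF y]
    by (intro hI) (simp_all add: S' br_add_left f_add)
  show "\<lbrakk>x, y\<rbrakk> \<in> h" by (rule br_h[OF h_S[OF x] h_S[OF y]])
qed

lemmas h' = subringD[OF h_subring]

lemma u_h: "u \<in> h"
  by (rule hI) (simp_all add: u_S)

lemma h_psubset: "h \<subset> S"
  using f_u_ne h_S h_f by blast

lemma pol_h: assumes "pol S P" "P \<subseteq> h" shows "pol h P"
proof -
  have "h \<subseteq> S" using h_psubset by blast
  then show ?thesis using assms unfolding pol_def by (meson subset_trans)
qed

lemma u_P: assumes "pol S P" "P \<subseteq> h" shows "u \<in> P"
  by (rule pol_perp[OF S'(1) assms(1) u_S]) (use assms(2) h_f in blast)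

section \<open>The polarization replacing P inside h\<close>

definition pr :: "'a set \<Rightarrow> 'a set" where "pr P = lspan L (insert u (P \<inter> h))"

lemma pr_gen: "u \<in> pr P" "x \<in> P \<Longrightarrow> x \<in> h \<Longrightarrow> x \<in> pr P"
  by (auto simp: pr_def intro: lspan.gen)

context
  fixes P assumes P: "pol S P"
begin

lemmas P' = subringD[OF polD(1)[OF P]]

lemma P_S: "x \<in> P \<Longrightarrow> x \<in> S"
  using polD(2)[OF P] by blast

lemma pr_subset: "insert u (P \<inter> h) \<subseteq> carr"
  using h'(2) by auto

lemma pr_sub: "add_subgroup L (pr P)"
  unfolding pr_def by (rule add_subgroup_lspan[OF pr_subset])

lemma pr_h: "pr P \<subseteq> h"
  unfolding pr_def by (rule lspan_mono) (use u_h h'(1) in auto)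

lemma pr_form: "y \<in> pr P \<Longrightarrow> \<exists>y0\<in>P \<inter> h. \<exists>k. y = y0 \<oplus> nsmul L k u"
  unfolding pr_def
proof (induction rule: lspan.induct)
  case zero
  show ?case by (rule bexI[of _ \<zero>], rule exI[of _ 0]) (simp_all add: P' h')
next
  case (gen x)
  then consider "x = u" | "x \<in> P \<inter> h" by blast
  then show ?case
  proof cases
    case 1
    then show ?thesis by (intro bexI[of _ \<zero>] exI[of _ 1]) (simp_all add: P' h')
  next
    case 2
    then show ?thesis by (intro bexI[of _ x] exI[of _ 0]) (simp_all add: P')
  qed
next
  case (add a b)
  then obtain a0 k b0 l where ab: "a0 \<in> P" "a0 \<in> h" "a = a0 \<oplus> nsmul L k u" "b0 \<in> P" "b0 \<in> h" "b = b0 \<oplus> nsmul L l u"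
    by blast
  then show ?case
    by (intro bexI[of _ "a0 \<oplus> b0"] exI[of _ "k + l"]) (simp_all add: P' h' nsmul_add add_ac)
next
  case (neg a)
  then obtain a0 k where a: "a0 \<in> P" "a0 \<in> h" "a = a0 \<oplus> nsmul L k u" by blast
  then show ?case
    by (intro bexI[of _ "\<ominus> a0"] exI[of _ "k * (card carr - 1)"])
      (simp_all add: P' h' neg_add neg_nsmul)
qed

text \<open>The additive decomposition and the two multiplicative ones share the same
  \<open>k\<close>: they differ by half a bracket with a multiple of \<open>u\<close> and an element
  of \<open>n\<close>, and such corrections in \<open>Z\<close> are absorbed by
  \<open>P \<inter> h\<close>.\<close>

lemma pr_decomp:
  assumes y: "y \<in> pr P"
  obtains k y0 y1 y2 where "y0 \<in> P" "y0 \<in> h" "y = y0 \<oplus> nsmul L k u"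
    "y1 \<in> P" "y1 \<in> h" "y = y1 \<star> nsmul L k u" "y2 \<in> P" "y2 \<in> h" "y = nsmul L k u \<star> y2"
proof -
  obtain y0 k where y0: "y0 \<in> P" "y0 \<in> h" "y = y0 \<oplus> nsmul L k u" using pr_form[OF y] by blast
  let ?w = "nsmul L k u"
  have w: "?w \<in> W" "\<ominus> ?w \<in> W" by (rule nsmul_u_W, rule W'(5)[OF nsmul_u_W])
  note wS = W_S[OF w(1)] W_S[OF w(2)]
  have yS: "y \<in> S" using y pr_h h_S by blast
  note c = S'(4)[OF yS] P'(4)[OF y0(1)] S'(4)[OF wS(1)]
  obtain r where r: "r \<in> n" "y \<star> \<ominus> ?w = y \<oplus> \<ominus> ?w \<oplus> (1 / 2) \<bullet> \<lbrakk>y, \<ominus> ?w\<rbrakk> \<oplus> r"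
    using mul_W[OF yS wS(2) W_br[OF yS w(2)]] by blast
  obtain r' where r': "r' \<in> n" "\<ominus> ?w \<star> y = \<ominus> ?w \<oplus> y \<oplus> (1 / 2) \<bullet> \<lbrakk>\<ominus> ?w, y\<rbrakk> \<oplus> r'"
    using mul_W[OF wS(2) yS W_br'[OF yS w(2)]] by blast
  define z where "z = (1 / 2) \<bullet> \<lbrakk>y, \<ominus> ?w\<rbrakk> \<oplus> r"
  define z' where "z' = (1 / 2) \<bullet> \<lbrakk>\<ominus> ?w, y\<rbrakk> \<oplus> r'"
  have z: "z \<in> Z" "z' \<in> Z"
    unfolding z_def z'_def by (intro Z' subgroup_rsm[OF Z_sub] W_br W_br' yS w n_Z r r')+
  note zc = Z'(3)[OF z(1)] Z'(3)[OF z(2)]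
  have "y \<oplus> \<ominus> ?w = y0" using c y0(3) by (simp add: add_assoc)
  then have "y \<star> \<ominus> ?w = y0 \<oplus> z" "\<ominus> ?w \<star> y = y0 \<oplus> z'"
    using r(2) r'(2) c n'(3)[OF r(1)] n'(3)[OF r'(1)]
    by (simp_all add: z_def z'_def add_assoc add_comm[of "\<ominus> ?w"])
  then have "y = (y0 \<oplus> z) \<star> ?w" "y = ?w \<star> (y0 \<oplus> z')"
    using c by (metis mul_cancel_right(2), metis mul_cancel(2))
  moreover have "y0 \<oplus> z \<in> P" "y0 \<oplus> z' \<in> P" "y0 \<oplus> z \<in> h" "y0 \<oplus> z' \<in> h"
    by (intro P' h' y0 Z_P[OF P] Z_h z)+
  ultimately show thesis using that y0 by blast
qed

text \<open>Split \<open>y\<close> into a factor from \<open>P\<close>, whose conjugation does not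
  affect the character, and a multiple of \<open>u\<close>, which lies in the second center.\<close>

lemma conj_pr:
  assumes y: "y \<in> pr P" and x: "x \<in> P"
  shows "y \<star> x \<star> \<ominus> y \<in> P" "f (y \<star> x \<star> \<ominus> y) = f x * f \<lbrakk>y, x\<rbrakk>"
proof -
  obtain k y0 y1 where y0: "y0 \<in> P" "y = y0 \<oplus> nsmul L k u" and y1: "y1 \<in> P" "y = y1 \<star> nsmul L k u"
    using pr_decomp[OF y] by metis
  let ?w = "nsmul L k u"
  note c = P'(4)[OF y0(1)] P'(4)[OF y1(1)] P'(4)[OF x]
  have wc: "?w \<in> carr" by simp
  have e: "y \<star> x \<star> \<ominus> y = y1 \<star> (?w \<star> x \<star> \<ominus> ?w) \<star> \<ominus> y1"
    using c wc by (simp add: y1(2) neg_mul mul_assoc)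
  note q = conj_P[OF P nsmul_u_W x, of k]
  show "y \<star> x \<star> \<ominus> y \<in> P"
    unfolding e by (intro pol_mul[OF P] y1 q P')
  have "f (y \<star> x \<star> \<ominus> y) = f (?w \<star> x \<star> \<ominus> ?w)"
    unfolding e using f_mul[OF P] y1 q P'(6) pol_mul[OF P] c by (simp add: f_neg)
  also have "\<dots> = f x * f \<lbrakk>y, x\<rbrakk>"
    using c wc polD(3)[OF P y0(1) x] by (simp add: q y0(2) br_add_left f_add)
  finally show "f (y \<star> x \<star> \<ominus> y) = f x * f \<lbrakk>y, x\<rbrakk>" .
qed

lemma pol_pr: "pol S (pr P)"
  unfolding pol_def
proof (intro conjI allI impI)
  have iso: "isotropic (insert u (P \<inter> h))"
    unfolding isotropic_def
  proof (intro ballI)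
    fix x y assume "x \<in> insert u (P \<inter> h)" "y \<in> insert u (P \<inter> h)"
    then show "f \<lbrakk>x, y\<rbrakk> = 1"
      using polD(3)[OF P, of x y] h_f[of x] h_f[of y] f_br_swap[of u y] h'(4)[of y] by auto
  qed
  then show "isotropic (pr P)"
    unfolding pr_def by (rule isotropic_lspan[OF pr_subset])
  show "pr P \<subseteq> S" using pr_h h_S by blast
  show "lie_subring L (pr P)"
    unfolding lie_subring_def
  proof (intro conjI ballI pr_sub)
    fix x y assume "x \<in> pr P" "y \<in> pr P"
    then obtain x0 k y0 l where xy: "x0 \<in> P" "x0 \<in> h" "x = x0 \<oplus> nsmul L k u" "y0 \<in> P" "y0 \<in> h" "y = y0 \<oplus> nsmul L l u"
      using pr_form by blast
    note S0 = h_S[OF xy(2)] h_S[OF xy(5)]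
    note c = h'(4)[OF xy(2)] h'(4)[OF xy(5)]
    have 1: "\<lbrakk>x0, y0\<rbrakk> \<in> P \<inter> h" using P'(7) xy br_h S0 by blast
    have 2: "t \<in> P \<inter> h" if "t \<in> Z" for t using Z_P[OF P that] Z_h[OF that] by blast
    have "\<lbrakk>x, y\<rbrakk> = \<lbrakk>x0, y0\<rbrakk> \<oplus> \<lbrakk>x0, nsmul L l u\<rbrakk> \<oplus> (\<lbrakk>nsmul L k u, y0\<rbrakk> \<oplus> \<lbrakk>nsmul L k u, nsmul L l u\<rbrakk>)"
      using c by (simp add: xy br_add_left br_add_right add_ac)
    also have "\<dots> \<in> P \<inter> h"
      using 1 2[OF W_br[OF S0(1) nsmul_u_W]] 2[OF W_br'[OF S0(2) nsmul_u_W]]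
        2[OF W_br[OF W_S[OF nsmul_u_W] nsmul_u_W]] by (simp add: P' h')
    finally show "\<lbrakk>x, y\<rbrakk> \<in> pr P" using pr_gen(2) by blast
  qed
  fix Q assume Q: "add_subgroup L Q \<and> Q \<subseteq> S \<and> pr P \<subseteq> Q \<and> isotropic Q"
  have "a \<in> pr P" if a: "a \<in> Q" for a
  proof -
    have aS: "a \<in> S" and ac: "a \<in> carr" using a Q S'(4) by blast+
    have fa: "f \<lbrakk>x, a\<rbrakk> = 1" if "x \<in> pr P" for x
      using that a Q unfolding isotropic_def by blast
    have ah: "a \<in> h" using fa[OF pr_gen(1)] f_br_swap[of a u] aS ac by (intro hI) auto
    \<comment> \<open>On \<open>P\<close> the character given by \<open>a\<close> is trivial on
      \<open>P \<inter> h\<close>, the kernel of the one given by \<open>u\<close>. The quotient is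
      trivial or cyclic of order \<open>p\<close>, so the former is a power of the latter;
      subtracting \<open>k\<close> copies of \<open>u\<close> from \<open>a\<close> yields an
      element orthogonal to \<open>P\<close>.\<close>
    have "\<exists>k. \<forall>x\<in>P. f \<lbrakk>x, a\<rbrakk> = f \<lbrakk>x, u\<rbrakk> ^ k"
    proof (cases "P \<subseteq> h")
      case True
      then have "\<forall>x\<in>P. f \<lbrakk>x, a\<rbrakk> = f \<lbrakk>x, u\<rbrakk> ^ 0" using fa pr_gen(2) by auto
      then show ?thesis by blast
    next
      case False
      then obtain v where v: "v \<in> P" "v \<notin> h" by blast
      have vS: "v \<in> S" and vc: "v \<in> carr" by (rule P_S[OF v(1)], rule P'(4)[OF v(1)])
      define z where "z = f \<lbrakk>v, u\<rbrakk>"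
      have z1: "z \<noteq> 1" using v vS hI by (auto simp: z_def)
      have zp: "z ^ p = 1" using f_u_pow[OF vS] by (simp add: z_def)
      have roots: "\<exists>j. y = z ^ j" if "y ^ p = 1" for y
        using root_of_unity_power[OF prime_p, of z 0 y] zp z1 that by simp
      have "nsmul L p v \<in> h"
        using vS vc subgroup_nsmul[OF S'(1) vS] zp by (intro hI) (simp_all add: nsmul_br f_nsmul z_def)
      then have "f \<lbrakk>nsmul L p v, a\<rbrakk> = 1"
        using subgroup_nsmul[OF P'(1) v(1)] by (intro fa pr_gen(2)) auto
      then have "f \<lbrakk>v, a\<rbrakk> ^ p = 1" using vc ac by (simp add: nsmul_br f_nsmul)
      then obtain k where k: "f \<lbrakk>v, a\<rbrakk> = z ^ k" using roots by blast
      have "f \<lbrakk>x, a\<rbrakk> = f \<lbrakk>x, u\<rbrakk> ^ k" if x: "x \<in> P" for x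
      proof -
        have xS: "x \<in> S" and xc: "x \<in> carr" by (rule P_S[OF x], rule P'(4)[OF x])
        obtain j where j: "f \<lbrakk>x, u\<rbrakk> = z ^ j" using roots f_u_pow[OF xS] by blast
        define y where "y = x \<oplus> \<ominus> nsmul L j v"
        have yP: "y \<in> P" unfolding y_def by (intro P' x subgroup_nsmul[OF P'(1) v(1)])
        have "f \<lbrakk>y, u\<rbrakk> = 1"
          using xc vc j f_nz[of "\<lbrakk>v, u\<rbrakk>"] by (simp add: y_def br_add_left br_neg f_add f_neg nsmul_br f_nsmul z_def)
        then have "y \<in> h" using P_S[OF yP] by (intro hI)
        then have "f \<lbrakk>y, a\<rbrakk> = 1" using yP by (intro fa pr_gen(2))
        then have "f \<lbrakk>x, a\<rbrakk> = f \<lbrakk>v, a\<rbrakk> ^ j"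
          using xc vc ac f_nz[of "\<lbrakk>v, a\<rbrakk>"] by (simp add: y_def br_add_left br_neg f_add f_neg nsmul_br f_nsmul field_simps)
        then show ?thesis using k j by (metis mult.commute power_mult)
      qed
      then show ?thesis by blast
    qed
    then obtain k where k: "\<forall>x\<in>P. f \<lbrakk>x, a\<rbrakk> = f \<lbrakk>x, u\<rbrakk> ^ k" by blast
    define b where "b = a \<oplus> \<ominus> nsmul L k u"
    have bh: "b \<in> h" unfolding b_def by (intro h' ah subgroup_nsmul[OF h'(1) u_h])
    have "b \<in> P"
    proof (rule pol_perp[OF S'(1) P h_S[OF bh]])
      fix x assume x: "x \<in> P"
      have xc: "x \<in> carr" by (rule P'(4)[OF x])
      show "f \<lbrakk>x, b\<rbrakk> = 1"
        using k x xc ac by (simp add: b_def br_add_right br_neg f_add f_neg nsmul_br f_nsmul)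
    qed
    then have "b \<in> pr P" using bh pr_gen(2) by blast
    then have "b \<oplus> nsmul L k u \<in> pr P"
      using subgroupD(4)[OF pr_sub] subgroup_nsmul[OF pr_sub pr_gen(1)] by blast
    moreover have "b \<oplus> nsmul L k u = a" using ac by (simp add: b_def add_assoc)
    ultimately show ?thesis by simp
  qed
  then show "Q = pr P" using Q by blast
qed

lemma sum_f_br:
  assumes "y \<in> S"
  shows "(\<Sum>x\<in>P. f \<lbrakk>y, x\<rbrakk>) = (if y \<in> P then of_nat (card P) else 0)"
proof (cases "y \<in> P")
  case True
  then show ?thesis using polD(3)[OF P] by simp
next
  case False
  then obtain x where x: "x \<in> P" "f \<lbrakk>x, y\<rbrakk> \<noteq> 1"
    using pol_perp[OF S'(1) P assms] by blast
  have yc: "y \<in> carr" using assms S'(4) by blast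
  have "(\<Sum>x\<in>P. f \<lbrakk>y, x\<rbrakk>) = 0"
    by (rule sum_char_zero[OF P'(1) _ x(1)])
      (use x yc f_br_swap[of y x] in \<open>simp_all add: P' br_add_right f_add\<close>)
  then show ?thesis using False by simp
qed

text \<open>Moving \<open>y\<close> past \<open>x\<close> produces the factor
  \<open>f \<lbrakk>y, x\<rbrakk>\<close>, whose sum over \<open>P\<close> vanishes unless
  \<open>y\<close> lies in \<open>P\<close>. This proves that averaging over \<open>pr P\<close> and
  then over \<open>P\<close> is a scalar without Schur's lemma, as needed while irreducibility is
  still being established.\<close>

lemma left_inversion:
  assumes \<phi>: "\<And>x g. x \<in> P \<Longrightarrow> g \<in> S \<Longrightarrow> \<phi> (x \<star> g) = f x * \<phi> g" and g: "g \<in> S"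
  shows "(\<Sum>x\<in>P. \<Sum>y\<in>pr P. inverse (f x) * (inverse (f y) * \<phi> (y \<star> (x \<star> g)))) =
    of_nat (card P * card (P \<inter> pr P)) * \<phi> g"
proof -
  note gc = S'(4)[OF g]
  have prS: "y \<in> S" if "y \<in> pr P" for y using that pr_h h_S by blast
  have "(\<Sum>x\<in>P. \<Sum>y\<in>pr P. inverse (f x) * (inverse (f y) * \<phi> (y \<star> (x \<star> g)))) =
      (\<Sum>y\<in>pr P. \<Sum>x\<in>P. inverse (f x) * (inverse (f y) * \<phi> (y \<star> (x \<star> g))))"
    by (rule sum.swap)
  also have "\<dots> = (\<Sum>y\<in>pr P. inverse (f y) * \<phi> (y \<star> g) * (\<Sum>x\<in>P. f \<lbrakk>y, x\<rbrakk>))"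
    unfolding sum_distrib_left
  proof (intro sum.cong refl)
    fix x y assume y: "y \<in> pr P" and x: "x \<in> P"
    note c = P'(4)[OF x] S'(4)[OF prS[OF y]]
    have "y \<star> (x \<star> g) = y \<star> x \<star> \<ominus> y \<star> (y \<star> g)"
      using c gc by (simp add: mul_assoc)
    then have "\<phi> (y \<star> (x \<star> g)) = f x * f \<lbrakk>y, x\<rbrakk> * \<phi> (y \<star> g)"
      using \<phi>[OF conj_pr(1)[OF y x] subring_mul[OF S prS[OF y] g]] conj_pr(2)[OF y x] by simp
    then show "inverse (f x) * (inverse (f y) * \<phi> (y \<star> (x \<star> g))) = inverse (f y) * \<phi> (y \<star> g) * f \<lbrakk>y, x\<rbrakk>"
      using c by simp
  qed
  also have "\<dots> = (\<Sum>y\<in>pr P. if y \<in> P then of_nat (card P) * \<phi> g else 0)"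
  proof (intro sum.cong refl)
    fix y assume y: "y \<in> pr P"
    show "inverse (f y) * \<phi> (y \<star> g) * (\<Sum>x\<in>P. f \<lbrakk>y, x\<rbrakk>) = (if y \<in> P then of_nat (card P) * \<phi> g else 0)"
      using sum_f_br[OF prS[OF y]] \<phi>[OF _ g, of y] S'(4)[OF prS[OF y]] by simp
  qed
  also have "\<dots> = of_nat (card P * card (P \<inter> pr P)) * \<phi> g"
  proof -
    have "finite (pr P)" by (rule finite_sub) (rule subgroupD(1)[OF pr_sub])
    then show ?thesis
      by (simp add: sum.If_cases Int_commute)
  qed
  finally show ?thesis .
qed

text \<open>The mirror image for right translations. Moving \<open>y\<close> to the left conjugates
  \<open>x\<close> by \<open>\<ominus> y\<close>, which accounts for the sign.\<close>

lemma right_inversion: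
  assumes \<phi>: "\<And>x g. x \<in> P \<Longrightarrow> g \<in> S \<Longrightarrow> \<phi> (g \<star> x) = \<phi> g * f x" and g: "g \<in> S"
  shows "(\<Sum>x\<in>P. \<Sum>y\<in>pr P. inverse (f x) * (inverse (f y) * \<phi> (g \<star> x \<star> y))) =
    of_nat (card P * card (P \<inter> pr P)) * \<phi> g"
proof -
  note gc = S'(4)[OF g]
  have prS: "y \<in> S" if "y \<in> pr P" for y using that pr_h h_S by blast
  have "(\<Sum>x\<in>P. \<Sum>y\<in>pr P. inverse (f x) * (inverse (f y) * \<phi> (g \<star> x \<star> y))) =
      (\<Sum>y\<in>pr P. \<Sum>x\<in>P. inverse (f x) * (inverse (f y) * \<phi> (g \<star> x \<star> y)))"
    by (rule sum.swap)
  also have "\<dots> = (\<Sum>y\<in>pr P. inverse (f y) * \<phi> (g \<star> y) * (\<Sum>x\<in>P. f \<lbrakk>\<ominus> y, x\<rbrakk>))"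
    unfolding sum_distrib_left
  proof (intro sum.cong refl)
    fix x y assume y: "y \<in> pr P" and x: "x \<in> P"
    have my: "\<ominus> y \<in> pr P" by (rule subgroupD(5)[OF pr_sub y])
    note c = P'(4)[OF x] S'(4)[OF prS[OF y]]
    have "g \<star> x \<star> y = g \<star> y \<star> (\<ominus> y \<star> x \<star> \<ominus> (\<ominus> y))"
      using c gc by (simp add: mul_assoc)
    then have "\<phi> (g \<star> x \<star> y) = \<phi> (g \<star> y) * (f x * f \<lbrakk>\<ominus> y, x\<rbrakk>)"
      using \<phi>[OF conj_pr(1)[OF my x] subring_mul[OF S g prS[OF y]]] conj_pr(2)[OF my x] by simp
    then show "inverse (f x) * (inverse (f y) * \<phi> (g \<star> x \<star> y)) = inverse (f y) * \<phi> (g \<star> y) * f \<lbrakk>\<ominus> y, x\<rbrakk>"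
      using c by simp
  qed
  also have "\<dots> = (\<Sum>y\<in>pr P. if y \<in> P then of_nat (card P) * \<phi> g else 0)"
  proof (intro sum.cong refl)
    fix y assume y: "y \<in> pr P"
    have yc: "y \<in> carr" by (rule S'(4)[OF prS[OF y]])
    have "\<ominus> y \<in> P \<longleftrightarrow> y \<in> P" using P'(6)[of y] P'(6)[of "\<ominus> y"] yc by auto
    then show "inverse (f y) * \<phi> (g \<star> y) * (\<Sum>x\<in>P. f \<lbrakk>\<ominus> y, x\<rbrakk>) = (if y \<in> P then of_nat (card P) * \<phi> g else 0)"
      using sum_f_br[OF S'(6)[OF prS[OF y]]] \<phi>[OF _ g, of y] yc by simp
  qed
  also have "\<dots> = of_nat (card P * card (P \<inter> pr P)) * \<phi> g"
  proof -
    have "finite (pr P)" by (rule finite_sub) (rule subgroupD(1)[OF pr_sub])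
    then show ?thesis
      by (simp add: sum.If_cases Int_commute)
  qed
  finally show ?thesis .
qed

end

end

section \<open>Induced spaces and averaging operators\<close>

context char_lie
begin

lemma f_rsm: "x \<in> carr \<Longrightarrow> f (q \<bullet> x) = f x ^ res q"
  by (simp add: rat_smul_res f_nsmul)

definition Vs :: "'a set \<Rightarrow> 'a set \<Rightarrow> ('a \<Rightarrow> complex) set" where
  "Vs S P = {\<phi>. \<forall>x\<in>P. \<forall>g\<in>S. \<phi> (x \<star> g) = f x * \<phi> g}"

lemma VsD: "\<phi> \<in> Vs S P \<Longrightarrow> x \<in> P \<Longrightarrow> g \<in> S \<Longrightarrow> \<phi> (x \<star> g) = f x * \<phi> g"
  by (simp add: Vs_def)

text \<open>The intertwining operator without its normalization; the source polarization then no
  longer appears in the formula.\<close>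

definition T :: "'a set \<Rightarrow> ('a \<Rightarrow> complex) \<Rightarrow> 'a \<Rightarrow> complex" where
  "T P \<phi> g = (\<Sum>x\<in>P. inverse (f x) * \<phi> (x \<star> g))"

lemma T_Vs:
  assumes S: "lie_subring L S" and P: "pol S P"
  shows "T P \<phi> \<in> Vs S P"
  unfolding Vs_def
proof (intro CollectI ballI)
  fix x g assume x: "x \<in> P" and g: "g \<in> S"
  note P' = subringD[OF polD(1)[OF P]]
  note c = P'(4)[OF x] subringD(4)[OF S g]
  have "T P \<phi> (x \<star> g) = (\<Sum>y\<in>P. f x * (inverse (f (y \<star> x)) * \<phi> ((y \<star> x) \<star> g)))"
    unfolding T_def
  proof (rule sum.cong[OF refl])
    fix y assume y: "y \<in> P"
    show "inverse (f y) * \<phi> (y \<star> (x \<star> g)) = f x * (inverse (f (y \<star> x)) * \<phi> ((y \<star> x) \<star> g))"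
      using c P'(4)[OF y] by (simp add: f_mul[OF P y x] mul_assoc)
  qed
  also have "\<dots> = (\<Sum>y\<in>P. f x * (inverse (f y) * \<phi> (y \<star> g)))"
    by (rule sum_mul_right[OF P x])
  finally show "T P \<phi> (x \<star> g) = f x * T P \<phi> g"
    by (simp add: T_def sum_distrib_left)
qed

lemma T_right_equivariant:
  assumes S: "lie_subring L S" and P: "pol S P" and g: "g \<in> S" and y: "y \<in> S"
    and K: "\<And>g. g \<in> S \<Longrightarrow> K (g \<star> y) = K g * c"
  shows "T P K (g \<star> y) = T P K g * c"
proof -
  have "K (x \<star> (g \<star> y)) = K (x \<star> g) * c" if "x \<in> P" for x
  proof -
    have xS: "x \<in> S" using that polD(2)[OF P] by blast
    have "x \<star> (g \<star> y) = x \<star> g \<star> y"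
      using subringD(4)[OF S] xS g y by (simp add: mul_assoc)
    then show ?thesis using K[OF subring_mul[OF S xS g]] by simp
  qed
  then show ?thesis by (simp add: T_def sum_distrib_right mult.assoc)
qed

end

section \<open>Irreducibility passes from h to S and from P' to P\<close>

context step
begin

text \<open>Since \<open>u\<close> belongs to \<open>P\<close>, the function \<open>K\<close> is
  invariant under conjugation by \<open>u\<close>. For \<open>g\<close> outside \<open>h\<close>
  this conjugation amounts to multiplying \<open>g\<close> by an element of \<open>P\<close> on
  which \<open>f\<close> is not \<open>1\<close>, so \<open>K g\<close> vanishes; inside
  \<open>h\<close> the assumption applies.\<close>

lemma clean_if_clean_h:
  assumes P: "pol S P" and Ph: "P \<subseteq> h" and cl: "clean h P"
  shows "clean S P"
  unfolding clean_def
proof (intro allI impI ballI)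
  fix K g assume K: "bieq S P K" and g: "g \<in> S - P"
  note P' = subringD[OF polD(1)[OF P]]
  show "K g = 0"
  proof (cases "g \<in> h")
    case True
    have "bieq h P K" using K h_S unfolding bieq_def by blast
    then show ?thesis using cl True g unfolding clean_def by blast
  next
    case False
    have gS: "g \<in> S" using g by blast
    note gc = S'(4)[OF gS]
    have u: "u \<in> P" by (rule u_P[OF P Ph])
    obtain r where r: "r \<in> n" "u \<star> g \<star> \<ominus> u = g \<oplus> \<lbrakk>u, g\<rbrakk> \<oplus> r" using conj_W[OF u_W gS] by blast
    define z where "z = \<lbrakk>u, g\<rbrakk> \<oplus> r"
    have z: "z \<in> Z" unfolding z_def by (intro Z' W_br' gS u_W n_Z r)
    note zc = Z'(3)[OF z]
    have e: "u \<star> g \<star> \<ominus> u = g \<oplus> z" using r gc n'(3)[OF r(1)] by (simp add: z_def add_assoc)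
    have gz: "g \<oplus> z \<in> S" "\<ominus> g \<in> S" by (intro S' gS Z_S z)+
    \<comment> \<open>Turns the additive correction \<open>z\<close> into a left factor
      \<open>z'\<close>, at the cost of an element of \<open>n\<close>.\<close>
    have "\<lbrakk>g \<oplus> z, \<ominus> g\<rbrakk> = \<ominus> \<lbrakk>z, g\<rbrakk>" using gc zc by (simp add: br_add_left br_neg)
    also have "\<dots> \<in> n" by (intro n' Z_br' gS z)
    finally have "\<exists>r\<in>n. (g \<oplus> z) \<star> \<ominus> g = g \<oplus> z \<oplus> \<ominus> g \<oplus> r"
      by (rule mul_expand2[OF S'(4)[OF gz(1)] S'(4)[OF gz(2)] n_sub _ n_br[OF gz(1)] n_br[OF gz(2)]])
    then obtain r' where r': "r' \<in> n" "(g \<oplus> z) \<star> \<ominus> g = g \<oplus> z \<oplus> \<ominus> g \<oplus> r'" by blast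
    define z' where "z' = z \<oplus> r'"
    have z': "z' \<in> P" unfolding z'_def by (intro Z_P[OF P] Z' z n_Z r')
    have "(g \<oplus> z) \<star> \<ominus> g = z'" using r' gc zc by (simp add: z'_def add_conj)
    then have zg: "g \<oplus> z = z' \<star> g" using gc zc by (metis closed(2) mul_cancel_right(2))
    have "f z' = f \<lbrakk>u, g\<rbrakk>"
      using gc n'(3)[OF r(1)] n'(3)[OF r'(1)] n_f[OF r(1)] n_f[OF r'(1)]
      by (simp add: z'_def z_def f_add)
    then have fz: "f z' \<noteq> 1" using False hI[OF gS] f_br_swap[of u g] gc by auto
    have "K (u \<star> g \<star> \<ominus> u) = f u * K g * f (\<ominus> u)"
      using K u P'(6)[OF u] gS unfolding bieq_def by blast
    then have 1: "K (g \<oplus> z) = K g" by (simp add: e f_neg)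
    have "K (z' \<star> g \<star> \<zero>) = f z' * K g * f \<zero>"
      using K z' P'(3) gS unfolding bieq_def by blast
    then have "K (g \<oplus> z) = f z' * K g" using gc P'(4)[OF z'] by (simp add: zg)
    then show ?thesis using 1 fz by simp
  qed
qed

text \<open>Averaging over \<open>pr P\<close> on both sides turns \<open>K\<close> into a function
  bi-equivariant for \<open>pr P\<close>, which by assumption is supported there. The inversion
  formulas show that a nonzero \<open>K g\<close> would survive this process after moving
  \<open>g\<close> within its double coset of \<open>P\<close>, so that double coset meets
  \<open>pr P\<close>, and it suffices to treat multiples of \<open>u\<close>.\<close>

lemma clean_if_clean_pr:
  assumes P: "pol S P" and cl: "clean S (pr P)"
  shows "clean S P"
  unfolding clean_def
proof (intro allI impI ballI)
  fix K g assume K: "bieq S P K" and g: "g \<in> S - P"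
  note P' = subringD[OF polD(1)[OF P]] and prp = pol_pr[OF P]
  note Q' = subringD[OF polD(1)[OF prp]]
  have gS: "g \<in> S" using g by blast
  have Kl: "K (x \<star> g) = f x * K g" if "x \<in> P" "g \<in> S" for x g
  proof -
    have "K (x \<star> g \<star> \<zero>) = f x * K g * f \<zero>" using K that P'(3) unfolding bieq_def by blast
    then show ?thesis using that P'(4) S'(4) by simp
  qed
  have Kr: "K (g \<star> x) = K g * f x" if "x \<in> P" "g \<in> S" for x g
  proof -
    have "K (\<zero> \<star> g \<star> x) = f \<zero> * K g * f x" using K that P'(3) unfolding bieq_def by blast
    then show ?thesis using that S'(4) by simp
  qed
  define K1 where "K1 = T (pr P) K"
  have K1l: "K1 (y \<star> g) = f y * K1 g" if "y \<in> pr P" "g \<in> S" for y g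
    using VsD[OF T_Vs[OF S prp] that] by (simp add: K1_def)
  have K1r: "K1 (g \<star> x) = K1 g * f x" if "x \<in> P" "g \<in> S" for x g
    unfolding K1_def using that P_S[OF P] Kr by (intro T_right_equivariant[OF S prp])
  define K2 where "K2 g = (\<Sum>y\<in>pr P. inverse (f y) * K1 (g \<star> y))" for g
  have "bieq S (pr P) K2"
    unfolding bieq_def
  proof (intro ballI)
    fix x y g assume x: "x \<in> pr P" and y: "y \<in> pr P" and g: "g \<in> S"
    note c = Q'(4)[OF x] Q'(4)[OF y] S'(4)[OF g]
    have QS: "z \<in> S" if "z \<in> pr P" for z using that polD(2)[OF prp] by blast
    have "K2 (x \<star> g \<star> y) = (\<Sum>z\<in>pr P. f x * f y * (inverse (f (y \<star> z)) * K1 (g \<star> (y \<star> z))))"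
      unfolding K2_def
    proof (rule sum.cong[OF refl])
      fix z assume z: "z \<in> pr P"
      have "x \<star> g \<star> y \<star> z = x \<star> (g \<star> (y \<star> z))" using c Q'(4)[OF z] by (simp add: mul_assoc)
      then have "K1 (x \<star> g \<star> y \<star> z) = f x * K1 (g \<star> (y \<star> z))"
        using K1l[OF x subring_mul[OF S g QS[OF pol_mul[OF prp y z]]]] by simp
      then show "inverse (f z) * K1 (x \<star> g \<star> y \<star> z) = f x * f y * (inverse (f (y \<star> z)) * K1 (g \<star> (y \<star> z)))"
        using c Q'(4)[OF z] by (simp add: f_mul[OF prp y z])
    qed
    also have "\<dots> = (\<Sum>z\<in>pr P. f x * f y * (inverse (f z) * K1 (g \<star> z)))"
      by (rule sum_mul_left[OF prp y])
    finally show "K2 (x \<star> g \<star> y) = f x * K2 g * f y"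
      by (simp add: K2_def sum_distrib_left sum_distrib_right mult_ac)
  qed
  then have K2z: "K2 g = 0" if "g \<in> S" "g \<notin> pr P" for g
    using cl that unfolding clean_def by blast
  have kap: "(of_nat (card P * card (P \<inter> pr P)) :: complex) \<noteq> 0"
  proof -
    have "\<zero> \<in> P \<inter> pr P" using P'(3) Q'(3) by blast
    moreover have "finite P" by (rule finite_sub[OF P'(2)])
    ultimately show ?thesis by auto
  qed
  show "K g = 0"
  proof (rule ccontr)
    assume Kg: "K g \<noteq> 0"
    have "(\<Sum>x\<in>P. inverse (f x) * K1 (x \<star> g)) = of_nat (card P * card (P \<inter> pr P)) * K g"
      unfolding K1_def T_def sum_distrib_left by (rule left_inversion[where \<phi> = K, OF P Kl gS])
    then have "(\<Sum>x\<in>P. inverse (f x) * K1 (x \<star> g)) \<noteq> 0" using kap Kg by simp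
    then obtain x where x: "x \<in> P" "K1 (x \<star> g) \<noteq> 0" by (elim sum.not_neutral_contains_not_neutral) auto
    have xg: "x \<star> g \<in> S" by (rule subring_mul[OF S P_S[OF P x(1)] gS])
    have "(\<Sum>x'\<in>P. inverse (f x') * K2 (x \<star> g \<star> x')) = of_nat (card P * card (P \<inter> pr P)) * K1 (x \<star> g)"
      unfolding K2_def sum_distrib_left by (rule right_inversion[where \<phi> = K1, OF P K1r xg])
    then have "(\<Sum>x'\<in>P. inverse (f x') * K2 (x \<star> g \<star> x')) \<noteq> 0" using kap x by simp
    then obtain x' where x': "x' \<in> P" "K2 (x \<star> g \<star> x') \<noteq> 0" by (elim sum.not_neutral_contains_not_neutral) auto
    define y where "y = x \<star> g \<star> x'"
    have yS: "y \<in> S" unfolding y_def by (rule subring_mul[OF S xg P_S[OF P x'(1)]])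
    have y: "y \<in> pr P" using K2z[OF yS] x' by (auto simp: y_def)
    have "K y = f x * K g * f x'" using K x x' gS unfolding bieq_def y_def by blast
    then have Ky: "K y \<noteq> 0" using Kg P'(4)[OF x(1)] P'(4)[OF x'(1)] by simp
    obtain k y1 where y1: "y1 \<in> P" "y = y1 \<star> nsmul L k u" using pr_decomp[OF P y] by metis
    let ?w = "nsmul L k u"
    have wS: "?w \<in> S" by (rule W_S[OF nsmul_u_W])
    have Kw: "K ?w \<noteq> 0" using Ky Kl[OF y1(1) wS] y1 by auto
    have "?w \<in> P"
    proof (rule pol_perp[OF S'(1) P wS])
      fix v assume v: "v \<in> P"
      note q = conj_P[OF P nsmul_u_W v, of k]
      have vc: "v \<in> carr" by (rule P'(4)[OF v])
      \<comment> \<open>The value of \<open>K\<close> at \<open>?w \<star> v\<close> is computed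
        with \<open>v\<close> on the right and with its conjugate on the left; as
        \<open>K ?w\<close> is nonzero, the twist \<open>f \<lbrakk>?w, v\<rbrakk>\<close> must be
        \<open>1\<close>.\<close>
      have "?w \<star> v \<star> \<ominus> ?w \<star> ?w = ?w \<star> v" using vc by simp
      then have "f v * f \<lbrakk>?w, v\<rbrakk> * K ?w = K ?w * f v"
        using Kl[OF q(1) wS] Kr[OF v wS] q(2) by (simp only:)
      then show "f \<lbrakk>v, ?w\<rbrakk> = 1" using Kw vc f_br_swap[of v ?w] by simp
    qed
    then have "y \<in> P" using pol_mul[OF P y1(1)] y1(2) by simp
    moreover have "g = \<ominus> x \<star> y \<star> \<ominus> x'"
      using P'(4)[OF x(1)] P'(4)[OF x'(1)] S'(4)[OF gS] by (simp add: y_def mul_assoc)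
    ultimately have "g \<in> P" using pol_mul[OF P] P'(6) x(1) x'(1) by simp
    then show False using g by blast
  qed
qed

end

context char_lie
begin

theorem clean_pol: "lie_subring L S \<Longrightarrow> pol S P \<Longrightarrow> clean S P"
proof (induction "card S" arbitrary: S P rule: less_induct)
  case less
  note S = less.prems(1) and P = less.prems(2)
  show ?case
  proof (cases "isotropic S")
    case True
    then have "P = S" using P subringD(1)[OF S] unfolding pol_def by blast
    then show ?thesis by (simp add: clean_def)
  next
    case False
    then obtain n u where "good S n u" using exists_good[OF S] by blast
    then interpret step L p f S n u using S by unfold_locales
    have "card h < card S"
      by (rule psubset_card_mono[OF finite_sub[OF S'(2)] h_psubset])
    then have "clean h (pr P)"
      using less.hyps[OF _ h_subring pol_h[OF pol_pr[OF P] pr_h[OF P]]] by blast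
    then have "clean S (pr P)" by (rule clean_if_clean_h[OF pol_pr[OF P] pr_h[OF P]])
    then show ?thesis by (rule clean_if_clean_pr[OF P])
  qed
qed

definition dlt :: "'a set \<Rightarrow> 'a \<Rightarrow> complex" where
  "dlt P x = (if x \<in> P then f x else 0)"

end

section \<open>Schur's lemma for sums of left translations\<close>

locale subring = char_lie +
  fixes S
  assumes S: "lie_subring L S"
begin

lemmas S' = subringD[OF S]

lemma pol_S: "pol S P \<Longrightarrow> x \<in> P \<Longrightarrow> x \<in> S"
  using polD(2) by blast

lemma pol_carr: "pol S P \<Longrightarrow> x \<in> P \<Longrightarrow> x \<in> carr"
  using polD(5) by blast

lemma mul_S: "x \<in> S \<Longrightarrow> y \<in> S \<Longrightarrow> x \<star> y \<in> S"
  by (rule subring_mul[OF S])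

lemma pol_neg: "pol S P \<Longrightarrow> x \<in> P \<Longrightarrow> \<ominus> x \<in> P"
  using subringD(6)[OF polD(1)] by blast

lemma mem_mul_left:
  assumes P: "pol S P" and "x \<in> P" "g \<in> S"
  shows "x \<star> g \<in> P \<longleftrightarrow> g \<in> P"
proof
  assume "x \<star> g \<in> P"
  from pol_mul[OF P pol_neg[OF P assms(2)] this] have "\<ominus> x \<star> (x \<star> g) \<in> P" .
  then show "g \<in> P" using assms S'(4) pol_carr[OF P] by simp
qed (rule pol_mul[OF P assms(2)])

lemma mem_mul_right:
  assumes P: "pol S P" and "x \<in> P" "g \<in> S"
  shows "g \<star> x \<in> P \<longleftrightarrow> g \<in> P"
proof
  assume "g \<star> x \<in> P"
  from pol_mul[OF P this pol_neg[OF P assms(2)]] have "g \<star> x \<star> \<ominus> x \<in> P" .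
  then show "g \<in> P" using assms S'(4) pol_carr[OF P] by simp
qed (rule pol_mul[OF P _ assms(2)])

lemma dlt_Vs: assumes P: "pol S P" shows "dlt P \<in> Vs S P"
  unfolding Vs_def dlt_def using mem_mul_left[OF P] f_mul[OF P] by auto

lemma dlt_right: assumes P: "pol S P" and "x \<in> P" "g \<in> S" shows "dlt P (g \<star> x) = dlt P g * f x"
  unfolding dlt_def using mem_mul_right[OF P assms(2,3)] f_mul[OF P _ assms(2)] by auto

lemma dlt_zero: "pol S P \<Longrightarrow> dlt P \<zero> = 1"
  using subringD(3)[OF polD(1)] by (auto simp: dlt_def)

text \<open>Left translations commute with right ones, so the image of \<open>dlt P\<close> is
  equivariant on both sides and is a multiple of \<open>dlt P\<close> by \<open>clean_pol\<close>.
  The right translates of \<open>dlt P\<close> span \<open>Vs S P\<close>, which carries the scalar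
  over to every \<open>\<phi>\<close>.\<close>

theorem schur:
  assumes P: "pol S P" and k: "\<And>i. i \<in> I \<Longrightarrow> k i \<in> S"
    and maps: "(\<lambda>g. \<Sum>i\<in>I. w i * dlt P (k i \<star> g)) \<in> Vs S P"
    and \<phi>: "\<phi> \<in> Vs S P" and g: "g \<in> S"
  shows "(\<Sum>i\<in>I. w i * \<phi> (k i \<star> g)) = (\<Sum>i\<in>I. w i * dlt P (k i)) * \<phi> g"
proof -
  note P' = subringD[OF polD(1)[OF P]]
  define K where "K g = (\<Sum>i\<in>I. w i * dlt P (k i \<star> g))" for g
  have Kl: "K (x \<star> g) = f x * K g" if "x \<in> P" "g \<in> S" for x g
    using VsD[OF maps that] by (simp add: K_def)
  have Kr: "K (g \<star> x) = K g * f x" if "x \<in> P" "g \<in> S" for x g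
    unfolding K_def sum_distrib_right
  proof (rule sum.cong[OF refl])
    fix i assume i: "i \<in> I"
    have "k i \<star> (g \<star> x) = k i \<star> g \<star> x"
      using S'(4) k[OF i] that P'(4) by (simp add: mul_assoc)
    then show "w i * dlt P (k i \<star> (g \<star> x)) = w i * dlt P (k i \<star> g) * f x"
      using dlt_right[OF P that(1) mul_S[OF k[OF i] that(2)]] by simp
  qed
  have "bieq S P K"
    unfolding bieq_def using Kl Kr mul_S pol_S[OF P] by simp
  then have K0: "K g = 0" if "g \<in> S" "g \<notin> P" for g
    using clean_pol[OF S P] that unfolding clean_def by blast
  have K: "K g = K \<zero> * dlt P g" if "g \<in> S" for g
    using K0[OF that] Kl[of g \<zero>] S'(3) P'(4)[of g] by (auto simp: dlt_def)
  \<comment> \<open>Writes \<open>\<phi>\<close> through right translates of \<open>dlt P\<close>;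
    each coset representative is counted \<open>card P\<close> times.\<close>
  have expand: "of_nat (card P) * \<phi> h = (\<Sum>y\<in>S. \<phi> y * dlt P (h \<star> \<ominus> y))" if h: "h \<in> S" for h
  proof -
    note hc = S'(4)[OF h]
    have "(\<Sum>y\<in>S. \<phi> y * dlt P (h \<star> \<ominus> y)) = (\<Sum>y\<in>{y\<in>S. h \<star> \<ominus> y \<in> P}. \<phi> y * f (h \<star> \<ominus> y))"
      using finite_sub[OF S'(2)] by (simp add: dlt_def sum.inter_filter if_distrib cong: if_cong)
    also have "\<dots> = (\<Sum>x\<in>P. \<phi> (\<ominus> x \<star> h) * f x)"
      by (rule sum.reindex_bij_witness[of _ "\<lambda>x. \<ominus> x \<star> h" "\<lambda>y. h \<star> \<ominus> y"])
        (use hc h P' S' in \<open>auto simp: neg_mul mul_S pol_S[OF P] mul_assoc\<close>)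
    also have "\<dots> = (\<Sum>x\<in>P. \<phi> h)"
      using VsD[OF \<phi> pol_neg[OF P] h] pol_carr[OF P] by (intro sum.cong) (simp_all add: f_neg)
    finally show ?thesis by simp
  qed
  have cP: "(of_nat (card P) :: complex) \<noteq> 0"
    using finite_sub[OF P'(2)] P'(3) by auto
  have "of_nat (card P) * (\<Sum>i\<in>I. w i * \<phi> (k i \<star> g)) = (\<Sum>i\<in>I. w i * (of_nat (card P) * \<phi> (k i \<star> g)))"
    by (simp add: sum_distrib_left mult_ac)
  also have "\<dots> = (\<Sum>i\<in>I. \<Sum>y\<in>S. \<phi> y * (w i * dlt P (k i \<star> (g \<star> \<ominus> y))))"
  proof (rule sum.cong[OF refl])
    fix i assume i: "i \<in> I"
    have "w i * (of_nat (card P) * \<phi> (k i \<star> g)) = (\<Sum>y\<in>S. w i * (\<phi> y * dlt P (k i \<star> g \<star> \<ominus> y)))"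
      by (simp only: expand[OF mul_S[OF k[OF i] g]] sum_distrib_left)
    also have "\<dots> = (\<Sum>y\<in>S. \<phi> y * (w i * dlt P (k i \<star> (g \<star> \<ominus> y))))"
      using S'(4) k[OF i] g by (intro sum.cong) (simp_all add: mul_assoc)
    finally show "w i * (of_nat (card P) * \<phi> (k i \<star> g)) = (\<Sum>y\<in>S. \<phi> y * (w i * dlt P (k i \<star> (g \<star> \<ominus> y))))" .
  qed
  also have "\<dots> = (\<Sum>y\<in>S. \<phi> y * K (g \<star> \<ominus> y))"
    by (subst sum.swap) (simp add: K_def sum_distrib_left)
  also have "\<dots> = (\<Sum>y\<in>S. K \<zero> * (\<phi> y * dlt P (g \<star> \<ominus> y)))"
  proof (rule sum.cong[OF refl])
    fix y assume "y \<in> S"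
    then have "K (g \<star> \<ominus> y) = K \<zero> * dlt P (g \<star> \<ominus> y)" using g S'(6) mul_S by (intro K) blast
    then show "\<phi> y * K (g \<star> \<ominus> y) = K \<zero> * (\<phi> y * dlt P (g \<star> \<ominus> y))" by simp
  qed
  also have "\<dots> = K \<zero> * (of_nat (card P) * \<phi> g)"
    by (simp only: expand[OF g] sum_distrib_left)
  finally have "(\<Sum>i\<in>I. w i * \<phi> (k i \<star> g)) = K \<zero> * \<phi> g" using cP by simp
  moreover have "K \<zero> = (\<Sum>i\<in>I. w i * dlt P (k i))"
    using k S'(4) by (simp add: K_def)
  ultimately show ?thesis by simp
qed

end

section \<open>The scalars of pairs and triples of polarizations\<close>

context char_lie
begin

definition kap :: "'a set \<Rightarrow> 'a set \<Rightarrow> complex" where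
  "kap P Q = of_nat (card P) * of_nat (card (P \<inter> Q))"

text \<open>The innermost equivariance makes the sum over \<open>P\<close> constant, which leaves
  the factor \<open>card P\<close> in front.\<close>

definition tri :: "'a set \<Rightarrow> 'a set \<Rightarrow> 'a set \<Rightarrow> complex" where
  "tri P Q R = of_nat (card P) *
     (\<Sum>y\<in>Q. \<Sum>z\<in>R. if z \<star> y \<in> P then f (z \<star> y) * inverse (f y) * inverse (f z) else 0)"

text \<open>The value of \<open>tri\<close> on the Heisenberg Lie ring, up to a power of the order of its center.\<close>

definition tri_lin :: "'a set \<Rightarrow> 'a set \<Rightarrow> 'a set \<Rightarrow> complex" where
  "tri_lin P Q R = of_nat (card P) *
     (\<Sum>y\<in>Q. \<Sum>z\<in>R. if z \<oplus> y \<in> P then f ((1 / 2) \<bullet> \<lbrakk>z, y\<rbrakk>) else 0)"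

end

context step
begin

text \<open>With \<open>y\<close> decomposed along a multiple \<open>w\<close> of \<open>u\<close>,
  both membership conditions reduce to \<open>z \<oplus> w \<in> P\<close> and both summands to
  \<open>f\<close> of half of \<open>\<lbrakk>z, w\<rbrakk>\<close>.\<close>

lemma tri_pr:
  assumes P: "pol S P" and R: "pol S R"
  shows "tri P (pr P) R = tri_lin P (pr P) R"
  unfolding tri_def tri_lin_def
proof (rule arg_cong[where f = "(*) (of_nat (card P))"], intro sum.cong refl)
  fix y z assume y: "y \<in> pr P" and z: "z \<in> R"
  note P' = subringD[OF polD(1)[OF P]] and prp = pol_pr[OF P]
  note Q' = subringD[OF polD(1)[OF prp]]
  obtain k y0 y2 where y0: "y0 \<in> P" "y0 \<in> h" "y = y0 \<oplus> nsmul L k u" and y2: "y2 \<in> P" "y2 \<in> h" "y = nsmul L k u \<star> y2"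
    using pr_decomp[OF P y] by metis
  define w where "w = nsmul L k u"
  have w: "w \<in> W" "w \<in> pr P"
    unfolding w_def by (rule nsmul_u_W, rule subgroup_nsmul[OF Q'(1) pr_gen(1)])
  have zS: "z \<in> S" using z polD(2)[OF R] by blast
  note c = S'(4)[OF zS] P'(4)[OF y0(1)] P'(4)[OF y2(1)] Q'(4)[OF w(2)] Q'(4)[OF y]
  have zw: "\<lbrakk>z, w\<rbrakk> \<in> Z" by (rule W_br[OF zS w(1)])
  define t where "t = (1 / 2) \<bullet> \<lbrakk>z, w\<rbrakk>"
  obtain r where r: "r \<in> n" "z \<star> w = z \<oplus> w \<oplus> t \<oplus> r"
    using mul_W[OF zS W_S[OF w(1)] zw] t_def by blast
  have tr: "t \<oplus> r \<in> P" unfolding t_def by (intro Z_P[OF P] Z' subgroup_rsm[OF Z_sub zw] n_Z r)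
  have tc: "t \<in> carr" unfolding t_def using c by simp
  note rc = n'(3)[OF r(1)]
  have e: "z \<star> w = z \<oplus> w \<oplus> (t \<oplus> r)" using r c tc rc by (simp add: add_assoc)
  have canc: "a \<oplus> b \<in> P \<longleftrightarrow> a \<in> P" if "a \<in> carr" "b \<in> P" for a b
  proof
    assume "a \<oplus> b \<in> P"
    then have "a \<oplus> b \<oplus> \<ominus> b \<in> P" by (rule P'(5)[OF _ P'(6)[OF that(2)]])
    then show "a \<in> P" using that P'(4)[OF that(2)] by (simp add: add_assoc)
  qed (rule P'(5)[OF _ that(2)])
  have zy: "z \<star> y = z \<star> w \<star> y2" using c y2(3) by (simp add: w_def mul_assoc)
  have m1: "z \<star> w \<star> y2 \<in> P \<longleftrightarrow> z \<star> w \<in> P"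
  proof
    assume "z \<star> w \<star> y2 \<in> P"
    then have "z \<star> w \<star> y2 \<star> \<ominus> y2 \<in> P" by (rule pol_mul[OF P _ P'(6)[OF y2(1)]])
    then show "z \<star> w \<in> P" using c by simp
  qed (rule pol_mul[OF P _ y2(1)])
  have m2: "z \<star> w \<in> P \<longleftrightarrow> z \<oplus> w \<in> P" unfolding e using c by (intro canc tr) simp
  have "z \<oplus> y = z \<oplus> w \<oplus> y0" using c y0(3) by (simp add: w_def add_ac)
  then have m3: "z \<oplus> y \<in> P \<longleftrightarrow> z \<oplus> w \<in> P" using canc[of "z \<oplus> w" y0] c y0 by simp
  show "(if z \<star> y \<in> P then f (z \<star> y) * inverse (f y) * inverse (f z) else 0) =
      (if z \<oplus> y \<in> P then f ((1 / 2) \<bullet> \<lbrakk>z, y\<rbrakk>) else 0)"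
  proof (cases "z \<oplus> w \<in> P")
    case True
    then have "f (z \<star> w \<star> y2) = f (z \<star> w) * f y2" using m2 f_mul[OF P _ y2(1)] by blast
    moreover have "f y = f w * f y2"
      using f_mul[OF prp w(2) pr_gen(2)[OF y2(1,2)]] y2(3) by (simp add: w_def)
    moreover have "f (z \<star> w) = f z * f w * f t"
      using c tc rc n_f[OF r(1)] by (simp add: e f_add)
    ultimately have 1: "f (z \<star> w \<star> y2) * inverse (f y) * inverse (f z) = f t"
      using c by (simp add: field_simps)
    \<comment> \<open>Shows that replacing \<open>w\<close> by \<open>y\<close> in the bracket is
      invisible to \<open>f\<close>: \<open>y0\<close> is orthogonal to \<open>z \<oplus> y\<close>
      inside \<open>P\<close> and to \<open>y\<close> inside \<open>pr P\<close>.\<close>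
    have "f \<lbrakk>z \<oplus> y, y0\<rbrakk> = 1" using True m3 polD(3)[OF P _ y0(1)] by blast
    moreover have "f \<lbrakk>y, y0\<rbrakk> = 1" by (rule polD(3)[OF prp y pr_gen(2)[OF y0(1,2)]])
    ultimately have "f \<lbrakk>z, y0\<rbrakk> = 1" using c by (simp add: br_add_left f_add)
    then have "f ((1 / 2) \<bullet> \<lbrakk>z, y0\<rbrakk>) = 1" using c by (simp add: f_rsm)
    moreover have "\<lbrakk>z, y\<rbrakk> = \<lbrakk>z, y0\<rbrakk> \<oplus> \<lbrakk>z, w\<rbrakk>" using c y0(3) by (simp add: w_def br_add_right)
    ultimately have "f ((1 / 2) \<bullet> \<lbrakk>z, y\<rbrakk>) = f t"
      using c by (simp add: rsm_add_right f_add t_def)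
    then show ?thesis using 1 True m1 m2 m3 zy by simp
  next
    case False
    then show ?thesis using m1 m2 m3 zy by simp
  qed
qed

end

context subring
begin

lemma T_cong: "pol S P \<Longrightarrow> (\<And>g. g \<in> S \<Longrightarrow> \<phi> g = \<psi> g) \<Longrightarrow> g \<in> S \<Longrightarrow> T P \<phi> g = T P \<psi> g"
  unfolding T_def by (intro sum.cong refl) (simp add: mul_S pol_S)

lemma T_scale: "T P (\<lambda>g. c * \<phi> g) g = c * T P \<phi> g"
  by (simp add: T_def sum_distrib_left mult_ac)

lemma kap_nonzero: assumes "pol S P" "pol S Q" shows "kap P Q \<noteq> 0"
proof -
  have "\<zero> \<in> P \<inter> Q" using subringD(3)[OF polD(1)] assms by blast
  moreover have "finite P" using finite_sub polD(5) assms by blast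
  ultimately show ?thesis by (auto simp: kap_def)
qed

lemma T_T:
  assumes P: "pol S P" and Q: "pol S Q" and \<phi>: "\<phi> \<in> Vs S P" and g: "g \<in> S"
  shows "T P (T Q \<phi>) g = kap P Q * \<phi> g"
proof -
  define w where "w = (\<lambda>(x, y). inverse (f x) * inverse (f y))"
  define k where "k = (\<lambda>(x, y). y \<star> x)"
  have k: "k i \<in> S" if "i \<in> P \<times> Q" for i
    using that pol_S[OF P] pol_S[OF Q] mul_S by (auto simp: k_def)
  have TT: "T P (T Q \<psi>) g = (\<Sum>i\<in>P \<times> Q. w i * \<psi> (k i \<star> g))" if "g \<in> S" for \<psi> g
  proof -
    have "T P (T Q \<psi>) g = (\<Sum>x\<in>P. \<Sum>y\<in>Q. inverse (f x) * inverse (f y) * \<psi> (y \<star> x \<star> g))"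
      unfolding T_def sum_distrib_left using pol_carr[OF P] pol_carr[OF Q] S'(4)[OF that]
      by (intro sum.cong refl) (simp add: mul_assoc mult.assoc)
    then show ?thesis by (simp add: sum.cartesian_product w_def k_def split_def)
  qed
  have maps: "(\<lambda>g. \<Sum>i\<in>P \<times> Q. w i * dlt P (k i \<star> g)) \<in> Vs S P"
    unfolding Vs_def
  proof (intro CollectI ballI)
    fix x g assume x: "x \<in> P" and g: "g \<in> S"
    show "(\<Sum>i\<in>P \<times> Q. w i * dlt P (k i \<star> (x \<star> g))) = f x * (\<Sum>i\<in>P \<times> Q. w i * dlt P (k i \<star> g))"
      using VsD[OF T_Vs[OF S P] x g, of "T Q (dlt P)"] by (simp only: TT mul_S pol_S[OF P x] g)
  qed
  have "T P (T Q \<phi>) g = (\<Sum>i\<in>P \<times> Q. w i * dlt P (k i)) * \<phi> g"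
    unfolding TT[OF g] by (rule schur[OF P k maps \<phi> g])
  also have "(\<Sum>i\<in>P \<times> Q. w i * dlt P (k i)) = (\<Sum>x\<in>P. \<Sum>y\<in>Q. if y \<in> P then 1 else 0)"
    unfolding sum.cartesian_product
  proof (rule sum.cong[OF refl], clarify)
    fix x y assume x: "x \<in> P" and y: "y \<in> Q"
    show "w (x, y) * dlt P (k (x, y)) = (if y \<in> P then 1 else 0)"
      using mem_mul_right[OF P x pol_S[OF Q y]] f_mul[OF P _ x, of y] pol_carr[OF P x] pol_carr[OF Q y]
      by (simp add: w_def k_def dlt_def field_simps)
  qed
  also have "\<dots> = kap P Q"
    using finite_sub[OF polD(5)[OF Q]] by (simp add: kap_def sum.If_cases Int_commute)
  finally show ?thesis .
qed

lemma T_T_T: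
  assumes P: "pol S P" and Q: "pol S Q" and R: "pol S R" and \<phi>: "\<phi> \<in> Vs S P" and g: "g \<in> S"
  shows "T P (T Q (T R \<phi>)) g = tri P Q R * \<phi> g"
proof -
  define w where "w = (\<lambda>(x, y, z). inverse (f x) * (inverse (f y) * inverse (f z)))"
  define k where "k = (\<lambda>(x, y, z). z \<star> (y \<star> x))"
  let ?I = "P \<times> Q \<times> R"
  have k: "k i \<in> S" if "i \<in> ?I" for i
    using that pol_S[OF P] pol_S[OF Q] pol_S[OF R] mul_S by (auto simp: k_def)
  have TT: "T P (T Q (T R \<psi>)) g = (\<Sum>i\<in>?I. w i * \<psi> (k i \<star> g))" if "g \<in> S" for \<psi> g
  proof -
    have "T P (T Q (T R \<psi>)) g = (\<Sum>x\<in>P. \<Sum>y\<in>Q. \<Sum>z\<in>R. inverse (f x) * (inverse (f y) * inverse (f z)) * \<psi> (z \<star> (y \<star> x) \<star> g))"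
      unfolding T_def sum_distrib_left using pol_carr[OF P] pol_carr[OF Q] pol_carr[OF R] S'(4)[OF that]
      by (intro sum.cong refl) (simp add: mul_assoc mult.assoc)
    then show ?thesis by (simp add: sum.cartesian_product w_def k_def split_def)
  qed
  have maps: "(\<lambda>g. \<Sum>i\<in>?I. w i * dlt P (k i \<star> g)) \<in> Vs S P"
    unfolding Vs_def
  proof (intro CollectI ballI)
    fix x g assume x: "x \<in> P" and g: "g \<in> S"
    show "(\<Sum>i\<in>?I. w i * dlt P (k i \<star> (x \<star> g))) = f x * (\<Sum>i\<in>?I. w i * dlt P (k i \<star> g))"
      using VsD[OF T_Vs[OF S P] x g, of "T Q (T R (dlt P))"] by (simp only: TT mul_S pol_S[OF P x] g)
  qed
  have "T P (T Q (T R \<phi>)) g = (\<Sum>i\<in>?I. w i * dlt P (k i)) * \<phi> g"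
    unfolding TT[OF g] by (rule schur[OF P k maps \<phi> g])
  also have "(\<Sum>i\<in>?I. w i * dlt P (k i)) = (\<Sum>x\<in>P. \<Sum>y\<in>Q. \<Sum>z\<in>R. w (x, y, z) * dlt P (k (x, y, z)))"
    by (simp add: sum.cartesian_product split_def)
  also have "\<dots> = (\<Sum>x\<in>P. \<Sum>y\<in>Q. \<Sum>z\<in>R. if z \<star> y \<in> P then f (z \<star> y) * inverse (f y) * inverse (f z) else 0)"
  proof (intro sum.cong refl)
    fix x y z assume x: "x \<in> P" and y: "y \<in> Q" and z: "z \<in> R"
    note c = pol_carr[OF P x] pol_carr[OF Q y] pol_carr[OF R z]
    have "k (x, y, z) = z \<star> y \<star> x" using c by (simp add: k_def mul_assoc)
    then show "w (x, y, z) * dlt P (k (x, y, z)) = (if z \<star> y \<in> P then f (z \<star> y) * inverse (f y) * inverse (f z) else 0)"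
      using dlt_right[OF P x mul_S[OF pol_S[OF R z] pol_S[OF Q y]]] c by (simp add: w_def dlt_def)
  qed
  also have "\<dots> = tri P Q R" by (simp add: tri_def)
  finally show ?thesis .
qed

text \<open>In \<open>T P (T R (T P (T Q (T R _))))\<close> either the outer two operators or the
  middle three are replaced by their scalar.\<close>

lemma tri_cyclic:
  assumes P: "pol S P" and Q: "pol S Q" and R: "pol S R"
  shows "tri R P Q = tri P Q R"
proof -
  note z = S'(3) and TV = T_Vs[OF S]
  note d = dlt_Vs[OF P]
  have "T P (T R (T P (T Q (T R (dlt P))))) \<zero> = T P (\<lambda>g. tri R P Q * T R (dlt P) g) \<zero>"
    by (rule T_cong[OF P _ z]) (rule T_T_T[OF R P Q TV[OF R]])
  also have "\<dots> = tri R P Q * kap P R"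
    by (simp add: T_scale T_T[OF P R d z] dlt_zero[OF P])
  finally have 1: "T P (T R (T P (T Q (T R (dlt P))))) \<zero> = tri R P Q * kap P R" .
  have "T P (T R (T P (T Q (T R (dlt P))))) \<zero> = kap P R * T P (T Q (T R (dlt P))) \<zero>"
    by (rule T_T[OF P R TV[OF P] z])
  also have "\<dots> = kap P R * tri P Q R"
    by (simp add: T_T_T[OF P Q R d z] dlt_zero[OF P])
  finally show ?thesis using 1 kap_nonzero[OF P R] by simp
qed

text \<open>Each averaging operator has a left inverse up to the nonzero scalar \<open>kap\<close>,
  so a composition of three of them cannot vanish.\<close>

lemma tri_nonzero:
  assumes P: "pol S P" and Q: "pol S Q" and R: "pol S R"
  shows "tri P Q R \<noteq> 0"
proof
  assume 0: "tri P Q R = 0"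
  note z = S'(3) and TV = T_Vs[OF S] and d = dlt_Vs[OF P]
  have "kap Q P * T Q (T R (dlt P)) g = 0" if g: "g \<in> S" for g
  proof -
    have "kap Q P * T Q (T R (dlt P)) g = T Q (T P (T Q (T R (dlt P)))) g"
      by (rule T_T[OF Q P TV[OF Q] g, symmetric])
    also have "\<dots> = T Q (\<lambda>g. 0) g"
      by (rule T_cong[OF Q _ g]) (simp add: T_T_T[OF P Q R d] 0)
    finally show ?thesis by (simp add: T_def)
  qed
  then have 1: "T Q (T R (dlt P)) g = 0" if "g \<in> S" for g using that kap_nonzero[OF Q P] by simp
  have 2: "T R (dlt P) g = 0" if g: "g \<in> S" for g
  proof -
    have "kap R Q * T R (dlt P) g = T R (T Q (T R (dlt P))) g"
      by (rule T_T[OF R Q TV[OF R] g, symmetric])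
    also have "\<dots> = T R (\<lambda>g. 0) g" by (rule T_cong[OF R 1 g])
    finally show ?thesis using kap_nonzero[OF R Q] by (simp add: T_def)
  qed
  have "kap P R * dlt P \<zero> = T P (T R (dlt P)) \<zero>" by (rule T_T[OF P R d z, symmetric])
  also have "\<dots> = T P (\<lambda>g. 0) \<zero>" by (rule T_cong[OF P 2 z])
  finally show False using kap_nonzero[OF P R] dlt_zero[OF P] by (simp add: T_def)
qed

text \<open>The two sides are the two ways of inserting a scalar \<open>T T\<close> into the fourfold composition
  \<open>T P\<^sub>1 (T P\<^sub>2 (T P\<^sub>3 (T P\<^sub>4 \<phi>)))\<close>.\<close>

theorem tri_cocycle:
  assumes P1: "pol S P1" and P2: "pol S P2" and P3: "pol S P3" and P4: "pol S P4"
  shows "tri P1 P2 P3 * tri P1 P3 P4 * kap P2 P4 = tri P2 P3 P4 * tri P1 P2 P4 * kap P3 P1"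
proof -
  note z = S'(3) and TV = T_Vs[OF S] and d = dlt_Vs[OF P1]
  define X where "X = T P1 (T P2 (T P3 (T P4 (dlt P1)))) \<zero>"
  have "T P1 (T P2 (T P3 (T P1 (T P3 (T P4 (dlt P1)))))) \<zero> = tri P1 P2 P3 * T P1 (T P3 (T P4 (dlt P1))) \<zero>"
    by (rule T_T_T[OF P1 P2 P3 TV[OF P1] z])
  also have "\<dots> = tri P1 P2 P3 * tri P1 P3 P4"
    by (simp add: T_T_T[OF P1 P3 P4 d z] dlt_zero[OF P1])
  finally have 1: "T P1 (T P2 (T P3 (T P1 (T P3 (T P4 (dlt P1)))))) \<zero> = tri P1 P2 P3 * tri P1 P3 P4" .
  have "T P1 (T P2 (T P3 (T P1 (T P3 (T P4 (dlt P1)))))) \<zero> = T P1 (\<lambda>g. kap P3 P1 * T P2 (T P3 (T P4 (dlt P1))) g) \<zero>"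
  proof (rule T_cong[OF P1 _ z])
    fix g assume g: "g \<in> S"
    have "T P2 (T P3 (T P1 (T P3 (T P4 (dlt P1))))) g = T P2 (\<lambda>g. kap P3 P1 * T P3 (T P4 (dlt P1)) g) g"
      by (rule T_cong[OF P2 _ g]) (rule T_T[OF P3 P1 TV[OF P3]])
    then show "T P2 (T P3 (T P1 (T P3 (T P4 (dlt P1))))) g = kap P3 P1 * T P2 (T P3 (T P4 (dlt P1))) g"
      by (simp add: T_scale)
  qed
  then have A: "tri P1 P2 P3 * tri P1 P3 P4 = kap P3 P1 * X" using 1 by (simp add: T_scale X_def)
  have "T P1 (T P2 (T P4 (T P2 (T P3 (T P4 (dlt P1)))))) \<zero> = T P1 (\<lambda>g. kap P2 P4 * T P2 (T P3 (T P4 (dlt P1))) g) \<zero>"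
    by (rule T_cong[OF P1 _ z]) (rule T_T[OF P2 P4 TV[OF P2]])
  then have 2: "T P1 (T P2 (T P4 (T P2 (T P3 (T P4 (dlt P1)))))) \<zero> = kap P2 P4 * X"
    by (simp add: T_scale X_def)
  have "T P1 (T P2 (T P4 (T P2 (T P3 (T P4 (dlt P1)))))) \<zero> = T P1 (\<lambda>g. tri P4 P2 P3 * T P2 (T P4 (dlt P1)) g) \<zero>"
  proof (rule T_cong[OF P1 _ z])
    fix g assume g: "g \<in> S"
    have "T P2 (T P4 (T P2 (T P3 (T P4 (dlt P1))))) g = T P2 (\<lambda>g. tri P4 P2 P3 * T P4 (dlt P1) g) g"
      by (rule T_cong[OF P2 _ g]) (rule T_T_T[OF P4 P2 P3 TV[OF P4]])
    then show "T P2 (T P4 (T P2 (T P3 (T P4 (dlt P1))))) g = tri P4 P2 P3 * T P2 (T P4 (dlt P1)) g"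
      by (simp add: T_scale)
  qed
  also have "\<dots> = tri P4 P2 P3 * tri P1 P2 P4"
    by (simp add: T_scale T_T_T[OF P1 P2 P4 d z] dlt_zero[OF P1])
  finally have "kap P2 P4 * X = tri P2 P3 P4 * tri P1 P2 P4"
    using 2 tri_cyclic[OF P2 P3 P4] by simp
  then show ?thesis using A by (simp add: mult_ac)
qed

end

section \<open>The Heisenberg Lie ring of a character\<close>

context char_lie
begin

abbreviation Zs where "Zs \<equiv> zset L f"
abbreviation M where "M \<equiv> reduce L f"

lemma f_br_Zs: "x \<in> carr \<Longrightarrow> y \<in> carr \<Longrightarrow> f \<lbrakk>x, y\<rbrakk> \<in> Zs"
  by (auto simp: zset_def)

text \<open>A set of values of a biadditive form need not be a group a priori. Here a value
  \<open>b\<close> of largest order already has all its powers among the values, as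
  \<open>f \<lbrakk>x, nsmul L m y\<rbrakk>\<close>, and these are all roots of unity of the given
  exponent.\<close>

lemma zset_roots: "\<exists>j. Zs = {w. w ^ p ^ j = 1}"
proof -
  define j where "j = (LEAST i. \<forall>b\<in>Zs. b ^ p ^ i = 1)"
  obtain k where k: "card carr = p ^ k" using card_carr by blast
  have "f x ^ p ^ k = 1" if "x \<in> carr" for x
    using nsmul_card[OF fin that] f_nsmul[OF that, of "p ^ k"] by (simp add: k)
  then have "\<forall>b\<in>Zs. b ^ p ^ k = 1" by (auto simp: zset_def)
  then have j: "\<forall>b\<in>Zs. b ^ p ^ j = 1" unfolding j_def by (rule LeastI)
  have "w \<in> Zs" if w: "w ^ p ^ j = 1" for w
  proof (cases j)
    case 0
    then have "w = f \<lbrakk>\<zero>, \<zero>\<rbrakk>" using w by simp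
    then show ?thesis using f_br_Zs[of \<zero> \<zero>] by simp
  next
    case (Suc i)
    then have "\<not> (\<forall>b\<in>Zs. b ^ p ^ i = 1)"
      using not_less_Least[of i "\<lambda>i. \<forall>b\<in>Zs. b ^ p ^ i = 1"] by (simp add: j_def)
    then obtain b where b: "b \<in> Zs" "b ^ p ^ i \<noteq> 1" by blast
    then obtain m where m: "w = b ^ m"
      using root_of_unity_power[OF prime_p, of b i w] j w Suc by metis
    obtain x y where xy: "x \<in> carr" "y \<in> carr" "b = f \<lbrakk>x, y\<rbrakk>" using b by (auto simp: zset_def)
    then have "w = f \<lbrakk>x, nsmul L m y\<rbrakk>" using m by (simp add: nsmul_br f_nsmul)
    then show ?thesis using xy f_br_Zs[of x "nsmul L m y"] by simp
  qed
  then show ?thesis using j by blast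
qed

lemma card_Zs: "\<exists>j. card Zs = p ^ j" and fin_Zs: "finite Zs" and one_Zs: "1 \<in> Zs"
  and mult_Zs: "a \<in> Zs \<Longrightarrow> b \<in> Zs \<Longrightarrow> a * b \<in> Zs"
  and inverse_Zs: "a \<in> Zs \<Longrightarrow> inverse a \<in> Zs" and nz_Zs: "a \<in> Zs \<Longrightarrow> a \<noteq> 0"
proof -
  obtain j where j: "Zs = {w. w ^ p ^ j = 1}" using zset_roots by blast
  have pos: "0 < p ^ j" using prime_gt_0_nat[OF prime_p] by simp
  show "\<exists>j. card Zs = p ^ j" using card_roots_unity_eq[OF pos] j by auto
  show "finite Zs" unfolding j by (rule finite_nth_roots[OF pos])
  show "1 \<in> Zs" by (simp add: j)
  show "a \<in> Zs \<Longrightarrow> b \<in> Zs \<Longrightarrow> a * b \<in> Zs" by (simp add: j power_mult_distrib)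
  show "a \<in> Zs \<Longrightarrow> inverse a \<in> Zs" by (simp add: j power_inverse)
  show "a \<in> Zs \<Longrightarrow> a \<noteq> 0" using pos by (auto simp: j power_0_left)
qed

lemma M_simps [simp]:
  "lcarrier M = carr \<times> Zs" "lzero M = (\<zero>, 1)"
  "ladd M (x, a) (y, b) = (x \<oplus> y, a * b)" "lneg M (x, a) = (\<ominus> x, inverse a)"
  "lbr M (x, a) (y, b) = (\<zero>, f \<lbrakk>x, y\<rbrakk>)"
  by (simp_all add: reduce_def)

lemma reduce_char_Pair [simp]: "reduce_char (x, a) = a"
  by (simp add: reduce_char_def)

lemma lie_M: "lie_ring M"
  unfolding lie_ring_def
  by (auto simp: one_Zs mult_Zs inverse_Zs nz_Zs f_br_Zs add_ac br_add_left br_add_right f_add)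

lemma nilp_M: "nilpotent_class_less M p"
proof -
  have fst0: "fst y = \<zero>" if "y \<in> lcs M (Suc k)" for y k
  proof -
    have "y \<in> lspan M {lbr M x y |x y. x \<in> lcarrier M \<and> y \<in> lcs M k}" using that by simp
    then show ?thesis
    proof induction
      case (gen x)
      then show ?case by (auto simp: reduce_def)
    qed (simp_all add: reduce_def split_def)
  qed
  have "y = (\<zero>, 1)" if "y \<in> lcs M (Suc (Suc k))" for y k
  proof -
    have "y \<in> lspan M {lbr M x y |x y. x \<in> lcarrier M \<and> y \<in> lcs M (Suc k)}"
      using that by (simp only: lcs.simps)
    then show ?thesis
    proof induction
      case (gen x)
      then obtain a b where "x = lbr M a b" "a \<in> lcarrier M" "fst b = \<zero>" using fst0 by blast
      then show ?case by (cases a; cases b) simp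
    qed simp_all
  qed
  moreover have "lzero M \<in> lcs M (Suc (Suc k))" for k
    unfolding lcs.simps by (rule lspan.zero)
  ultimately have "lcs M (Suc (Suc k)) = {lzero M}" for k by fastforce
  \<comment> \<open>Triple brackets vanish in the reduced ring; this is enough because
    \<open>p\<close> is at least three.\<close>
  moreover have "p - 1 = Suc (Suc (p - 3))" using p_ge_3 by simp
  ultimately show ?thesis unfolding nilpotent_class_less_def by metis
qed

lemma char_lie_M: "char_lie M p reduce_char"
proof unfold_locales
  show "lie_ring M" by (rule lie_M)
  show "prime p" by (rule prime_p)
  show "finite (lcarrier M)" using fin fin_Zs by simp
  obtain k j where "card carr = p ^ k" "card Zs = p ^ j" using card_carr card_Zs by blast
  then have "card (lcarrier M) = p ^ (k + j)" by (simp add: card_cartesian_product power_add)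
  then show "\<exists>k. card (lcarrier M) = p ^ k" by blast
  show "nilpotent_class_less M p" by (rule nilp_M)
  show "odd p" by (rule odd_p)
  show "is_char M reduce_char"
    by (auto simp: is_char_def nz_Zs)
qed

text \<open>The scalar in \<open>alpha\<close> is unique because the induced space contains
  \<open>dlt P\<close>, whose value at \<open>\<zero>\<close> is \<open>1\<close>. The normalizing
  factors separate from the operators.\<close>

lemma alpha_tri:
  assumes P: "pol carr P" and Q: "pol carr Q" and R: "pol carr R"
  shows "alpha L p f P Q R =
    complex_of_real (1 / sqrt (real (card P * card (P \<inter> Q)))) *
    (complex_of_real (1 / sqrt (real (card Q * card (Q \<inter> R)))) *
    (complex_of_real (1 / sqrt (real (card R * card (R \<inter> P)))) * tri P Q R))"
    (is "_ = ?c1 * (?c2 * (?c3 * _))")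
proof -
  interpret SL: subring L p f carr
    by unfold_locales (simp add: lie_subring_def add_subgroup_def)
  have V: "Vspace L p f P = Vs carr P" by (simp add: Vspace_def Vs_def)
  have Phi: "Phi L p f X Y \<phi> = (\<lambda>g. complex_of_real (1 / sqrt (real (card X * card (X \<inter> Y)))) * T X \<phi> g)" for X Y \<phi>
    by (simp add: Phi_def T_def)
  have 1: "Phi L p f P Q (Phi L p f Q R (Phi L p f R P \<phi>)) g = ?c1 * (?c2 * (?c3 * tri P Q R)) * \<phi> g"
    if "\<phi> \<in> Vs carr P" "g \<in> carr" for \<phi> g
  proof -
    have "Phi L p f P Q (Phi L p f Q R (Phi L p f R P \<phi>)) g = ?c1 * (?c2 * (?c3 * T P (T Q (T R \<phi>)) g))"
      unfolding Phi SL.T_scale by (simp only: SL.T_scale)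
    then show ?thesis by (simp add: SL.T_T_T[OF P Q R that])
  qed
  show ?thesis
    unfolding alpha_def V
  proof (rule the_equality)
    show "\<forall>\<phi>\<in>Vs carr P. \<forall>g\<in>carr. Phi L p f P Q (Phi L p f Q R (Phi L p f R P \<phi>)) g =
        ?c1 * (?c2 * (?c3 * tri P Q R)) * \<phi> g"
      using 1 by blast
    fix c assume "\<forall>\<phi>\<in>Vs carr P. \<forall>g\<in>carr. Phi L p f P Q (Phi L p f Q R (Phi L p f R P \<phi>)) g = c * \<phi> g"
    then have "Phi L p f P Q (Phi L p f Q R (Phi L p f R P (dlt P))) \<zero> = c * dlt P \<zero>"
      using SL.dlt_Vs[OF P] closed(1) by blast
    then show "c = ?c1 * (?c2 * (?c3 * tri P Q R))"
      using 1[OF SL.dlt_Vs[OF P] closed(1)] SL.dlt_zero[OF P] by simp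
  qed
qed

end

text \<open>Kept apart from \<open>char_lie\<close>, since the reduced ring is again an instance of
  \<open>char_lie\<close> and could be reduced again without end.\<close>

locale heis = char_lie

sublocale heis \<subseteq> H: char_lie "reduce L f" p reduce_char
  by (rule char_lie_M)

section \<open>Comparison of the two scalars\<close>

context heis
begin

lemma square_root_unique:
  fixes a b :: complex
  assumes "a * a = b * b" "a ^ p ^ i = 1" "b ^ p ^ i = 1"
  shows "a = b"
proof -
  have b: "b \<noteq> 0" using assms(3) prime_gt_0_nat[OF prime_p] by (auto simp: power_0_left)
  have "(a / b) ^ 2 = 1" using assms(1) b by (simp add: power2_eq_square)
  moreover have "(a / b) ^ p ^ i = 1" using assms by (simp add: power_divide)
  ultimately have "(a / b) ^ gcd 2 (p ^ i) = 1" by (rule power_gcd_eq_1)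
  moreover have "gcd 2 (p ^ i) = 1" using odd_p by (simp add: coprime_iff_gcd_eq_1[symmetric])
  ultimately show ?thesis using b by simp
qed

text \<open>The scalar \<open>1 / 2\<close> is taken modulo different group orders in
  \<open>M\<close> and in \<open>L\<close>. Both results are square roots of
  \<open>f \<lbrakk>x, y\<rbrakk>\<close> in a group of odd order, hence equal.\<close>

lemma half_M:
  assumes "x \<in> carr" "y \<in> carr"
  shows "rat_smul M (1 / 2) (\<zero>, f \<lbrakk>x, y\<rbrakk>) = (\<zero>, f ((1 / 2) \<bullet> \<lbrakk>x, y\<rbrakk>))"
proof -
  have n: "nsmul M n (\<zero>, c) = (\<zero>, c ^ n)" for n c
    by (induction n) (simp_all add: H.nsmul_Suc)
  obtain i where i: "Zs = {w. w ^ p ^ i = 1}" using zset_roots by blast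
  define c where "c = f \<lbrakk>x, y\<rbrakk> ^ H.res (1 / 2)"
  have cM: "(\<zero>, f \<lbrakk>x, y\<rbrakk>) \<in> lcarrier M" using f_br_Zs[OF assms] by simp
  have r: "rat_smul M (1 / 2) (\<zero>, f \<lbrakk>x, y\<rbrakk>) = (\<zero>, c)"
    unfolding H.rat_smul_res n c_def ..
  then have a1: "c \<in> Zs" using H.rsm_closed[OF cM, of "1 / 2"] by simp
  have a2: "c * c = f \<lbrakk>x, y\<rbrakk>" using H.half_double[OF cM] r by simp
  have a3: "f ((1 / 2) \<bullet> \<lbrakk>x, y\<rbrakk>) \<in> Zs"
    using f_br_Zs[of x "(1 / 2) \<bullet> y"] assms by (simp add: rsm_br)
  have a4: "f ((1 / 2) \<bullet> \<lbrakk>x, y\<rbrakk>) * f ((1 / 2) \<bullet> \<lbrakk>x, y\<rbrakk>) = f \<lbrakk>x, y\<rbrakk>"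
    using assms by (intro f_half) simp
  have "c = f ((1 / 2) \<bullet> \<lbrakk>x, y\<rbrakk>)"
  proof (rule square_root_unique[of _ _ i])
    show "c * c = f ((1 / 2) \<bullet> \<lbrakk>x, y\<rbrakk>) * f ((1 / 2) \<bullet> \<lbrakk>x, y\<rbrakk>)" unfolding a2 a4 ..
    show "c ^ p ^ i = 1" "f ((1 / 2) \<bullet> \<lbrakk>x, y\<rbrakk>) ^ p ^ i = 1" using a1 a3 unfolding i by blast+
  qed
  then show ?thesis using r by simp
qed

lemma mul_M:
  assumes "x \<in> carr" "y \<in> carr" "a \<in> Zs" "b \<in> Zs"
  shows "exp_mul M p (x, a) (y, b) = (x \<oplus> y, a * b * f ((1 / 2) \<bullet> \<lbrakk>x, y\<rbrakk>))"
proof -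
  have z: "(x, a) \<in> lcarrier M" "(y, b) \<in> lcarrier M" using assms by simp_all
  let ?B = "{\<zero>} \<times> Zs"
  have B: "add_subgroup M ?B"
    by (auto simp: add_subgroup_def one_Zs mult_Zs inverse_Zs)
  have "\<exists>r\<in>{lzero M}. exp_mul M p (x, a) (y, b) =
      ladd M (ladd M (ladd M (x, a) (y, b)) (rat_smul M (1 / 2) (lbr M (x, a) (y, b)))) r"
  proof (rule H.mul_expand[OF z])
    show "add_subgroup M {lzero M}" by (simp add: add_subgroup_def one_Zs)
    fix w assume w: "set w \<subseteq> {(x, a), (y, b)}" "3 \<le> length w"
    then obtain c w' where w': "w = c # w'" by (cases w) auto
    have "nest M w' \<in> ?B"
      by (rule H.nest_subset[OF _ _ z B]) (use w w' assms in \<open>auto simp: f_br_Zs one_Zs\<close>)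
    moreover have "c \<in> lcarrier M" using w w' z by auto
    moreover have "w' \<noteq> []" using w w' by auto
    ultimately show "nest M w \<in> {lzero M}"
      unfolding w' by (subst H.nest_Cons) auto
  qed
  then show ?thesis using assms half_M[of x y] by (simp add: f_br_Zs)
qed

lemma subring_M: assumes "lie_subring L S" shows "lie_subring M (S \<times> Zs)"
proof -
  note S' = subringD[OF assms]
  show ?thesis
    unfolding lie_subring_def add_subgroup_def
    using S'(4) by (auto simp: one_Zs mult_Zs inverse_Zs f_br_Zs S')
qed

text \<open>The bracket of \<open>M\<close> sees only first components, so a larger isotropic group
  projects to an isotropic group of \<open>S\<close>, which can only be \<open>P\<close>.\<close>

lemma pol_M:
  assumes S: "lie_subring L S" and P: "pol S P"
  shows "H.pol (S \<times> Zs) (P \<times> Zs)"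
  unfolding H.pol_def
proof (intro conjI allI impI)
  show "lie_subring M (P \<times> Zs)" by (rule subring_M[OF polD(1)[OF P]])
  show "P \<times> Zs \<subseteq> S \<times> Zs" using polD(2)[OF P] by blast
  show "H.isotropic (P \<times> Zs)"
    using polD(3)[OF P] by (auto simp: H.isotropic_def)
  fix Q assume Q: "add_subgroup M Q \<and> Q \<subseteq> S \<times> Zs \<and> P \<times> Zs \<subseteq> Q \<and> H.isotropic Q"
  have QM: "\<And>x. x \<in> Q \<Longrightarrow> fst x \<in> carr" using Q subringD(4)[OF S] by auto
  have "fst ` Q = P"
  proof -
    have sub: "add_subgroup L (fst ` Q)"
      unfolding add_subgroup_def
    proof (intro conjI ballI)
      show "fst ` Q \<subseteq> carr" using QM by blast
      have "lzero M \<in> Q" using Q by (auto simp: add_subgroup_def)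
      then show "\<zero> \<in> fst ` Q" by force
      fix x assume "x \<in> fst ` Q"
      then obtain a where a: "(x, a) \<in> Q" by auto
      then have "lneg M (x, a) \<in> Q" using Q by (auto simp: add_subgroup_def simp del: M_simps)
      then show "\<ominus> x \<in> fst ` Q" by force
      fix y assume "y \<in> fst ` Q"
      then obtain b where b: "(y, b) \<in> Q" by auto
      have "ladd M (x, a) (y, b) \<in> Q" using a b Q by (auto simp: add_subgroup_def simp del: M_simps)
      then show "x \<oplus> y \<in> fst ` Q" by force
    qed
    have iso: "isotropic (fst ` Q)"
      using Q unfolding isotropic_def H.isotropic_def by force
    have "fst ` Q \<subseteq> S" using Q by auto
    moreover have "P \<subseteq> fst ` Q"
    proof
      fix x assume "x \<in> P"
      then have "(x, 1) \<in> Q" using Q one_Zs by auto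
      then show "x \<in> fst ` Q" by force
    qed
    ultimately show ?thesis using P sub iso unfolding pol_def by blast
  qed
  then show "Q = P \<times> Zs" using Q by force
qed

abbreviation \<zeta> :: complex where "\<zeta> \<equiv> of_nat (card Zs)"

lemma zeta_nonzero: "\<zeta> \<noteq> 0"
  using fin_Zs one_Zs by auto

lemma kap_M: "H.kap (P \<times> Zs) (Q \<times> Zs) = \<zeta> ^ 2 * kap P Q"
  by (simp add: H.kap_def kap_def card_cartesian_product Times_Int_Times power2_eq_square)

text \<open>The central components cancel in every summand; \<open>card P\<close> and the two sums
  contribute one factor \<open>\<zeta>\<close> each.\<close>

lemma tri_M:
  assumes "P \<subseteq> carr" "Q \<subseteq> carr" "R \<subseteq> carr"
  shows "H.tri (P \<times> Zs) (Q \<times> Zs) (R \<times> Zs) = \<zeta> ^ 3 * tri_lin P Q R"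
proof -
  let ?F = "\<lambda>y z. if z \<oplus> y \<in> P then f ((1 / 2) \<bullet> \<lbrakk>z, y\<rbrakk>) else 0"
  have "(\<Sum>y\<in>Q \<times> Zs. \<Sum>z\<in>R \<times> Zs. if exp_mul M p z y \<in> P \<times> Zs
      then reduce_char (exp_mul M p z y) * inverse (reduce_char y) * inverse (reduce_char z) else 0) =
      (\<Sum>y\<in>Q \<times> Zs. \<Sum>z\<in>R \<times> Zs. ?F (fst y) (fst z))"
  proof (intro sum.cong refl)
    fix y z assume mem: "y \<in> Q \<times> Zs" "z \<in> R \<times> Zs"
    obtain y0 b z0 c where e: "y = (y0, b)" "z = (z0, c)" by (cases y; cases z)
    then have yz: "y = (y0, b)" "z = (z0, c)" "y0 \<in> carr" "z0 \<in> carr" "b \<in> Zs" "c \<in> Zs"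
      using assms mem by auto
    have "f ((1 / 2) \<bullet> \<lbrakk>z0, y0\<rbrakk>) \<in> Zs"
      using f_br_Zs[of z0 "(1 / 2) \<bullet> y0"] yz by (simp add: rsm_br)
    then show "(if exp_mul M p z y \<in> P \<times> Zs
        then reduce_char (exp_mul M p z y) * inverse (reduce_char y) * inverse (reduce_char z) else 0) =
        ?F (fst y) (fst z)"
      using yz nz_Zs[OF yz(5)] nz_Zs[OF yz(6)] by (simp add: mul_M mult_Zs field_simps)
  qed
  also have "\<dots> = (\<Sum>y\<in>Q. \<zeta> * (\<Sum>z\<in>R. \<zeta> * ?F y z))"
  proof -
    have "(\<Sum>y\<in>A \<times> Zs. F (fst y)) = (\<Sum>x\<in>A. \<zeta> * F x)" for A and F :: "'a \<Rightarrow> complex"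
      using sum.cartesian_product[of "\<lambda>x a. F x" Zs A] by (simp add: split_def)
    note this[of "\<lambda>y. \<Sum>z\<in>R \<times> Zs. ?F y (fst z)" Q] this[of "?F y" R for y]
    then show ?thesis by (simp only:)
  qed
  finally show ?thesis
    by (simp add: H.tri_def tri_lin_def card_cartesian_product sum_distrib_left power3_eq_cube mult_ac)
qed

theorem tri_eq_tri_lin:
  "lie_subring L S \<Longrightarrow> pol S P \<Longrightarrow> pol S Q \<Longrightarrow> pol S R \<Longrightarrow> tri P Q R = tri_lin P Q R"
proof (induction "card S" arbitrary: S P Q R rule: less_induct)
  case less
  note S = less.prems(1) and P = less.prems(2) and Q = less.prems(3) and R = less.prems(4)
  interpret SL: subring L p f S by unfold_locales (rule S)
  interpret SM: subring M p reduce_char "S \<times> Zs" by unfold_locales (rule subring_M[OF S])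
  show ?case
  proof (cases "isotropic S")
    case True
    have eq: "X = S" if "pol S X" for X
      using that True subringD(1)[OF S] unfolding pol_def by blast
    have PS: "pol S S" using P eq[OF P] by simp
    have "tri S S S = tri_lin S S S"
      unfolding tri_def tri_lin_def
    proof (rule arg_cong[where f = "(*) (of_nat (card S))"], intro sum.cong refl)
      fix y z assume y: "y \<in> S" and z: "z \<in> S"
      have c: "y \<in> carr" "z \<in> carr" using subringD(4)[OF S] y z by blast+
      have "f \<lbrakk>z, y\<rbrakk> = 1" by (rule polD(3)[OF PS z y])
      then show "(if z \<star> y \<in> S then f (z \<star> y) * inverse (f y) * inverse (f z) else 0) =
          (if z \<oplus> y \<in> S then f ((1 / 2) \<bullet> \<lbrakk>z, y\<rbrakk>) else 0)"
        using c f_mul[OF PS z y] subring_mul[OF S z y] subringD(5)[OF S z y]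
        by (simp add: f_rsm field_simps)
    qed
    then show ?thesis using eq[OF P] eq[OF Q] eq[OF R] by simp
  next
    case False
    then obtain n u where "good S n u" using exists_good[OF S] by blast
    then interpret step L p f S n u using S by unfold_locales
    have lin: "H.tri (X \<times> Zs) (Y \<times> Zs) (Y' \<times> Zs) = \<zeta> ^ 3 * tri_lin X Y Y'"
      if "pol S X" "pol S Y" "pol S Y'" for X Y Y'
      using that by (intro tri_M polD(5))
    have cyc: "tri_lin Y' X Y = tri_lin X Y Y'" if "pol S X" "pol S Y" "pol S Y'" for X Y Y'
      using SM.tri_cyclic[OF pol_M[OF S that(1)] pol_M[OF S that(2)] pol_M[OF S that(3)]]
        lin that zeta_nonzero by simp
    \<comment> \<open>The cocycle identity for \<open>X\<close>, \<open>pr X\<close>,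
      \<open>Y\<close>, \<open>Y'\<close> holds for \<open>tri\<close> and for
      \<open>tri_lin\<close>. Two of its four factors agree by \<open>tri_pr\<close>, a third by
      assumption, and cancelling nonzero scalars gives the fourth.\<close>
    have exch: "tri X Y Y' = tri_lin X Y Y'"
      if X: "pol S X" and Y: "pol S Y" and Y': "pol S Y'" and eq: "tri (pr X) Y Y' = tri_lin (pr X) Y Y'" for X Y Y'
    proof -
      note X' = pol_pr[OF X]
      have 1: "tri X (pr X) Y * tri X Y Y' * kap (pr X) Y' = tri (pr X) Y Y' * tri X (pr X) Y' * kap Y X"
        by (rule SL.tri_cocycle[OF X X' Y Y'])
      \<comment> \<open>On each side two triple scalars contribute \<open>\<zeta> ^ 3\<close> each
        and \<open>kap\<close> contributes \<open>\<zeta> ^ 2\<close>.\<close>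
      have "\<zeta> ^ 8 * (tri_lin X (pr X) Y * tri_lin X Y Y' * kap (pr X) Y') =
          \<zeta> ^ 8 * (tri_lin (pr X) Y Y' * tri_lin X (pr X) Y' * kap Y X)"
        using SM.tri_cocycle[OF pol_M[OF S X] pol_M[OF S X'] pol_M[OF S Y] pol_M[OF S Y']]
        by (simp add: lin X X' Y Y' kap_M) (simp add: eval_nat_numeral mult_ac)
      then have "tri X (pr X) Y * tri_lin X Y Y' * kap (pr X) Y' = tri (pr X) Y Y' * tri X (pr X) Y' * kap Y X"
        using zeta_nonzero eq tri_pr[OF X Y] tri_pr[OF X Y'] by simp
      with 1 have "tri X (pr X) Y * tri X Y Y' * kap (pr X) Y' = tri X (pr X) Y * tri_lin X Y Y' * kap (pr X) Y'"
        by (simp only:)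
      then show ?thesis
        using SL.tri_nonzero[OF X X' Y] SL.kap_nonzero[OF X' Y'] by simp
    qed
    have ph: "pol h (pr X)" if "pol S X" for X by (rule pol_h[OF pol_pr[OF that] pr_h[OF that]])
    have "card h < card S"
      by (rule psubset_card_mono[OF finite_sub[OF S'(2)] h_psubset])
    then have "tri (pr P) (pr Q) (pr R) = tri_lin (pr P) (pr Q) (pr R)"
      by (rule less.hyps[OF _ h_subring ph[OF P] ph[OF Q] ph[OF R]])
    \<comment> \<open>From here the polarizations are restored one at a time; the exchange acts on
      the leading position only, so cyclic rotations come in between.\<close>
    then have "tri P (pr Q) (pr R) = tri_lin P (pr Q) (pr R)"
      by (rule exch[OF P pol_pr[OF Q] pol_pr[OF R]])
    then have "tri (pr R) P (pr Q) = tri_lin (pr R) P (pr Q)"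
      using SL.tri_cyclic[OF P pol_pr[OF Q] pol_pr[OF R]] cyc[OF P pol_pr[OF Q] pol_pr[OF R]] by simp
    then have "tri R P (pr Q) = tri_lin R P (pr Q)"
      by (rule exch[OF R P pol_pr[OF Q]])
    then have "tri (pr Q) R P = tri_lin (pr Q) R P"
      using SL.tri_cyclic[OF R P pol_pr[OF Q]] cyc[OF R P pol_pr[OF Q]] by simp
    then have "tri Q R P = tri_lin Q R P"
      by (rule exch[OF Q R P])
    then show ?thesis
      using SL.tri_cyclic[OF Q R P] cyc[OF Q R P] by simp
  qed
qed

end

theorem theorem1p4:
  fixes p :: nat and L :: "'a lie_ring" and f :: "'a \<Rightarrow> complex"
    and P1 P2 P3 :: "'a set"
  assumes "prime p" and "odd p"
    and "lie_ring L" and "finite (lcarrier L)"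
    and "\<exists>k. card (lcarrier L) = p ^ k"
    and "nilpotent_class_less L p"
    and "is_char L f"
    and "polarization L f P1" and "polarization L f P2" and "polarization L f P3"
  shows "alpha L p f P1 P2 P3 =
         alpha (reduce L f) p reduce_char
           (reduce_pol L f P1) (reduce_pol L f P2) (reduce_pol L f P3)"
proof -
  interpret heis L p f
    by unfold_locales (use assms in auto)
  have P: "pol carr P1" "pol carr P2" "pol carr P3"
    using assms by (simp_all add: polarization_pol)
  have S: "lie_subring L carr" by (simp add: lie_subring_def add_subgroup_def)
  have PM: "H.pol (lcarrier M) (P1 \<times> Zs)" "H.pol (lcarrier M) (P2 \<times> Zs)" "H.pol (lcarrier M) (P3 \<times> Zs)"
    using pol_M[OF S] P by simp_all
  \<comment> \<open>Each of the three normalizing factors loses one \<open>\<zeta>\<close>, which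
    balances the factor \<open>\<zeta> ^ 3\<close> of the triple sum.\<close>
  have norm: "complex_of_real (1 / sqrt (real (card (P \<times> Zs) * card ((P \<times> Zs) \<inter> (Q \<times> Zs))))) =
      complex_of_real (1 / sqrt (real (card P * card (P \<inter> Q)))) / \<zeta>" for P Q
  proof -
    have "real (card (P \<times> Zs) * card ((P \<times> Zs) \<inter> (Q \<times> Zs))) = real (card P * card (P \<inter> Q)) * (real (card Zs))\<^sup>2"
      by (simp add: card_cartesian_product Times_Int_Times power2_eq_square)
    then have "sqrt (real (card (P \<times> Zs) * card ((P \<times> Zs) \<inter> (Q \<times> Zs)))) = sqrt (real (card P * card (P \<inter> Q))) * real (card Zs)"
      by (simp only: real_sqrt_mult) simp
    then show ?thesis by (simp only:) simp
  qed
  have "H.tri (P1 \<times> Zs) (P2 \<times> Zs) (P3 \<times> Zs) = \<zeta> ^ 3 * tri P1 P2 P3"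
    using tri_M[OF polD(5)[OF P(1)] polD(5)[OF P(2)] polD(5)[OF P(3)]] tri_eq_tri_lin[OF S P] by simp
  then show ?thesis
    unfolding reduce_pol_def alpha_tri[OF P] H.alpha_tri[OF PM] norm
    using zeta_nonzero by (simp add: power3_eq_cube)
qed

end
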